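(* Let $(a,b)\in\mathcal P$. If the map $f_{a,b}$ satisfies the finiteness condition, then the set $A_{a,b}$ (the set with finite rectangular structure constructed from the truncated orbits of $a$ and $b$ as described in the context) is the attractor for the map $F_{a,b}$, i.e. $D_{a,b}=A_{a,b}$.
   Context: $T(x)=x+1$ and $S(x)=-1/x$, acting on $\bar{\mathbb R}=\mathbb R\cup\{\infty\}$ and generating the modular group $SL(2,\mathbb Z)$. $\mathcal P=\{(a,b)\in\mathbb R^2 : a\le 0\le b,\ b-a\ge 1,\ -ab\le 1\}$; the degenerate cases $a=0$, $b=0$, $(a,b)=(-1,1)$ are excluded. $f=f_{a,b}$ is $f(x)=\rho(x)x$ with $\rho(x)=T$ if $x<a$, $\rho(x)=S$ if $a\le x<b$, $\rho(x)=T^{-1}$ if $x\ge b$; and on $\bar{\mathbb R}^2\setminus\Delta$, $\Delta=\{x=y\}$, $F_{a,b}(x,y)=(\rho(y)x,\rho(y)y)$. Orbits: the upper orbit of $a$ is $\{f^n(Sa)\}_{n\ge0}$, the lower orbit of $a$ is $\{f^n(Ta)\}_{n\ge0}$, the lower orbit of $b$ is $\{f^n(Sb)\}_{n\ge0}$, the upper orbit of $b$ is $\{f^n(T^{-1}b)\}_{n\ge0}$. Convention: a lower orbit hitting $a$ (resp. $b$) continues with $Ta$ (resp. $Sb$); an upper orbit hitting $a$ (resp. $b$) continues with $Sa$ (resp. $T^{-1}b$). Cycles: $a$ has the cycle property if $f^{m_1}(Sa)=f^{k_1}(Ta)$ for some non-negative integers $m_1,k_1$ (the cycle being taken up to the first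 common value); its upper part is $\{Sa,\dots,f^{m_1-1}Sa\}$, its lower part $\{Ta,\dots,f^{k_1-1}Ta\}$; it is strong if $T^{-1}f^{-k_1}f^{m_1}S=\mathrm{Id}$ (powers of $f$ denoting the products of $T,S,T^{-1}$ applied along the orbit), weak otherwise. Likewise $b$ has the cycle property if $f^{k_2}(Sb)=f^{m_2}(T^{-1}b)$, with lower part $\{Sb,\dots,f^{k_2-1}Sb\}$ and upper part $\{T^{-1}b,\dots,f^{m_2-1}T^{-1}b\}$, strong if $Tf^{-m_2}f^{k_2}S=\mathrm{Id}$, weak otherwise. Truncated orbits: for $c\in\{a,b\}$, $\mathcal L_c$ (resp. $\mathcal U_c$) is the whole lower (resp. upper) orbit of $c$ (up to the first repeat, if eventually periodic) if $c$ has no cycle property; the lower (resp. upper) part of the $c$-cycle if $c$ has the strong cycle property; the lower (resp. upper) part together with $0$ if $c$ has the weak cycle property. $f_{a,b}$ satisfies the finiteness condition if $\mathcal L_a,\mathcal L_b,\mathcal U_a,\mathcal U_b$ are all finite. Put $\mathcal U_{a,b}=\mathcal U_a\cup\mathcal U_b$ (upper levels), $\mathcal L_{a,b}=\mathcal L_a\cup\mathcal L_b$ (lower levels), a value belonging to both orbits being counted twice. Construction of $A_{a,b}$: let $y_\ell$ be the level of $\mathcal L_{a,b}$ closest to $Sb$ with $y_\ell\ge Sb$ (other than the level $Sb\in\mathcal L_b$ itself) and $y_u$ the level of $\mathcal U_{a,b}$ closest to $Sa$ with $y_u\le Sa$ (other than $Sa\in\mathcal U_a$ itself). Take rays $[-\infty,x_b]\times\{b\}$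 and $[x_a,\infty]\times\{a\}$ with unknown $x_a,x_b$. Transport the first ray by $S$ to level $Sb$ and by $T^{-1}$ to level $T^{-1}b$, and then along the levels of $\mathcal L_b$ and $\mathcal U_b$ respectively, applying to the segment the same generators $T,S,T^{-1}$ that are applied to the level; transport the second ray by $T$ to level $Ta$ and by $S$ to level $Sa$, and then along $\mathcal L_a$ and $\mathcal U_a$ likewise. This assigns to each level $y$ a horizontal segment $I_y\times\{y\}$. The numbers $x_a\ge1$, $x_b\le-1$ are the unique solution of the two equations: the right endpoint of the segment at level $Sb$ equals the left endpoint of the segment at level $y_\ell$, and the left endpoint of the segment at level $Sa$ equals the right endpoint of the segment at level $y_u$. Consecutive segments of $\mathcal U_{a,b}$ (resp. of $\mathcal L_{a,b}$) then have matching endpoints and form the graph of a non-decreasing step-function; $A_{a,b}=A^u_{a,b}\cup A^\ell_{a,b}$, where $A^u_{a,b}=\bigcup_{y\in\mathcal U_{a,b}}I_y\times[y,\infty]$ and $A^\ell_{a,b}=\bigcup_{y\in\mathcal L_{a,b}}I_y\times[-\infty,y]$. Attractor: $D_{a,b}=\bigcap_{n\ge0}D_n$, $D_n=\bigcap_{i=0}^nF_{a,b}^i(\Theta_{a,b})$, where $\Theta_{a,b}=\Theta^u_{a,b}\cup\Theta^l_{a,b}\subset\bar{\mathbb R}^2\setminus\Delta$ with $\Theta^u_{a,b}=[-\infty,-1]\times[b-1,\infty]\cup[-1,0]\times[-\frac1a,\infty]$ if $b\ge1$; $\Theta^u_{a,b}=[-\infty,-1]\times[b-1,\infty]\cup[-1,0]\times[\min(-\frac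 b{b-1},-\frac1a),\infty]\cup[0,1]\times[-\frac1{b-1},\infty]$ if $0<b<1$; $\Theta^l_{a,b}=[0,1]\times[-\infty,-\frac1b]\cup[1,\infty]\times[-\infty,a+1]$ if $a\le-1$; $\Theta^l_{a,b}=[-1,0]\times[-\infty,-\frac1{a+1}]\cup[0,1]\times[-\infty,\max(\frac a{a+1},-\frac1b)]\cup[1,\infty]\times[-\infty,a+1]$ if $-1<a<0$. In intervals $\pm\infty$ both denote the point $\infty$; points of $\Delta$ are disregarded.
   Formalization: D=A is proved up to edges: D is contained in A and A∖D lies in the finitely many segments I_y×{y}, y a lower level; a cycle is strong if some common value gives Id; common values a, b without Id, and ∞, close no cycle; levels of equal value are ordered by segment position. *)

theory Defs
  imports Complex_Main "HOL-Library.Extended_Real"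
begin

section \<open>The extended real line and the modular generators\<close>

datatype rbar = Fin real | Infty

primrec T :: "rbar \<Rightarrow> rbar" where
  "T (Fin x) = Fin (x + 1)"
| "T Infty = Infty"

primrec Tinv :: "rbar \<Rightarrow> rbar" where
  "Tinv (Fin x) = Fin (x - 1)"
| "Tinv Infty = Infty"

primrec S :: "rbar \<Rightarrow> rbar" where
  "S (Fin x) = (if x = 0 then Infty else Fin (- 1 / x))"
| "S Infty = Fin 0"

text \<open>
  Intervals of the circle \<^typ>\<open>rbar\<close> are written with extended real endpoints, where both
  infinities stand for the single point \<^term>\<open>Infty\<close>.  The functions \<open>lo\<close> and \<open>hi\<close> read a point
  as the left, respectively right, endpoint of such an interval.
\<close>

definition of_ereal :: "ereal \<Rightarrow> rbar" where
  "of_ereal e = (if \<bar>e\<bar> = \<infinity> then Infty else Fin (real_of_ereal e))"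

definition ivl :: "ereal \<Rightarrow> ereal \<Rightarrow> rbar set" where
  "ivl p q = of_ereal ` {p..q}"

primrec lo :: "rbar \<Rightarrow> ereal" where
  "lo (Fin x) = ereal x"
| "lo Infty = - \<infinity>"

primrec hi :: "rbar \<Rightarrow> ereal" where
  "hi (Fin x) = ereal x"
| "hi Infty = \<infinity>"

section \<open>Parameters, the natural extension map and its attractor\<close>

definition param_set :: "(real \<times> real) set" where
  "param_set = {(a, b). a \<le> 0 \<and> 0 \<le> b \<and> b - a \<ge> 1 \<and> - (a * b) \<le> 1}"

text \<open>
  \<open>rho a b y\<close> is the generator applied at \<open>y\<close>.  At infinity both translations fix \<open>y\<close>; we count
  infinity as \<open>\<ge> b\<close>.
\<close>

primrec rho :: "real \<Rightarrow> real \<Rightarrow> rbar \<Rightarrow> rbar \<Rightarrow> rbar" where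
  "rho a b (Fin y) = (if y < a then T else if y < b then S else Tinv)"
| "rho a b Infty = Tinv"

definition F :: "real \<Rightarrow> real \<Rightarrow> rbar \<times> rbar \<Rightarrow> rbar \<times> rbar" where
  "F a b = (\<lambda>(x, y). (rho a b y x, rho a b y y))"

definition diagonal :: "(rbar \<times> rbar) set" where
  "diagonal = {(x, y). x = y}"

definition Theta_u :: "real \<Rightarrow> real \<Rightarrow> (rbar \<times> rbar) set" where
  "Theta_u a b =
     (if b \<ge> 1 then
        ivl (- \<infinity>) (- 1) \<times> ivl (ereal (b - 1)) \<infinity>
        \<union> ivl (- 1) 0 \<times> ivl (ereal (- 1 / a)) \<infinity>
      else
        ivl (- \<infinity>) (- 1) \<times> ivl (ereal (b - 1)) \<infinity>
        \<union> ivl (- 1) 0 \<times> ivl (ereal (min (- b / (b - 1)) (- 1 / a))) \<infinity>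
        \<union> ivl 0 1 \<times> ivl (ereal (- 1 / (b - 1))) \<infinity>)"

definition Theta_l :: "real \<Rightarrow> real \<Rightarrow> (rbar \<times> rbar) set" where
  "Theta_l a b =
     (if a \<le> - 1 then
        ivl 0 1 \<times> ivl (- \<infinity>) (ereal (- 1 / b))
        \<union> ivl 1 \<infinity> \<times> ivl (- \<infinity>) (ereal (a + 1))
      else
        ivl (- 1) 0 \<times> ivl (- \<infinity>) (ereal (- 1 / (a + 1)))
        \<union> ivl 0 1 \<times> ivl (- \<infinity>) (ereal (max (a / (a + 1)) (- 1 / b)))
        \<union> ivl 1 \<infinity> \<times> ivl (- \<infinity>) (ereal (a + 1)))"

definition Theta :: "real \<Rightarrow> real \<Rightarrow> (rbar \<times> rbar) set" where
  "Theta a b = (Theta_u a b \<union> Theta_l a b) - diagonal"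

definition D_n :: "real \<Rightarrow> real \<Rightarrow> nat \<Rightarrow> (rbar \<times> rbar) set" where
  "D_n a b n = (\<Inter>i\<in>{0..n}. (F a b ^^ i) ` Theta a b)"

definition attractor :: "real \<Rightarrow> real \<Rightarrow> (rbar \<times> rbar) set" where
  "attractor a b = (\<Inter>n. D_n a b n)"

section \<open>Upper and lower orbits of the discontinuity points\<close>

text \<open>
  On lower orbits the value \<open>a\<close> is followed by \<open>T a\<close> and the value \<open>b\<close> by \<open>S b\<close>; on upper orbits
  \<open>a\<close> is followed by \<open>S a\<close> and \<open>b\<close> by \<open>Tinv b\<close>, which is what \<^const>\<open>rho\<close> does.
\<close>

primrec rho_low :: "real \<Rightarrow> real \<Rightarrow> rbar \<Rightarrow> rbar \<Rightarrow> rbar" where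
  "rho_low a b (Fin y) = (if y \<le> a then T else if y \<le> b then S else Tinv)"
| "rho_low a b Infty = Tinv"

text \<open>
  \<open>walk r g c n\<close> is the product of generators (as a transformation of the circle) that leads from
  \<open>c\<close> to the \<open>n\<close>-th point \<open>walk r g c n c\<close> of the orbit starting at \<open>g c\<close>.
\<close>

primrec walk ::
  "(rbar \<Rightarrow> rbar \<Rightarrow> rbar) \<Rightarrow> (rbar \<Rightarrow> rbar) \<Rightarrow> rbar \<Rightarrow> nat \<Rightarrow> rbar \<Rightarrow> rbar" where
  "walk r g c 0 = g"
| "walk r g c (Suc n) = r (walk r g c n c) \<circ> walk r g c n"

datatype disc = At_a | At_b

primrec pt :: "real \<Rightarrow> real \<Rightarrow> disc \<Rightarrow> rbar" where
  "pt a b At_a = Fin a"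
| "pt a b At_b = Fin b"

primrec upper_walk :: "real \<Rightarrow> real \<Rightarrow> disc \<Rightarrow> nat \<Rightarrow> rbar \<Rightarrow> rbar" where
  "upper_walk a b At_a = walk (rho a b) S (Fin a)"
| "upper_walk a b At_b = walk (rho a b) Tinv (Fin b)"

primrec lower_walk :: "real \<Rightarrow> real \<Rightarrow> disc \<Rightarrow> nat \<Rightarrow> rbar \<Rightarrow> rbar" where
  "lower_walk a b At_a = walk (rho_low a b) T (Fin a)"
| "lower_walk a b At_b = walk (rho_low a b) S (Fin b)"

definition upper_orbit :: "real \<Rightarrow> real \<Rightarrow> disc \<Rightarrow> nat \<Rightarrow> rbar" where
  "upper_orbit a b c n = upper_walk a b c n (pt a b c)"

definition lower_orbit :: "real \<Rightarrow> real \<Rightarrow> disc \<Rightarrow> nat \<Rightarrow> rbar" where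
  "lower_orbit a b c n = lower_walk a b c n (pt a b c)"

section \<open>Cycles and truncated orbits\<close>

text \<open>
  Orbits that reach infinity have passed through \<open>0\<close> and met there already, so infinity is not
  admitted as a common value.
\<close>

definition common_value :: "real \<Rightarrow> real \<Rightarrow> disc \<Rightarrow> nat \<Rightarrow> nat \<Rightarrow> bool" where
  "common_value a b c m k \<longleftrightarrow>
     upper_orbit a b c m = lower_orbit a b c k \<and> upper_orbit a b c m \<noteq> Infty"

text \<open>
  With \<open>m = m\<^sub>1\<close> and \<open>k = k\<^sub>1\<close> the product below is \<open>T\<^sup>-\<^sup>1 f\<^sup>-\<^sup>k f\<^sup>m S\<close> for \<open>c = a\<close>; for \<open>c = b\<close> it is
  the inverse \<open>S\<^sup>-\<^sup>1 f\<^sup>-\<^sup>k f\<^sup>m T\<^sup>-\<^sup>1\<close> of \<open>T f\<^sup>-\<^sup>m f\<^sup>k S\<close>.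
\<close>

definition strong_end :: "real \<Rightarrow> real \<Rightarrow> disc \<Rightarrow> nat \<Rightarrow> nat \<Rightarrow> bool" where
  "strong_end a b c m k \<longleftrightarrow>
     common_value a b c m k \<and> inv (lower_walk a b c k) \<circ> upper_walk a b c m = id"

text \<open>
  At the values \<open>a\<close> and \<open>b\<close> an upper and a lower orbit continue differently, so (unless the
  product is the identity) hitting the same one of these two values does not close a cycle.  This
  matters only for special parameters with \<open>b = a + 1\<close>.
\<close>

definition weak_end :: "real \<Rightarrow> real \<Rightarrow> disc \<Rightarrow> nat \<Rightarrow> nat \<Rightarrow> bool" where
  "weak_end a b c m k \<longleftrightarrow>
     common_value a b c m k \<and> upper_orbit a b c m \<notin> {Fin a, Fin b}"

definition strong_cycle :: "real \<Rightarrow> real \<Rightarrow> disc \<Rightarrow> bool" where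
  "strong_cycle a b c \<longleftrightarrow> (\<exists>m k. strong_end a b c m k)"

definition weak_cycle :: "real \<Rightarrow> real \<Rightarrow> disc \<Rightarrow> bool" where
  "weak_cycle a b c \<longleftrightarrow> \<not> strong_cycle a b c \<and> (\<exists>m k. weak_end a b c m k)"

text \<open>
  The cycle is taken up to the first common value; if the cycle property is strong, up to the first
  common value at which the product is the identity.  (Two eventually periodic orbits may cross at
  a common value before they meet with trivial product.)
\<close>

definition cycle_end :: "real \<Rightarrow> real \<Rightarrow> disc \<Rightarrow> nat \<Rightarrow> nat \<Rightarrow> bool" where
  "cycle_end a b c = (if strong_cycle a b c then strong_end a b c else weak_end a b c)"

definition upper_length :: "real \<Rightarrow> real \<Rightarrow> disc \<Rightarrow> nat" where
  "upper_length a b c = (LEAST m. \<exists>k. cycle_end a b c m k)"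

definition lower_length :: "real \<Rightarrow> real \<Rightarrow> disc \<Rightarrow> nat" where
  "lower_length a b c = (LEAST k. cycle_end a b c (upper_length a b c) k)"

definition upper_trunc :: "real \<Rightarrow> real \<Rightarrow> disc \<Rightarrow> rbar set" where
  "upper_trunc a b c =
     (if strong_cycle a b c then upper_orbit a b c ` {..<upper_length a b c}
      else if weak_cycle a b c then insert (Fin 0) (upper_orbit a b c ` {..<upper_length a b c})
      else range (upper_orbit a b c))"

definition lower_trunc :: "real \<Rightarrow> real \<Rightarrow> disc \<Rightarrow> rbar set" where
  "lower_trunc a b c =
     (if strong_cycle a b c then lower_orbit a b c ` {..<lower_length a b c}
      else if weak_cycle a b c then insert (Fin 0) (lower_orbit a b c ` {..<lower_length a b c})
      else range (lower_orbit a b c))"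

definition finiteness_condition :: "real \<Rightarrow> real \<Rightarrow> bool" where
  "finiteness_condition a b \<longleftrightarrow> (\<forall>c. finite (upper_trunc a b c) \<and> finite (lower_trunc a b c))"

section \<open>Levels and their segments\<close>

text \<open>
  A level is tagged with the discontinuity point whose orbit it belongs to, so a value occurring in
  both orbits gives two levels.
\<close>

type_synonym level = "disc \<times> rbar"

definition upper_levels :: "real \<Rightarrow> real \<Rightarrow> level set" where
  "upper_levels a b = (SIGMA c:UNIV. upper_trunc a b c)"

definition lower_levels :: "real \<Rightarrow> real \<Rightarrow> level set" where
  "lower_levels a b = (SIGMA c:UNIV. lower_trunc a b c)"

text \<open>The product of generators that leads from the discontinuity point to (the first visit of) a level.\<close>

definition upper_map :: "real \<Rightarrow> real \<Rightarrow> level \<Rightarrow> rbar \<Rightarrow> rbar" where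
  "upper_map a b = (\<lambda>(c, y). upper_walk a b c (LEAST n. upper_orbit a b c n = y))"

definition lower_map :: "real \<Rightarrow> real \<Rightarrow> level \<Rightarrow> rbar \<Rightarrow> rbar" where
  "lower_map a b = (\<lambda>(c, y). lower_walk a b c (LEAST n. lower_orbit a b c n = y))"

primrec ray_left :: "real \<Rightarrow> real \<Rightarrow> disc \<Rightarrow> rbar" where
  "ray_left xa xb At_a = Fin xa"
| "ray_left xa xb At_b = Infty"

primrec ray_right :: "real \<Rightarrow> real \<Rightarrow> disc \<Rightarrow> rbar" where
  "ray_right xa xb At_a = Infty"
| "ray_right xa xb At_b = Fin xb"

definition ray :: "real \<Rightarrow> real \<Rightarrow> disc \<Rightarrow> rbar set" where
  "ray xa xb c = ivl (lo (ray_left xa xb c)) (hi (ray_right xa xb c))"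

text \<open>
  The generators preserve the cyclic orientation of the circle, hence carry the left (right)
  endpoint of a segment to the left (right) endpoint of its image.
\<close>

definition upper_left :: "real \<Rightarrow> real \<Rightarrow> real \<Rightarrow> real \<Rightarrow> level \<Rightarrow> rbar" where
  "upper_left a b xa xb l = upper_map a b l (ray_left xa xb (fst l))"

definition upper_right :: "real \<Rightarrow> real \<Rightarrow> real \<Rightarrow> real \<Rightarrow> level \<Rightarrow> rbar" where
  "upper_right a b xa xb l = upper_map a b l (ray_right xa xb (fst l))"

definition upper_seg :: "real \<Rightarrow> real \<Rightarrow> real \<Rightarrow> real \<Rightarrow> level \<Rightarrow> rbar set" where
  "upper_seg a b xa xb l = upper_map a b l ` ray xa xb (fst l)"

definition lower_left :: "real \<Rightarrow> real \<Rightarrow> real \<Rightarrow> real \<Rightarrow> level \<Rightarrow> rbar" where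
  "lower_left a b xa xb l = lower_map a b l (ray_left xa xb (fst l))"

definition lower_right :: "real \<Rightarrow> real \<Rightarrow> real \<Rightarrow> real \<Rightarrow> level \<Rightarrow> rbar" where
  "lower_right a b xa xb l = lower_map a b l (ray_right xa xb (fst l))"

definition lower_seg :: "real \<Rightarrow> real \<Rightarrow> real \<Rightarrow> real \<Rightarrow> level \<Rightarrow> rbar set" where
  "lower_seg a b xa xb l = lower_map a b l ` ray xa xb (fst l)"

text \<open>
  Levels are ordered by value, and two levels with the same value by the position of their
  segments: in the step function the one further to the left comes first.
\<close>

definition lower_before :: "real \<Rightarrow> real \<Rightarrow> real \<Rightarrow> real \<Rightarrow> level \<Rightarrow> level \<Rightarrow> bool" where
  "lower_before a b xa xb l l' \<longleftrightarrow>
     lo (snd l) < lo (snd l') \<or>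
     snd l = snd l' \<and> lo (lower_left a b xa xb l) < lo (lower_left a b xa xb l')"

definition upper_before :: "real \<Rightarrow> real \<Rightarrow> real \<Rightarrow> real \<Rightarrow> level \<Rightarrow> level \<Rightarrow> bool" where
  "upper_before a b xa xb u u' \<longleftrightarrow>
     hi (snd u) < hi (snd u') \<or>
     snd u = snd u' \<and> hi (upper_right a b xa xb u) < hi (upper_right a b xa xb u')"

definition level_Sb :: "real \<Rightarrow> level" where
  "level_Sb b = (At_b, S (Fin b))"

definition level_Sa :: "real \<Rightarrow> level" where
  "level_Sa a = (At_a, S (Fin a))"

text \<open>
  The levels \<open>y\<^sub>\<ell>\<close> and \<open>y\<^sub>u\<close>.  A copy of the value \<open>S b\<close> in the lower orbit of \<open>a\<close> is a candidate for
  \<open>y\<^sub>\<ell>\<close> exactly if its segment lies to the right of the segment of \<open>S b\<close> in the lower orbit of \<open>b\<close>;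
  it lies to the left if \<open>b = a + 1\<close>, where the lower orbit of \<open>a\<close> starts with \<open>T a = b\<close>.
  Similarly for \<open>S a\<close>.
\<close>

definition next_lower :: "real \<Rightarrow> real \<Rightarrow> real \<Rightarrow> real \<Rightarrow> level \<Rightarrow> bool" where
  "next_lower a b xa xb l \<longleftrightarrow>
     l \<in> lower_levels a b \<and> lower_before a b xa xb (level_Sb b) l \<and>
     (\<forall>l' \<in> lower_levels a b.
        lower_before a b xa xb (level_Sb b) l' \<longrightarrow> \<not> lower_before a b xa xb l' l)"

definition prev_upper :: "real \<Rightarrow> real \<Rightarrow> real \<Rightarrow> real \<Rightarrow> level \<Rightarrow> bool" where
  "prev_upper a b xa xb u \<longleftrightarrow>
     u \<in> upper_levels a b \<and> upper_before a b xa xb u (level_Sa a) \<and>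
     (\<forall>u' \<in> upper_levels a b.
        upper_before a b xa xb u' (level_Sa a) \<longrightarrow> \<not> upper_before a b xa xb u u')"

definition endpoint_equations :: "real \<Rightarrow> real \<Rightarrow> real \<Rightarrow> real \<Rightarrow> bool" where
  "endpoint_equations a b xa xb \<longleftrightarrow>
     xa \<ge> 1 \<and> xb \<le> - 1 \<and>
     (\<exists>l. next_lower a b xa xb l \<and>
        lower_right a b xa xb (level_Sb b) = lower_left a b xa xb l) \<and>
     (\<exists>u. prev_upper a b xa xb u \<and>
        upper_left a b xa xb (level_Sa a) = upper_right a b xa xb u)"

definition x_ab :: "real \<Rightarrow> real \<Rightarrow> real \<times> real" where
  "x_ab a b = (THE (xa, xb). endpoint_equations a b xa xb)"

section \<open>The set with finite rectangular structure\<close>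

definition A_upper :: "real \<Rightarrow> real \<Rightarrow> (rbar \<times> rbar) set" where
  "A_upper a b = (case x_ab a b of (xa, xb) \<Rightarrow>
     (\<Union>u\<in>upper_levels a b. upper_seg a b xa xb u \<times> ivl (hi (snd u)) \<infinity>))"

definition A_lower :: "real \<Rightarrow> real \<Rightarrow> (rbar \<times> rbar) set" where
  "A_lower a b = (case x_ab a b of (xa, xb) \<Rightarrow>
     (\<Union>l\<in>lower_levels a b. lower_seg a b xa xb l \<times> ivl (- \<infinity>) (lo (snd l))))"

definition A_set :: "real \<Rightarrow> real \<Rightarrow> (rbar \<times> rbar) set" where
  "A_set a b = (A_upper a b \<union> A_lower a b) - diagonal"

text \<open>
  The horizontal boundary segments of \<open>A_lower\<close>, i.e.\ the graph of its step function.
\<close>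

definition lower_edges :: "real \<Rightarrow> real \<Rightarrow> (rbar \<times> rbar) set" where
  "lower_edges a b = (case x_ab a b of (xa, xb) \<Rightarrow>
     (\<Union>l\<in>lower_levels a b. lower_seg a b xa xb l \<times> {snd l})) - diagonal"

text \<open>
  The attractor equals \<^const>\<open>A_set\<close> only up to these edges: \<^const>\<open>A_set\<close> is closed, but \<^const>\<open>F\<close> is defined on the half-open
  strips \<open>y < a\<close>, \<open>a \<le> y < b\<close>, \<open>b \<le> y\<close>, so the images of a closed set lack some upper edges.  For
  \<open>-1 < a < 0\<close> the attractor contains no point \<open>(x, a + 1)\<close> with \<open>0 < x\<close> finite, whereas
  \<^const>\<open>A_lower\<close> contains the whole ray from \<open>x\<^sub>a + 1\<close> to infinity at that level as soon as \<open>T a\<close> is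
  a level.
\<close>

lemma in_ivl_Fin: "Fin t \<in> ivl p q \<longleftrightarrow> p \<le> ereal t \<and> ereal t \<le> q"
proof
  assume "Fin t \<in> ivl p q"
  then obtain e where "e \<in> {p..q}" "\<bar>e\<bar> \<noteq> \<infinity>" "real_of_ereal e = t"
    unfolding ivl_def of_ereal_def by (auto split: if_splits)
  then show "p \<le> ereal t \<and> ereal t \<le> q"
    by (metis atLeastAtMost_iff ereal_real')
next
  assume "p \<le> ereal t \<and> ereal t \<le> q"
  then have "ereal t \<in> {p..q}" "of_ereal (ereal t) = Fin t"
    by (auto simp: of_ereal_def)
  then show "Fin t \<in> ivl p q"
    unfolding ivl_def by (metis imageI)
qed

lemma edge_not_in_attractor:
  assumes "- 1 < a" "a < 0" "b - a \<ge> 1" "0 < x"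
  shows "(Fin x, Fin (a + 1)) \<notin> attractor a b"
proof
  assume "(Fin x, Fin (a + 1)) \<in> attractor a b"
  then have "(Fin x, Fin (a + 1)) \<in> (F a b ^^ 1) ` Theta a b"
    unfolding attractor_def D_n_def by (metis INT_E UNIV_I atLeastAtMost_iff le_refl zero_le)
  then have "(Fin x, Fin (a + 1)) \<in> F a b ` Theta a b"
    by simp
  then obtain u v where th: "(u, v) \<in> Theta a b"
    and img: "rho a b v u = Fin x" "rho a b v v = Fin (a + 1)"
    by (auto simp: F_def)
  obtain y where v: "v = Fin y"
    using img by (cases v) auto
  consider "y < a" | "a \<le> y" "y < b" | "y \<ge> b" by linarith
  then show False
  proof cases
    case 1
    then show False using img v by simp
  next
    case 2
    then have "y \<noteq> 0" "- 1 / y = a + 1" using img v by (auto split: if_splits)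
    then have "y * (a + 1) = - 1" by (auto simp: field_simps)
    moreover have "y * (a + 1) \<ge> a * (a + 1)"
      using 2 assms by (intro mult_right_mono) auto
    moreover have "a * (a + 1) > - 1"
    proof -
      have "a * (a + 1) + 1 = (a + 1 / 2)\<^sup>2 + 3 / 4" by (simp add: power2_eq_square algebra_simps)
      then show ?thesis using zero_le_power2[of "a + 1 / 2"] by linarith
    qed
    ultimately show False by linarith
  next
    case 3
    then have y: "y = a + 2" using img v assms by auto
    obtain z where u: "u = Fin z" and z: "z = x + 1"
      using img v 3 assms by (cases u) auto
    have "a / (a + 1) < 0" "- 1 / b < 0" "- 1 / (a + 1) < 0"
      using assms by (auto simp: divide_neg_pos)
    then have "a / (a + 1) < a + 2" "- 1 / b < a + 2" "- 1 / (a + 1) < a + 2"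
      using assms by linarith+
    then show False
      using th assms unfolding Theta_def Theta_u_def Theta_l_def u v y z
      by (auto simp: in_ivl_Fin one_ereal_def zero_ereal_def split: if_splits)
  qed
qed

end

theory Submission
  imports Defs
begin

text \<open>
  Over each level \<open>y\<close> the attractor turns out to be an arc of the circle: the points \<open>x\<close> from a left wall
  \<open>l(y)\<close> through infinity to a right wall \<open>r(y)\<close>. The proof studies these two walls instead of the
  sets \<open>D_n\<close>.

  A row at level \<open>y\<close> is made of the images of the rows at the preimages of \<open>y\<close>. This turns invariance
  into a recursion for the left wall alone (\<open>lwall_S\<close>, \<open>lwall_T\<close>, \<open>lwall_top\<close>): follow the backward
  orbit of \<open>y\<close> by \<open>S\<close> below \<open>S b\<close> and by \<open>T\<inverse>\<close> above it, until a level beyond \<open>a + 1\<close> is reached, where the wall is at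
  infinity. In suitable charts each backward step is an isometry or shrinks a distance
  \<open>d\<close> to at most \<open>d / (1 + d)\<close>, so the recursion has only one solution. The reflection \<open>x \<mapsto> -x\<close> exchanges \<open>(a, b)\<close> with
  \<open>(-b, -a)\<close>, upper with lower orbits and left with right; the right wall is the
  mirror image of a left wall, and upper orbits are mirror images of lower orbits. As \<open>f\<close>
  jumps at \<open>a\<close> and \<open>b\<close>, every level is considered from the right and from the left.

  The proof has three parts.

  The attractor is the region between the right limits of the walls (\<open>attractor_eq_region\<close>). One
  inclusion is the contraction. For the other, the region must be covered by its own image, that is, the images of the pieces of
  the region must fit together. This is an identity between the walls, \<open>r \<circ> S = S \<circ> l\<close> and
  \<open>r \<circ> STS = STS \<circ> l\<close> on certain levels (\<open>walls_match_S\<close>, \<open>walls_match_M\<close>); each of the two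
  reduces to the other one step further back, and again the contraction decides.

  The left wall can only jump at the levels of the lower orbits of \<open>a\<close> and \<open>b\<close>, followed as long as the recursion leads
  back along them (\<open>lwall_agree\<close>). These live parts are the truncated orbits (\<open>trunc_eq\<close>): the upper and the lower
  orbit of a discontinuity point are linked by \<open>STS\<close> at a sequence of times until either
  they close up with trivial product, or both meet \<open>0\<close>, or this goes on for ever (\<open>cycle_trichotomy\<close>).

  Finally, the rays of the construction have to be chosen so that the segments transported along the live orbits fill the jumps
  of the wall exactly (\<open>ray_ends\<close>, \<open>ray_ends_both_exists\<close>). Such endpoints
  solve the endpoint equations (\<open>next_lower_match_exists\<close>), and these have at most one solution, since the two equations contract
  (\<open>endpoints_unique\<close>). So the rows of the rectangular set are the arcs between the left limit of
  the left wall and the right limit of the right wall, and it differs from the attractor only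
  inside the lower edges.
\<close>

section \<open>Arithmetic and order on the circle\<close>

text \<open>
  The mirror symmetry of the whole situation.
\<close>

definition neg :: "rbar \<Rightarrow> rbar" where
  "neg z = (case z of Fin x \<Rightarrow> Fin (- x) | Infty \<Rightarrow> Infty)"

lemma neg_simps [simp]: "neg (Fin x) = Fin (- x)" "neg Infty = Infty"
  by (auto simp: neg_def)

lemma neg_neg [simp]: "neg (neg z) = z"
  by (cases z) auto

lemma neg_eq_iff [simp]: "neg z = neg w \<longleftrightarrow> z = w"
  by (metis neg_neg)

lemma neg_eq_Fin_iff: "neg z = Fin x \<longleftrightarrow> z = Fin (- x)"
  by (cases z) auto

lemma neg_eq_Infty_iff [simp]: "neg z = Infty \<longleftrightarrow> z = Infty"
  by (cases z) auto

lemma neg_T: "neg (T z) = Tinv (neg z)"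
  by (cases z) auto

lemma neg_Tinv: "neg (Tinv z) = T (neg z)"
  by (cases z) auto

lemma neg_S: "neg (S z) = S (neg z)"
  by (cases z) auto

lemma T_Tinv [simp]: "T (Tinv z) = z"
  by (cases z) auto

lemma Tinv_T [simp]: "Tinv (T z) = z"
  by (cases z) auto

lemma S_S [simp]: "S (S z) = z"
  by (cases z) auto

text \<open>The relation \<open>(S T)\<^sup>3 = 1\<close> of the modular group.\<close>

lemma Tinv_S_Tinv: "Tinv (S (Tinv z)) = S (T (S z))"
  by (cases z) (auto simp: field_simps)

lemma T_S_T: "T (S (T z)) = S (Tinv (S z))"
  by (metis T_Tinv Tinv_S_Tinv S_S Tinv_T)

lemma STST: "S (T (S (T z))) = Tinv (S z)"
  using T_S_T[of z] by (metis S_S)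

lemma T_inj: "T z = T w \<longleftrightarrow> z = w"
  by (metis Tinv_T)

lemma Tinv_inj: "Tinv z = Tinv w \<longleftrightarrow> z = w"
  by (metis T_Tinv)

lemma S_inj: "S z = S w \<longleftrightarrow> z = w"
  by (metis S_S)

lemma T_eq_Infty_iff [simp]: "T z = Infty \<longleftrightarrow> z = Infty"
  by (cases z) auto

lemma hi_inj: "hi z = hi w \<longleftrightarrow> z = w"
  by (cases z; cases w) auto

lemma lo_inj: "lo z = lo w \<longleftrightarrow> z = w"
  by (cases z; cases w) auto

lemma hi_neg: "hi (neg z) = - lo z"
  by (cases z) auto

lemma lo_neg: "lo (neg z) = - hi z"
  by (cases z) auto

lemma hi_T_le_iff: "hi (T z) \<le> hi (T w) \<longleftrightarrow> hi z \<le> hi w"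
  by (cases z; cases w) auto

lemma one_le_hi: "1 \<le> hi z \<longleftrightarrow> (case z of Fin x \<Rightarrow> 1 \<le> x | Infty \<Rightarrow> True)"
  by (cases z) (auto simp: one_ereal_def)

lemma lo_eq_hi: "z \<noteq> Infty \<Longrightarrow> lo z = hi z"
  by (cases z) auto

lemma zero_less_hi: "0 < hi z \<longleftrightarrow> (case z of Fin x \<Rightarrow> 0 < x | Infty \<Rightarrow> True)"
  by (cases z) auto

lemma hi_S_le_iff:
  assumes "0 < hi z" "0 < hi w"
  shows "hi (S z) \<le> hi (S w) \<longleftrightarrow> hi z \<le> hi w"
  using assms by (cases z; cases w) (auto simp: zero_less_hi field_simps)

text \<open>
  Between \<open>-1\<close> and infinity the circle is ordered like an interval of extended reals; \<open>arc p q\<close> is an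
  interval for this order.  The two generators used on lower orbits carry arcs to arcs, \<open>S\<close> as long
  as \<open>0\<close> is not inside.
\<close>

definition arc :: "rbar \<Rightarrow> rbar \<Rightarrow> rbar set" where
  "arc p q = {z. hi p \<le> hi z \<and> hi z \<le> hi q}"

lemma T_image_arc: "T ` arc p q = arc (T p) (T q)"
proof -
  have "z \<in> T ` arc p q \<longleftrightarrow> z \<in> arc (T p) (T q)" for z
    unfolding arc_def image_def
    by (auto simp: hi_T_le_iff intro!: exI[of _ "Tinv z"]) (metis T_Tinv hi_T_le_iff)+
  then show ?thesis by blast
qed

lemma S_image_arc:
  assumes "0 < hi p" "hi p \<le> hi q"
  shows "S ` arc p q = arc (S p) (S q)"
proof -
  have sub: "S z \<in> arc (S p) (S q)" if "z \<in> arc p q" for z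
    using that assms unfolding arc_def
    by (auto simp: hi_S_le_iff dest: order.strict_trans2)
  have "z \<in> S ` arc p q" if "z \<in> arc (S p) (S q)" for z
  proof -
    have q: "0 < hi q" using assms by (rule order.strict_trans2)
    have le0: "hi (S q) \<le> 0" using q by (cases q) (auto simp: zero_less_hi)
    then have "hi z \<le> 0" using that unfolding arc_def by (auto dest: order.trans)
    then have pos: "0 < hi (S z)" by (cases z) (auto simp: zero_less_hi divide_neg_neg)
    have "S z \<in> arc p q"
      using that assms q pos hi_S_le_iff[of p "S z"] hi_S_le_iff[of "S z" q]
      unfolding arc_def by auto
    then show ?thesis by (metis S_S imageI)
  qed
  with sub show ?thesis by blast
qed

section \<open>The walls of the attractor\<close>

text \<open>
  A level is approached from the right (\<open>s = True\<close>) or from the left (\<open>s = False\<close>). Such a sided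
  level never coincides with a cut \<open>c\<close>, it lies on one side of it. With \<open>s = True\<close> this gives the convention of \<open>f\<close> and of
  the upper orbits, with \<open>s = False\<close> the convention of the lower orbits.
\<close>

definition below :: "bool \<Rightarrow> real \<Rightarrow> real \<Rightarrow> bool" where
  "below s y c \<longleftrightarrow> (if s then y < c else y \<le> c)"

lemma below_add: "below s (y + d) c \<longleftrightarrow> below s y (c - d)"
  by (auto simp: below_def)

lemma below_diff: "below s (y - d) c \<longleftrightarrow> below s y (c + d)"
  by (auto simp: below_def)

lemma below_le: "below s y c \<Longrightarrow> y \<le> c"
  by (auto simp: below_def split: if_splits)

lemma not_below_ge: "\<not> below s y c \<Longrightarrow> c \<le> y"
  by (auto simp: below_def split: if_splits)

lemma below_mono: "below s y c \<Longrightarrow> c \<le> d \<Longrightarrow> below s y d"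
  by (auto simp: below_def split: if_splits)

lemma less_below: "y < c \<Longrightarrow> below s y c"
  by (auto simp: below_def)

lemma not_below_less: "c < y \<Longrightarrow> \<not> below s y c"
  by (auto simp: below_def)

lemma below_uminus: "below (\<not> s) (- y) c \<longleftrightarrow> \<not> below s y (- c)"
  by (auto simp: below_def)

text \<open>Order of sided points: \<open>y\<close> from the left precedes \<open>y\<close> from the right.\<close>

definition precedes :: "bool \<Rightarrow> real \<Rightarrow> bool \<Rightarrow> real \<Rightarrow> bool" where
  "precedes s y s' y' \<longleftrightarrow> y < y' \<or> y = y' \<and> (s \<longrightarrow> s')"

lemma precedes_below: "precedes s y s' y' \<Longrightarrow> below s' y' c \<Longrightarrow> below s y c"
  by (auto simp: precedes_def below_def split: if_splits)

lemma precedes_diff: "precedes s y s' y' \<Longrightarrow> precedes s (y - d) s' (y' - d)"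
  by (auto simp: precedes_def)

lemma precedes_inv:
  assumes "precedes s y s' y'" "y < 0" "y' < 0"
  shows "precedes s (- 1 / y) s' (- 1 / y')"
  using assms by (auto simp: precedes_def field_simps)

text \<open>
  The clamps \<open>max 1\<close> and \<open>max 0\<close> make the step preserve the functions that increase with the sided level, so
  that the least fixed point increases too; \<open>ewall_S\<close> and \<open>ewall_T\<close> give the recursion without them.
\<close>

definition wall_step :: "real \<Rightarrow> real \<Rightarrow> (bool \<Rightarrow> real \<Rightarrow> ereal) \<Rightarrow> bool \<Rightarrow> real \<Rightarrow> ereal" where
  "wall_step a b f s y =
     (if below s y (- 1 / b) then - inverse (max 1 (f s (- 1 / y)))
      else if below s y (a + 1) then max 0 (f s (y - 1) + 1)
      else \<infinity>)"

lemma mono_wall_step: "mono (wall_step a b)"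
proof (rule monoI)
  fix f g :: "bool \<Rightarrow> real \<Rightarrow> ereal"
  assume le: "f \<le> g"
  then have le': "f s y \<le> g s y" for s y by (simp add: le_fun_def)
  have "inverse (max 1 (g s y)) \<le> inverse (max 1 (f s y))" for s y
    by (rule ereal_inverse_antimono[OF _ max.mono[OF order.refl le']]) (simp add: le_max_iff_disj)
  moreover have "max 0 (f s y + 1) \<le> max 0 (g s y + 1)" for s y
    by (intro max.mono add_mono le') auto
  ultimately show "wall_step a b f \<le> wall_step a b g"
    by (auto simp: wall_step_def le_fun_def)
qed

definition ewall :: "real \<Rightarrow> real \<Rightarrow> bool \<Rightarrow> real \<Rightarrow> ereal" where
  "ewall a b = lfp (wall_step a b)"

lemma ewall_unfold: "ewall a b s y = wall_step a b (ewall a b) s y"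
  unfolding ewall_def by (metis lfp_unfold mono_wall_step)

definition lwall :: "real \<Rightarrow> real \<Rightarrow> bool \<Rightarrow> real \<Rightarrow> rbar" where
  "lwall a b s y = of_ereal (ewall a b s y)"

text \<open>
  The mirror image of the left wall for the parameters \<open>(-b, -a)\<close>; the reflection also exchanges the two sides of a level.
\<close>

definition rwall :: "real \<Rightarrow> real \<Rightarrow> bool \<Rightarrow> real \<Rightarrow> rbar" where
  "rwall a b s y = neg (lwall (- b) (- a) (\<not> s) (- y))"

lemma inverse_max_one: "0 \<le> inverse (max 1 (e::ereal))" "inverse (max 1 (e::ereal)) \<le> 1"
proof -
  show "0 \<le> inverse (max 1 e)"
    by (cases e) (auto simp: max_def)
  have "inverse (max 1 e) \<le> inverse (1::ereal)"
    by (rule ereal_inverse_antimono) auto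
  then show "inverse (max 1 e) \<le> 1" by (simp add: one_ereal_def)
qed

lemma hi_of_ereal: "e \<noteq> - \<infinity> \<Longrightarrow> hi (of_ereal e) = e"
  by (cases e) (auto simp: of_ereal_def)

lemma T_of_ereal: "e \<noteq> - \<infinity> \<Longrightarrow> T (of_ereal e) = of_ereal (e + 1)"
  by (cases e) (auto simp: of_ereal_def one_ereal_def)

lemma S_of_ereal: "1 \<le> e \<Longrightarrow> S (of_ereal e) = of_ereal (- inverse e)"
  by (cases e) (auto simp: of_ereal_def one_ereal_def divide_inverse)

locale ab =
  fixes a b :: real
  assumes a_neg: "a < 0" and b_pos: "0 < b" and gap: "b - a \<ge> 1" and prod: "- (a * b) \<le> 1"
begin

lemma mirror: "ab (- b) (- a)"
  using a_neg b_pos gap prod by unfold_locales (auto simp: mult.commute)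

lemma Sb_neg: "- 1 / b < 0"
  using b_pos by simp

lemma Sa_pos: "0 < - 1 / a"
  using a_neg by simp

lemma Sb_le_a: "- 1 / b \<le> a"
  using prod b_pos by (simp add: field_simps)

lemma b_le_Sa: "b \<le> - 1 / a"
  using prod a_neg by (simp add: field_simps)

lemma Sb_less_a1: "- 1 / b < a + 1"
  using Sb_le_a by linarith

lemma below_Sb: "y < 0 \<Longrightarrow> below s (- 1 / y) b \<longleftrightarrow> below s y (- 1 / b)"
  using b_pos by (auto simp: below_def field_simps)

lemma ewall_ge_m1: "- 1 \<le> ewall a b s y"
proof -
  have "- 1 \<le> wall_step a b (ewall a b) s y"
    using inverse_max_one(2)[of "ewall a b s (- 1 / y)"]
    by (auto simp: wall_step_def ereal_minus_le_minus le_max_iff_disj)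
  then show ?thesis by (simp add: ewall_unfold[symmetric])
qed

lemma ewall_not_minf: "ewall a b s y \<noteq> - \<infinity>"
  using ewall_ge_m1[of s y] by (auto simp: one_ereal_def)

lemma ewall_T:
  assumes "\<not> below s y (- 1 / b)" "below s y (a + 1)"
  shows "ewall a b s y = ewall a b s (y - 1) + 1"
proof -
  have "0 \<le> ewall a b s (y - 1) + 1"
    using ewall_ge_m1[of s "y - 1"] by (cases "ewall a b s (y - 1)") (auto simp: one_ereal_def)
  then show ?thesis
    using assms ewall_unfold[of a b s y] by (simp add: wall_step_def max_def)
qed

lemma ewall_ge_0: "\<not> below s y (- 1 / b) \<Longrightarrow> 0 \<le> ewall a b s y"
  by (subst ewall_unfold) (simp add: wall_step_def)

lemma ewall_top: "\<not> below s y (- 1 / b) \<Longrightarrow> \<not> below s y (a + 1) \<Longrightarrow> ewall a b s y = \<infinity>"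
  by (subst ewall_unfold) (simp add: wall_step_def)

lemma ewall_ge_1:
  assumes "0 \<le> y"
  shows "1 \<le> ewall a b s y"
proof -
  have nb: "\<not> below s y (- 1 / b)" using assms Sb_neg by (intro not_below_less) linarith
  show ?thesis
  proof (cases "below s y (a + 1)")
    case False
    then show ?thesis using nb ewall_top by simp
  next
    case True
    have e: "ewall a b s y = ewall a b s (y - 1) + 1" using True nb ewall_T by simp
    show ?thesis
    proof (cases "below s (y - 1) (- 1 / b)")
      case False
      then have "0 \<le> ewall a b s (y - 1)" by (rule ewall_ge_0)
      then show ?thesis unfolding e by (cases "ewall a b s (y - 1)") (auto simp: one_ereal_def)
    next
      case True2: True
      \<comment> \<open>here \<open>1 < b\<close>, and \<open>S (y - 1) \<ge> 1\<close> lies above all lower levels\<close>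
      have y1: "y - 1 \<le> a" using True below_le[of s y "a + 1"] by simp
      then have "y < 1" using a_neg by linarith
      then have "1 \<le> - 1 / (y - 1)" using assms by (simp add: field_simps)
      then have "a + 1 < - 1 / (y - 1)" "- 1 / b < - 1 / (y - 1)"
        using a_neg Sb_neg by linarith+
      then have "ewall a b s (- 1 / (y - 1)) = \<infinity>" by (intro ewall_top not_below_less)
      then have "ewall a b s (y - 1) = 0"
        using True2 ewall_unfold[of a b s "y - 1"] by (simp add: wall_step_def max_def)
      then show ?thesis using e by simp
    qed
  qed
qed

lemma ewall_S:
  assumes "below s y (- 1 / b)"
  shows "ewall a b s y = - inverse (ewall a b s (- 1 / y))"
proof -
  have "y < 0" using assms below_le Sb_neg by (meson order.strict_trans1)
  then have "1 \<le> ewall a b s (- 1 / y)" by (intro ewall_ge_1) (simp add: field_simps)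
  then show ?thesis using assms ewall_unfold[of a b s y] by (simp add: wall_step_def max_def)
qed

lemma hi_lwall: "hi (lwall a b s y) = ewall a b s y"
  unfolding lwall_def by (rule hi_of_ereal) (rule ewall_not_minf)

subsection \<open>Recursion along backward orbits\<close>

lemma lwall_S: "below s y (- 1 / b) \<Longrightarrow> lwall a b s y = S (lwall a b s (- 1 / y))"
proof -
  assume A: "below s y (- 1 / b)"
  then have "y < 0" using below_le Sb_neg by (meson order.strict_trans1)
  then have "1 \<le> ewall a b s (- 1 / y)" by (intro ewall_ge_1) (simp add: field_simps)
  then show ?thesis unfolding lwall_def by (simp add: S_of_ereal ewall_S[OF A])
qed

lemma lwall_T:
  "\<not> below s y (- 1 / b) \<Longrightarrow> below s y (a + 1) \<Longrightarrow> lwall a b s y = T (lwall a b s (y - 1))"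
  unfolding lwall_def by (simp add: T_of_ereal ewall_not_minf ewall_T)

lemma lwall_top: "\<not> below s y (a + 1) \<Longrightarrow> lwall a b s y = Infty"
proof -
  assume A: "\<not> below s y (a + 1)"
  then have "\<not> below s y (- 1 / b)" using below_mono[of s y "- 1 / b" "a + 1"] Sb_less_a1 by auto
  with A show ?thesis unfolding lwall_def by (simp add: ewall_top of_ereal_def)
qed

lemma lwall_zone1: "below s y (- 1 / b) \<Longrightarrow> - 1 \<le> hi (lwall a b s y) \<and> hi (lwall a b s y) \<le> 0"
proof -
  assume "below s y (- 1 / b)"
  then have "ewall a b s y = - inverse (max 1 (ewall a b s (- 1 / y)))"
    using ewall_unfold[of a b s y] by (simp add: wall_step_def)
  then have "ewall a b s y \<le> 0"
    using inverse_max_one(1)[of "ewall a b s (- 1 / y)"] by (metis ereal_uminus_le_0_iff)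
  then show ?thesis unfolding hi_lwall using ewall_ge_m1 by blast
qed

lemma lwall_zone2: "\<not> below s y (- 1 / b) \<Longrightarrow> 0 \<le> hi (lwall a b s y)"
  unfolding hi_lwall by (rule ewall_ge_0)

lemma lwall_zone3: "0 \<le> y \<Longrightarrow> 1 \<le> hi (lwall a b s y)"
  unfolding hi_lwall by (rule ewall_ge_1)

lemma lwall_ge_m1: "- 1 \<le> hi (lwall a b s y)"
  unfolding hi_lwall by (rule ewall_ge_m1)

text \<open>
  Only the top value is infinite: each \<open>T\<inverse>\<close> lowers the level by one, so finitely many of them lead
  below \<open>S b\<close>, where the wall is at most \<open>0\<close>.
\<close>

lemma lwall_finite:
  assumes "below s y (a + 1)"
  shows "\<exists>x. lwall a b s y = Fin x"
proof -
  have z1: "\<exists>x. lwall a b s y = Fin x" if "below s y (- 1 / b)" for y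
    using lwall_zone1[OF that] by (cases "lwall a b s y") auto
  have main: "\<exists>x. lwall a b s y = Fin x" if "below s y (a + 1)" "y < - 1 / b + real n" for n y
    using that
  proof (induction n arbitrary: y)
    case 0
    then show ?case by (intro z1) (simp add: less_below)
  next
    case (Suc n)
    show ?case
    proof (cases "below s y (- 1 / b)")
      case False
      have "below s (y - 1) (a + 1)" using Suc.prems(1) by (auto simp: below_diff intro: below_mono)
      then obtain x where "lwall a b s (y - 1) = Fin x" using Suc by force
      then show ?thesis using lwall_T[OF False Suc.prems(1)] by simp
    qed (rule z1)
  qed
  obtain n :: nat where "y - (- 1 / b) < real n" using reals_Archimedean2 by blast
  then have "y < - 1 / b + real n" by linarith
  with assms show ?thesis by (rule main)
qed

lemma lwall_eq_Infty_iff: "lwall a b s y = Infty \<longleftrightarrow> \<not> below s y (a + 1)"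
  using lwall_top lwall_finite by force

text \<open>
  The functions that increase with the sided level are closed under the recursion step and under suprema.
\<close>

lemma lwall_mono:
  assumes "precedes s y s' y'"
  shows "hi (lwall a b s y) \<le> hi (lwall a b s' y')"
proof -
  let ?P = "\<lambda>f :: bool \<Rightarrow> real \<Rightarrow> ereal. \<forall>s y s' y'. precedes s y s' y' \<longrightarrow> f s y \<le> f s' y'"
  have "?P (lfp (wall_step a b))"
  proof (rule lfp_ordinal_induct[OF mono_wall_step])
    fix f assume P: "?P f"
    show "?P (wall_step a b f)"
    proof (intro allI impI)
      fix s y s' y' assume pr: "precedes s y s' y'"
      show "wall_step a b f s y \<le> wall_step a b f s' y'"
      proof (cases "below s' y' (- 1 / b)")
        case True
        then have b: "below s y (- 1 / b)" by (rule precedes_below[OF pr])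
        have "y < 0" "y' < 0" using True b below_le Sb_neg by (meson order.strict_trans1)+
        then have "f s (- 1 / y) \<le> f s' (- 1 / y')" using P precedes_inv[OF pr] by blast
        then have "inverse (max 1 (f s' (- 1 / y'))) \<le> inverse (max 1 (f s (- 1 / y)))"
          by (intro ereal_inverse_antimono) (auto intro: max.mono simp: le_max_iff_disj)
        then show ?thesis using b True by (simp add: wall_step_def)
      next
        case F1: False
        have nn: "0 \<le> wall_step a b f s' y'" using F1 by (simp add: wall_step_def)
        show ?thesis
        proof (cases "below s y (- 1 / b)")
          case True
          then have "wall_step a b f s y \<le> 0"
            using inverse_max_one(1) by (simp add: wall_step_def ereal_uminus_le_0_iff)
          then show ?thesis using nn by (rule order.trans)
        next
          case F2: False
          show ?thesis
          proof (cases "below s' y' (a + 1)")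
            case True
            then have b: "below s y (a + 1)" by (rule precedes_below[OF pr])
            have "f s (y - 1) \<le> f s' (y' - 1)" using P precedes_diff[OF pr] by blast
            then have "max 0 (f s (y - 1) + 1) \<le> max 0 (f s' (y' - 1) + 1)"
              by (intro max.mono add_mono) auto
            then show ?thesis using F1 F2 True b by (simp add: wall_step_def)
          next
            case False
            then show ?thesis using F1 by (simp add: wall_step_def)
          qed
        qed
      qed
    qed
  next
    fix M :: "(bool \<Rightarrow> real \<Rightarrow> ereal) set"
    assume "\<forall>f\<in>M. ?P f"
    then show "?P (Sup M)"
      by (fastforce simp: Sup_fun_def image_image intro!: SUP_mono)
  qed
  then show ?thesis unfolding hi_lwall ewall_def using assms by blast
qed

lemma lwall_sides: "hi (lwall a b False y) \<le> hi (lwall a b True y)"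
  by (rule lwall_mono) (simp add: precedes_def)

end

section \<open>The right wall\<close>

context ab
begin

lemma rwall_S: "\<not> below s y (- 1 / a) \<Longrightarrow> rwall a b s y = S (rwall a b s (- 1 / y))"
proof -
  interpret m: ab "- b" "- a" by (rule mirror)
  assume "\<not> below s y (- 1 / a)"
  then have "below (\<not> s) (- y) (- 1 / - a)" by (simp add: below_uminus)
  from m.lwall_S[OF this] show ?thesis by (simp add: rwall_def neg_S)
qed

lemma rwall_Tinv:
  "below s y (- 1 / a) \<Longrightarrow> \<not> below s y (b - 1) \<Longrightarrow> rwall a b s y = Tinv (rwall a b s (y + 1))"
proof -
  interpret m: ab "- b" "- a" by (rule mirror)
  assume A: "below s y (- 1 / a)" and B: "\<not> below s y (b - 1)"
  have "\<not> below (\<not> s) (- y) (- 1 / - a)" using A by (simp add: below_uminus)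
  moreover have "below (\<not> s) (- y) (- b + 1)" using B by (simp add: below_uminus)
  ultimately have "lwall (- b) (- a) (\<not> s) (- y) = T (lwall (- b) (- a) (\<not> s) (- y - 1))"
    by (rule m.lwall_T)
  then show ?thesis by (simp add: rwall_def neg_T)
qed

lemma rwall_eq_Infty_iff: "rwall a b s y = Infty \<longleftrightarrow> below s y (b - 1)"
proof -
  interpret m: ab "- b" "- a" by (rule mirror)
  have "lwall (- b) (- a) (\<not> s) (- y) = Infty \<longleftrightarrow> \<not> below (\<not> s) (- y) (- b + 1)"
    by (rule m.lwall_eq_Infty_iff)
  then show ?thesis by (simp add: rwall_def below_uminus)
qed

lemma rwall_zone1:
  "\<not> below s y (- 1 / a) \<Longrightarrow> 0 \<le> lo (rwall a b s y) \<and> lo (rwall a b s y) \<le> 1"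
proof -
  interpret m: ab "- b" "- a" by (rule mirror)
  assume "\<not> below s y (- 1 / a)"
  then have "below (\<not> s) (- y) (- 1 / - a)" by (simp add: below_uminus)
  from m.lwall_zone1[OF this] show ?thesis
    by (cases "lwall (- b) (- a) (\<not> s) (- y)") (auto simp: rwall_def one_ereal_def)
qed

lemma rwall_zone2: "below s y (- 1 / a) \<Longrightarrow> lo (rwall a b s y) \<le> 0"
proof -
  interpret m: ab "- b" "- a" by (rule mirror)
  assume "below s y (- 1 / a)"
  then have "\<not> below (\<not> s) (- y) (- 1 / - a)" by (simp add: below_uminus)
  from m.lwall_zone2[OF this] show ?thesis
    by (cases "lwall (- b) (- a) (\<not> s) (- y)") (auto simp: rwall_def)
qed

lemma rwall_zone3: "y \<le> 0 \<Longrightarrow> lo (rwall a b s y) \<le> - 1"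
proof -
  interpret m: ab "- b" "- a" by (rule mirror)
  assume "y \<le> 0"
  then have "0 \<le> - y" by simp
  from m.lwall_zone3[OF this, of "\<not> s"] show ?thesis
    by (cases "lwall (- b) (- a) (\<not> s) (- y)") (auto simp: rwall_def one_ereal_def)
qed

lemma rwall_le_1: "lo (rwall a b s y) \<le> 1"
  using rwall_zone1[of s y] rwall_zone2[of s y] by (cases "below s y (- 1 / a)") (auto intro: order.trans)

lemma rwall_mono:
  assumes "precedes s y s' y'"
  shows "lo (rwall a b s y) \<le> lo (rwall a b s' y')"
proof -
  interpret m: ab "- b" "- a" by (rule mirror)
  have "precedes (\<not> s') (- y') (\<not> s) (- y)" using assms by (auto simp: precedes_def)
  from m.lwall_mono[OF this] show ?thesis by (simp add: rwall_def lo_neg)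
qed

end

section \<open>Charts in which the backward dynamics contracts\<close>

text \<open>
  Coordinates on the three intervals \<open>[-1, 0]\<close>, \<open>[0, \<infinity>]\<close> and \<open>[1, \<infinity>]\<close> between which the recursion moves the wall:
  \<open>S\<close> maps the third to the first, \<open>T\<close> the first into the second and the second to the third.
  In these charts \<open>S\<close> and \<open>T : [0, \<infinity>] \<rightarrow> [1, \<infinity>]\<close> are isometries, and \<open>T\<close> contracts when its image is
  measured by \<open>chi2\<close>.
\<close>

definition chi1 :: "rbar \<Rightarrow> real" where
  "chi1 z = (case z of Fin x \<Rightarrow> - x | Infty \<Rightarrow> 0)"

definition chi2 :: "rbar \<Rightarrow> real" where
  "chi2 z = (case z of Fin x \<Rightarrow> 1 / (1 + x) | Infty \<Rightarrow> 0)"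

definition chi3 :: "rbar \<Rightarrow> real" where
  "chi3 z = (case z of Fin x \<Rightarrow> 1 / x | Infty \<Rightarrow> 0)"

lemma chi2_T_low:
  assumes "- 1 \<le> hi z" "hi z \<le> 0"
  shows "chi2 (T z) = 1 / (2 - chi1 z)"
  using assms by (cases z) (auto simp: chi1_def chi2_def one_ereal_def)

lemma chi2_T:
  assumes "0 \<le> hi z"
  shows "chi2 (T z) = chi2 z / (1 + chi2 z)"
  using assms by (cases z) (auto simp: chi2_def field_simps)

lemma chi3_T: "0 \<le> hi z \<Longrightarrow> chi3 (T z) = chi2 z"
  by (cases z) (auto simp: chi2_def chi3_def field_simps)

lemma chi1_S: "1 \<le> hi z \<Longrightarrow> chi1 (S z) = chi3 z"
  by (cases z) (auto simp: chi1_def chi3_def one_le_hi)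

lemma chi2_chi3: "1 \<le> hi z \<Longrightarrow> chi2 z = chi3 z / (1 + chi3 z)"
  by (cases z) (auto simp: chi2_def chi3_def one_le_hi field_simps)

lemma chi2_T_S:
  assumes "1 \<le> hi z"
  shows "chi2 (T (S z)) = 1 / (2 - chi3 z)"
  using assms by (cases z) (auto simp: chi2_def chi3_def one_le_hi field_simps)

lemma chi1_range: "- 1 \<le> hi z \<Longrightarrow> hi z \<le> 0 \<Longrightarrow> 0 \<le> chi1 z \<and> chi1 z \<le> 1"
  by (cases z) (auto simp: chi1_def one_ereal_def)

lemma chi2_range: "0 \<le> hi z \<Longrightarrow> 0 \<le> chi2 z \<and> chi2 z \<le> 1"
  by (cases z) (auto simp: chi2_def field_simps)

lemma chi3_range: "1 \<le> hi z \<Longrightarrow> 0 \<le> chi3 z \<and> chi3 z \<le> 1"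
  by (cases z) (auto simp: chi3_def one_le_hi field_simps)

lemma chi1_le_iff:
  "\<lbrakk>- 1 \<le> hi z; hi z \<le> 0; - 1 \<le> hi w; hi w \<le> 0\<rbrakk> \<Longrightarrow> chi1 z \<le> chi1 w \<longleftrightarrow> hi w \<le> hi z"
  by (cases z; cases w) (auto simp: chi1_def)

lemma chi2_le_iff: "\<lbrakk>0 \<le> hi z; 0 \<le> hi w\<rbrakk> \<Longrightarrow> chi2 z \<le> chi2 w \<longleftrightarrow> hi w \<le> hi z"
  by (cases z; cases w) (auto simp: chi2_def field_simps)

lemma chi3_le_iff: "\<lbrakk>1 \<le> hi z; 1 \<le> hi w\<rbrakk> \<Longrightarrow> chi3 z \<le> chi3 w \<longleftrightarrow> hi w \<le> hi z"
  by (cases z; cases w) (auto simp: chi3_def one_le_hi field_simps)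

text \<open>
  The two contractions, in one-sided form.  Both shrink a distance \<open>d\<close> to at most \<open>d / (1 + d)\<close>, so
  that \<open>n\<close> of them leave at most \<open>1 / n\<close>.
\<close>

lemma shrink_T:
  fixes t t' d :: real
  assumes "0 \<le> t" "0 \<le> t'" "0 \<le> d" "t \<le> t' + d"
  shows "t / (1 + t) \<le> t' / (1 + t') + d / (1 + d)"
proof -
  have "t / (1 + t) \<le> (t' + d) / (1 + (t' + d))"
    using assms by (simp add: divide_simps) (simp add: algebra_simps)
  also have "\<dots> = t' / (1 + t') + d / ((1 + t') * (1 + (t' + d)))"
    using assms by (simp add: divide_simps add_nonneg_eq_0_iff) (simp add: algebra_simps)
  also have "d / ((1 + t') * (1 + (t' + d))) \<le> d / (1 + d)"
  proof (rule divide_left_mono)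
    have "1 * (1 + d) \<le> (1 + t') * (1 + (t' + d))" using assms by (intro mult_mono) auto
    then show "1 + d \<le> (1 + t') * (1 + (t' + d))" by simp
  qed (use assms in auto)
  finally show ?thesis by simp
qed

lemma shrink_ST:
  fixes u u' d :: real
  assumes "u \<le> 1" "u' \<le> 1" "0 \<le> d" "u \<le> u' + d"
  shows "1 / (2 - u) \<le> 1 / (2 - u') + d / (1 + d)"
proof (cases "u \<le> u'")
  case True
  then have "1 / (2 - u) \<le> 1 / (2 - u')" using assms by (simp add: divide_simps)
  moreover have "0 \<le> d / (1 + d)" using assms by simp
  ultimately show ?thesis by linarith
next
  case False
  define e where "e = u - u'"
  have e: "0 < e" "e \<le> d" using False assms by (auto simp: e_def)
  have "1 / (2 - u) - 1 / (2 - u') = e / ((2 - u) * (2 - u'))"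
    using assms by (simp add: e_def field_simps)
  also have "\<dots> \<le> e / (1 + e)"
  proof (rule divide_left_mono)
    have "1 * (1 + e) \<le> (2 - u) * (2 - u')" using assms e by (intro mult_mono) (auto simp: e_def)
    then show "1 + e \<le> (2 - u) * (2 - u')" by simp
  qed (use assms e in auto)
  also have "\<dots> \<le> d / (1 + d)" using e by (simp add: divide_simps) (simp add: algebra_simps)
  finally show ?thesis by simp
qed

lemma shrink_T_abs:
  fixes t t' d :: real
  assumes "0 \<le> t" "0 \<le> t'" "\<bar>t - t'\<bar> \<le> d"
  shows "\<bar>t / (1 + t) - t' / (1 + t')\<bar> \<le> d / (1 + d)"
proof -
  have d: "0 \<le> d" using assms(3) by linarith
  have "t \<le> t' + d" "t' \<le> t + d" using assms(3) by linarith+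
  with shrink_T[of t t' d] shrink_T[of t' t d] assms d show ?thesis by (simp add: abs_le_iff)
qed

lemma shrink_ST_abs:
  fixes u u' d :: real
  assumes "u \<le> 1" "u' \<le> 1" "\<bar>u - u'\<bar> \<le> d"
  shows "\<bar>1 / (2 - u) - 1 / (2 - u')\<bar> \<le> d / (1 + d)"
proof -
  have d: "0 \<le> d" using assms(3) by linarith
  have "u \<le> u' + d" "u' \<le> u + d" using assms(3) by linarith+
  with shrink_ST[of u u' d] shrink_ST[of u' u d] assms d show ?thesis by (simp add: abs_le_iff)
qed

lemma shrink_bound:
  fixes d c :: real
  assumes "0 \<le> d" "d \<le> 1 / c" "0 < c"
  shows "d / (1 + d) \<le> 1 / (c + 1)"
  using assms by (simp add: divide_simps) (simp add: algebra_simps)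

lemma zero_of_bounds:
  fixes x :: real
  assumes "\<And>n :: nat. \<bar>x\<bar> \<le> 1 / (real n + 1)"
  shows "x = 0"
proof (rule ccontr)
  assume "x \<noteq> 0"
  then obtain n :: nat where "inverse (real (Suc n)) < \<bar>x\<bar>"
    using reals_Archimedean[of "\<bar>x\<bar>"] by auto
  with assms[of n] show False by (simp add: field_simps)
qed

section \<open>The two walls fit together\<close>

context ab
begin

text \<open>
  The levels \<open>q\<close> for which the left end of the row at \<open>q\<close> and the right end of the row at \<open>S q\<close> correspond under \<open>S\<close>. In
  \<open>dom_M\<close> the row at \<open>q / (1 - q)\<close> and the transformation \<open>S T S\<close> take this role.
\<close>

definition dom_S :: "bool \<Rightarrow> real \<Rightarrow> bool" where
  "dom_S s q \<longleftrightarrow> q < 0 \<and> \<not> below s q (- 1 / b) \<and> below s q a"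

definition dom_M :: "bool \<Rightarrow> real \<Rightarrow> bool" where
  "dom_M s q \<longleftrightarrow>
     0 < q \<and> q < 1 \<and> below s q b \<and> below s (q / (1 - q)) (- 1 / a) \<or>
     q < 0 \<and> \<not> below s (q / (1 - q)) a \<and> \<not> below s q (- 1 / b)"

lemma dom_S_inv:
  assumes "dom_S s q"
  shows "\<not> below s (- 1 / q) b" "below s (- 1 / q) (- 1 / a)" "0 < - 1 / q"
  using assms a_neg b_pos unfolding dom_S_def below_def
  by (auto simp: field_simps split: if_splits)

text \<open>
  Two backward steps of one of the walls, a translation and \<open>S\<close>, lead to a pair linked by \<open>S T S\<close>. If neither wall
  could make them, then \<open>1 / (1 - q) \<ge> b\<close> and \<open>q / (1 - q) < a\<close>; these two numbers differ by one, which contradicts \<open>b - a \<ge> 1\<close>.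
\<close>

lemma dom_S_cases:
  assumes "dom_S s q"
  defines "q' \<equiv> 1 / (1 - q)"
  shows "dom_M s q' \<and> lwall a b s q = T (S (lwall a b s q')) \<and> q' / (1 - q') = - 1 / q \<or>
    dom_M s q \<and> rwall a b s (- 1 / q) = Tinv (S (rwall a b s (q / (1 - q))))"
proof -
  have q: "q < 0" "\<not> below s q (- 1 / b)" "below s q a" using assms by (auto simp: dom_S_def)
  have q': "0 < q'" "q' < 1" "q' / (1 - q') = - 1 / q" "- 1 / (q - 1) = q'"
    using q unfolding q'_def by (auto simp: field_simps)
  show ?thesis
  proof (cases "below s q' b")
    case True
    have qm: "below s (q - 1) (- 1 / b)"
      using True q below_Sb[of "q - 1" s] q'(4) by simp
    have "below s q (a + 1)" using q(3) by (rule below_mono) simp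
    then have "lwall a b s q = T (lwall a b s (q - 1))" using q by (intro lwall_T)
    also have "\<dots> = T (S (lwall a b s q'))" using lwall_S[OF qm] q'(4) by simp
    finally have "lwall a b s q = T (S (lwall a b s q'))" .
    moreover have "dom_M s q'"
      using q' True dom_S_inv(2)[OF assms(1)] unfolding dom_M_def by simp
    ultimately show ?thesis using q' by blast
  next
    case False
    have e: "q / (1 - q) = q' - 1" using q unfolding q'_def by (simp add: field_simps)
    have na: "\<not> below s (q / (1 - q)) a"
    proof
      assume A: "below s (q / (1 - q)) a"
      then show False using False gap unfolding e below_def by (auto split: if_splits)
    qed
    then have dM: "dom_M s q" using q unfolding dom_M_def by simp
    define p where "p = - 1 / q"
    have p: "\<not> below s p b" "below s p (- 1 / a)" "0 < p"
      using dom_S_inv[OF assms(1)] by (auto simp: p_def)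
    have "\<not> below s p (b - 1)" using p(1) below_mono[of s p "b - 1" b] by auto
    then have r1: "rwall a b s p = Tinv (rwall a b s (p + 1))" using p by (intro rwall_Tinv)
    have p1: "- 1 / (p + 1) = q / (1 - q)" using q by (simp add: p_def field_simps)
    have "\<not> below s (p + 1) (- 1 / a)"
      using na a_neg p(3) unfolding p1[symmetric] below_def by (auto simp: field_simps split: if_splits)
    then have "rwall a b s (p + 1) = S (rwall a b s (q / (1 - q)))" using rwall_S p1 by metis
    with r1 dM show ?thesis by (simp add: p_def)
  qed
qed

text \<open>
  Either one of the walls ends here, and then the other one is known explicitly, or both walls make one backward
  translation, which leads to a pair linked by \<open>S\<close>.
\<close>

lemma dom_M_cases:
  assumes "dom_M s q"
  shows "rwall a b s (q / (1 - q)) = S (T (S (lwall a b s q))) \<and> 1 \<le> hi (lwall a b s q) \<or>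
    dom_S s (q - 1) \<and> lwall a b s q = T (lwall a b s (q - 1)) \<and>
    rwall a b s (q / (1 - q)) = Tinv (rwall a b s (- 1 / (q - 1)))"
proof -
  define p where "p = q / (1 - q)"
  have "\<not> below s q (- 1 / b)" if "0 < q"
    using that Sb_neg by (intro not_below_less) linarith
  then have q: "q < 1" "q \<noteq> 0" "\<not> below s q (- 1 / b)"
    using assms unfolding dom_M_def by auto
  have p1: "p + 1 = - 1 / (q - 1)" using q unfolding p_def by (simp add: field_simps)
  have p1': "- 1 / (p + 1) = q - 1" using q unfolding p1 by (simp add: field_simps)
  have p1pos: "0 < p + 1" using q unfolding p1 by (simp add: field_simps)
  have pSa: "below s p (- 1 / a)"
  proof (cases "0 < q")
    case True
    then show ?thesis using assms unfolding dom_M_def p_def by auto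
  next
    case False
    then have "p < 0" using q unfolding p_def by (simp add: field_simps)
    then show ?thesis using Sa_pos by (intro less_below) linarith
  qed
  have inv_b: "below s (p + 1) b \<longleftrightarrow> below s (q - 1) (- 1 / b)"
    unfolding p1 by (rule below_Sb) (use q in simp)
  have inv_a: "below s (q - 1) a \<longleftrightarrow> below s (p + 1) (- 1 / a)"
    unfolding p1 using q a_neg by (auto simp: below_def field_simps)
  have big: "lwall a b s (p + 1) = Infty" if "\<not> below s (p + 1) (a + 1)"
    using that by (rule lwall_top)
  have pa: "\<not> below s p a"
  proof (cases "0 < q")
    case True
    then have "0 < p" using q unfolding p_def by (simp add: field_simps)
    then show ?thesis using a_neg by (intro not_below_less) linarith
  next
    case False
    then show ?thesis using assms unfolding dom_M_def p_def by auto
  qed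
  show ?thesis
  proof (cases "below s p (b - 1)")
    case True
    \<comment> \<open>the right wall has ended, and the left wall is at \<open>1\<close>\<close>
    have r: "rwall a b s p = Infty" using True by (simp add: rwall_eq_Infty_iff)
    have "below s (p + 1) b" using True by (simp add: below_add)
    then have qb: "below s (q - 1) (- 1 / b)" by (simp add: inv_b)
    then have "below s (q - 1) a" using below_mono Sb_le_a by blast
    then have qa: "below s q (a + 1)" by (simp add: below_diff)
    have "\<not> below s (p + 1) (a + 1)" using pa by (simp add: below_add)
    then have "lwall a b s (q - 1) = Fin 0" using lwall_S[OF qb] big p1 by simp
    then have l: "lwall a b s q = Fin 1" using lwall_T[OF q(3) qa] by simp
    show ?thesis using r l by (simp add: p_def[symmetric] one_ereal_def)
  next
    case nb: False
    have r: "rwall a b s p = Tinv (rwall a b s (p + 1))" using pSa nb by (rule rwall_Tinv)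
    show ?thesis
    proof (cases "below s q (a + 1)")
      case False
      \<comment> \<open>the left wall has ended, and the right wall is at \<open>-1\<close>\<close>
      have l: "lwall a b s q = Infty" using False by (rule lwall_top)
      have na: "\<not> below s (q - 1) a" using False by (simp add: below_diff)
      then have "rwall a b s (p + 1) = S (rwall a b s (q - 1))"
        using rwall_S[of s "p + 1"] p1' inv_a by simp
      moreover have "rwall a b s (q - 1) = Infty"
      proof -
        have "below s q b"
        proof (cases "0 < q")
          case True then show ?thesis using assms unfolding dom_M_def by auto
        next
          case False then show ?thesis using b_pos q by (intro less_below) auto
        qed
        then show ?thesis by (simp add: rwall_eq_Infty_iff below_diff)
      qed
      ultimately show ?thesis using r l by (simp add: p_def[symmetric])
    next
      case True
      have "dom_S s (q - 1)"
        using True nb inv_b q unfolding dom_S_def by (auto simp: below_diff below_add)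
      moreover have "lwall a b s q = T (lwall a b s (q - 1))" using q(3) True by (rule lwall_T)
      ultimately show ?thesis using r p1 by (simp add: p_def[symmetric])
    qed
  qed
qed

lemma wall_approx_M:
  assumes S: "\<And>q. dom_S s q \<Longrightarrow>
      \<bar>chi2 (lwall a b s q) - chi2 (S (rwall a b s (- 1 / q)))\<bar> \<le> d"
    and d: "0 \<le> d" and q: "dom_M s q"
  shows "1 \<le> hi (lwall a b s q)" "1 \<le> hi (T (S (T (rwall a b s (q / (1 - q))))))"
    "\<bar>chi3 (lwall a b s q) - chi3 (T (S (T (rwall a b s (q / (1 - q))))))\<bar> \<le> d"
proof -
  let ?l = "lwall a b s q" and ?r = "T (S (T (rwall a b s (q / (1 - q)))))"
  have "1 \<le> hi ?l \<and> 1 \<le> hi ?r \<and> \<bar>chi3 ?l - chi3 ?r\<bar> \<le> d"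
  proof (rule disjE[OF dom_M_cases[OF q]])
    assume A: "rwall a b s (q / (1 - q)) = S (T (S ?l)) \<and> 1 \<le> hi ?l"
    then have "?r = ?l" by (metis T_S_T S_S T_Tinv)
    with A d show ?thesis by simp
  next
    assume A: "dom_S s (q - 1) \<and> ?l = T (lwall a b s (q - 1)) \<and>
      rwall a b s (q / (1 - q)) = Tinv (rwall a b s (- 1 / (q - 1)))"
    let ?l' = "lwall a b s (q - 1)" and ?r' = "S (rwall a b s (- 1 / (q - 1)))"
    have r: "?r = T ?r'" using A by simp
    have l0: "0 \<le> hi ?l'" using A unfolding dom_S_def by (intro lwall_zone2) auto
    have "lo (rwall a b s (- 1 / (q - 1))) \<le> 0" using A dom_S_inv by (intro rwall_zone2) auto
    then have r0: "0 \<le> hi ?r'"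
      by (cases "rwall a b s (- 1 / (q - 1))") (auto simp: divide_nonneg_nonpos divide_nonpos_nonpos)
    have ge: "1 \<le> hi (T z)" if "0 \<le> hi z" for z
      using that by (cases z) (auto simp: one_ereal_def)
    show ?thesis
      using A S[of "q - 1"] chi3_T[OF l0] chi3_T[OF r0] ge[OF l0] ge[OF r0] unfolding r by simp
  qed
  then show "1 \<le> hi ?l" "1 \<le> hi ?r" "\<bar>chi3 ?l - chi3 ?r\<bar> \<le> d" by auto
qed

text \<open>
  Each round through \<open>dom_M\<close> and back contains one contraction.
\<close>

lemma wall_approx_S:
  "dom_S s q \<Longrightarrow> \<bar>chi2 (lwall a b s q) - chi2 (S (rwall a b s (- 1 / q)))\<bar> \<le> 1 / (real n + 1)"
proof (induction n arbitrary: q)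
  case 0
  have "0 \<le> hi (lwall a b s q)" using 0 unfolding dom_S_def by (intro lwall_zone2) auto
  moreover have "0 \<le> hi (S (rwall a b s (- 1 / q)))"
  proof -
    have "lo (rwall a b s (- 1 / q)) \<le> 0" using 0 dom_S_inv by (intro rwall_zone2) auto
    then show ?thesis
      by (cases "rwall a b s (- 1 / q)") (auto simp: divide_nonneg_nonpos divide_nonpos_nonpos)
  qed
  ultimately show ?case using chi2_range by (smt (verit) divide_self_if of_nat_0)
next
  case (Suc n)
  define d where "d = 1 / (real n + 1)"
  have d: "0 \<le> d" by (simp add: d_def)
  have d': "d / (1 + d) \<le> 1 / (real (Suc n) + 1)"
    using shrink_bound[of d "real n + 1"] d by (simp add: d_def)
  note M = wall_approx_M[OF Suc.IH, folded d_def, OF _ d]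
  let ?l = "lwall a b s q" and ?r = "rwall a b s (- 1 / q)"
  show ?case
  proof (rule disjE[OF dom_S_cases[OF Suc.prems]])
    define q' where "q' = 1 / (1 - q)"
    assume "dom_M s (1 / (1 - q)) \<and> ?l = T (S (lwall a b s (1 / (1 - q)))) \<and>
      1 / (1 - q) / (1 - 1 / (1 - q)) = - 1 / q"
    then have A: "dom_M s q'" "?l = T (S (lwall a b s q'))" "q' / (1 - q') = - 1 / q"
      by (auto simp: q'_def)
    let ?r' = "T (S (T ?r))"
    have r: "S ?r = T (S ?r')" by (metis T_S_T S_S T_Tinv)
    have M': "1 \<le> hi (lwall a b s q')" "1 \<le> hi ?r'" "\<bar>chi3 (lwall a b s q') - chi3 ?r'\<bar> \<le> d"
      using M[of q'] A by simp_all
    have "\<bar>chi2 (T (S (lwall a b s q'))) - chi2 (T (S ?r'))\<bar> \<le> d / (1 + d)"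
      using M' chi3_range shrink_ST_abs[OF _ _ M'(3)] by (simp add: chi2_T_S)
    then show ?thesis using d' unfolding A(2) r by linarith
  next
    assume A: "dom_M s q \<and> ?r = Tinv (S (rwall a b s (q / (1 - q))))"
    let ?r' = "T (S (T (rwall a b s (q / (1 - q)))))"
    have r: "S ?r = ?r'" using A by (simp add: T_S_T)
    have M': "1 \<le> hi ?l" "1 \<le> hi ?r'" "\<bar>chi3 ?l - chi3 ?r'\<bar> \<le> d"
      using M[of q] A by simp_all
    have "\<bar>chi2 ?l - chi2 ?r'\<bar> \<le> d / (1 + d)"
      using M' chi3_range shrink_T_abs[OF _ _ M'(3)] by (simp add: chi2_chi3)
    then show ?thesis using d' unfolding r by linarith
  qed
qed

text \<open>
  This identity and the next one say that the images under \<open>F\<close> of adjacent pieces of the region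
  have a common boundary.
\<close>

theorem walls_match_S:
  assumes "dom_S s q"
  shows "rwall a b s (- 1 / q) = S (lwall a b s q)"
proof -
  let ?l = "lwall a b s q" and ?r = "S (rwall a b s (- 1 / q))"
  have l: "0 \<le> hi ?l" using assms unfolding dom_S_def by (intro lwall_zone2) auto
  have "lo (rwall a b s (- 1 / q)) \<le> 0" using assms dom_S_inv by (intro rwall_zone2) auto
  then have r: "0 \<le> hi ?r"
    by (cases "rwall a b s (- 1 / q)") (auto simp: divide_nonneg_nonpos divide_nonpos_nonpos)
  have "chi2 ?l - chi2 ?r = 0"
    by (rule zero_of_bounds) (rule wall_approx_S[OF assms])
  then have "hi ?l = hi ?r" using chi2_le_iff[OF l r] chi2_le_iff[OF r l] by simp
  then have "?l = ?r" by (simp add: hi_inj)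
  then show ?thesis by (metis S_S)
qed

theorem walls_match_M:
  assumes "dom_M s q"
  shows "rwall a b s (q / (1 - q)) = S (T (S (lwall a b s q)))"
  using dom_M_cases[OF assms]
proof
  assume A: "dom_S s (q - 1) \<and> lwall a b s q = T (lwall a b s (q - 1)) \<and>
    rwall a b s (q / (1 - q)) = Tinv (rwall a b s (- 1 / (q - 1)))"
  then have "rwall a b s (q / (1 - q)) = Tinv (S (Tinv (lwall a b s q)))"
    using walls_match_S[of s "q - 1"] by simp
  then show ?thesis by (simp add: Tinv_S_Tinv)
qed simp

end

section \<open>The attractor is the region between the walls\<close>

text \<open>
  The generator that \<open>f\<close> applies at a sided level.
\<close>

definition gen :: "real \<Rightarrow> real \<Rightarrow> bool \<Rightarrow> real \<Rightarrow> rbar \<Rightarrow> rbar" where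
  "gen a b s t = (if below s t a then T else if below s t b then S else Tinv)"

lemma rho_eq_gen: "rho a b (Fin t) = gen a b True t"
  by (simp add: gen_def below_def)

lemma rho_low_eq_gen: "rho_low a b (Fin t) = gen a b False t"
  by (simp add: gen_def below_def)

lemma gen_mirror:
  assumes "a < b"
  shows "gen (- b) (- a) (\<not> s) (- t) (neg x) = neg (gen a b s t x)"
proof -
  have "below s t a \<Longrightarrow> below s t b" using assms by (auto intro: below_mono)
  then show ?thesis by (auto simp: gen_def below_uminus neg_T neg_S neg_Tinv)
qed

text \<open>
  The lower and the upper part of the row at a sided level; they are empty above \<open>a + 1\<close> and below \<open>b - 1\<close>, respectively.
\<close>

definition low_row :: "real \<Rightarrow> real \<Rightarrow> bool \<Rightarrow> real \<Rightarrow> rbar \<Rightarrow> bool" where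
  "low_row a b s t x \<longleftrightarrow> below s t (a + 1) \<and> hi (lwall a b s t) \<le> hi x"

definition up_row :: "real \<Rightarrow> real \<Rightarrow> bool \<Rightarrow> real \<Rightarrow> rbar \<Rightarrow> bool" where
  "up_row a b s t x \<longleftrightarrow> \<not> below s t (b - 1) \<and> lo x \<le> lo (rwall a b s t)"

lemma ereal_le_uminus_iff: "(x :: ereal) \<le> - y \<longleftrightarrow> y \<le> - x"
  by (cases x; cases y) auto

lemma up_row_mirror: "up_row a b s t x \<longleftrightarrow> low_row (- b) (- a) (\<not> s) (- t) (neg x)"
  by (auto simp: up_row_def low_row_def rwall_def below_uminus hi_neg lo_neg ereal_le_uminus_iff)

lemma low_row_mirror: "low_row a b s t x \<longleftrightarrow> up_row (- b) (- a) (\<not> s) (- t) (neg x)"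
  by (simp add: up_row_mirror)

definition region :: "real \<Rightarrow> real \<Rightarrow> (rbar \<times> rbar) set" where
  "region a b = {(x, y). x \<noteq> y \<and>
     (case y of Infty \<Rightarrow> True | Fin t \<Rightarrow> low_row a b True t x \<or> up_row a b True t x)}"

subsection \<open>The region is contained in its image\<close>

context ab
begin

text \<open>
  Rows below \<open>S b\<close> have two preimages, by \<open>T\<close> and by \<open>S\<close>; their images abut.
\<close>

lemma T_lwall_eq_S_rwall:
  assumes "t < 0" "below s (t - 1) (- 1 / b)" "below s (- 1 / t) (- 1 / a)"
  shows "T (lwall a b s (t - 1)) = S (rwall a b s (- 1 / t))"
proof -
  define q where "q = - 1 / (t - 1)"
  have q: "0 < q" "q < 1" "q / (1 - q) = - 1 / t"
    using assms(1) unfolding q_def by (auto simp: field_simps)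
  have "below s q b" using below_Sb[of "t - 1" s] assms unfolding q_def by simp
  then have "dom_M s q" using q assms unfolding dom_M_def by simp
  from walls_match_M[OF this] have "rwall a b s (- 1 / t) = S (T (S (lwall a b s q)))"
    using q by simp
  then show ?thesis using lwall_S[OF assms(2)] by (simp add: q_def)
qed

text \<open>
  The image by \<open>T\<close> of the row at \<open>t - 1\<close> covers the row at \<open>t\<close> if \<open>t\<close> lies above \<open>S b\<close>. Otherwise it leaves a gap, which
  the image by \<open>S\<close> of the row at \<open>S t\<close> fills.
\<close>

lemma low_row_surj:
  assumes "low_row a b s t x"
  shows "\<exists>t' x'. (low_row a b s t' x' \<or> up_row a b s t' x') \<and>
    gen a b s t' x' = x \<and> gen a b s t' (Fin t') = Fin t"
proof -
  have t: "below s t (a + 1)" and x: "hi (lwall a b s t) \<le> hi x"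
    using assms by (auto simp: low_row_def)
  have tm: "below s (t - 1) a" using t by (simp add: below_diff)
  show ?thesis
  proof (cases "hi (T (lwall a b s (t - 1))) \<le> hi x")
    case True
    then have "hi (lwall a b s (t - 1)) \<le> hi (Tinv x)" by (metis T_Tinv hi_T_le_iff)
    moreover have "below s (t - 1) (a + 1)" using tm by (rule below_mono) simp
    ultimately have "low_row a b s (t - 1) (Tinv x)" by (simp add: low_row_def)
    moreover have "gen a b s (t - 1) = T" using tm by (simp add: gen_def)
    ultimately show ?thesis by (intro exI[of _ "t - 1"] exI[of _ "Tinv x"]) simp
  next
    case False
    have tS: "below s t (- 1 / b)" using False lwall_T[of s t] t x by metis
    define z where "z = - 1 / t"
    have t0: "t < 0" using tS below_le Sb_neg by (meson order.strict_trans1)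
    have z0: "0 < z" using t0 by (simp add: z_def)
    have zb: "below s z b" using below_Sb[OF t0] tS by (simp add: z_def)
    have zSa: "below s z (- 1 / a)" using zb b_le_Sa by (rule below_mono)
    have "below s (t - 1) (- 1 / b)" using tS by (auto simp: below_diff intro: below_mono)
    then have m: "T (lwall a b s (t - 1)) = S (rwall a b s z)"
      using T_lwall_eq_S_rwall[OF t0] zSa by (simp add: z_def)
    have lt: "lwall a b s t = S (lwall a b s z)" using lwall_S[OF tS] by (simp add: z_def)
    have lz: "1 \<le> hi (lwall a b s z)" using z0 by (intro lwall_zone3) simp
    have rz: "lo (rwall a b s z) \<le> 0" using zSa by (rule rwall_zone2)
    have xlt: "hi x < hi (S (rwall a b s z))" using False m by simp
    obtain \<xi> where xi: "x = Fin \<xi>" using xlt by (cases x) auto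
    have "\<not> below s z a" using z0 a_neg by (intro not_below_less) linarith
    then have g: "gen a b s z = S" using zb by (simp add: gen_def)
    have "low_row a b s z (S x) \<or> up_row a b s z (S x)"
    proof (cases "\<xi> < 0")
      case True
      have pos: "0 < hi (S x)" using True xi by (simp add: divide_neg_neg)
      have lz': "0 < hi (lwall a b s z)" using lz by (cases "lwall a b s z") (auto simp: one_ereal_def)
      have "hi (S (lwall a b s z)) \<le> hi (S (S x))" using x lt by simp
      then have le: "hi (lwall a b s z) \<le> hi (S x)" using hi_S_le_iff[OF lz' pos] by simp
      then have "lwall a b s z \<noteq> Infty" using xi True by (cases "lwall a b s z") auto
      then have "below s z (a + 1)" by (simp add: lwall_eq_Infty_iff)
      with le show ?thesis by (simp add: low_row_def)
    next
      case xi0: False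
      then obtain \<rho> where r: "rwall a b s z = Fin \<rho>" using xlt xi by (cases "rwall a b s z") auto
      then have "\<not> below s z (b - 1)" using rwall_eq_Infty_iff[of s z] by simp
      moreover have "lo (S x) \<le> lo (rwall a b s z)"
      proof (cases "\<xi> = 0 \<or> \<rho> = 0")
        case True
        then show ?thesis using xi xi0 r by auto
      next
        case False
        then have "0 < \<xi>" "\<rho> < 0" "\<xi> < - 1 / \<rho>" using xlt xi xi0 r rz by auto
        then have "- 1 / \<xi> \<le> \<rho>" by (simp add: field_simps)
        then show ?thesis using False xi r by simp
      qed
      ultimately show ?thesis by (simp add: up_row_def)
    qed
    then show ?thesis using g t0 by (intro exI[of _ z] exI[of _ "S x"]) (auto simp: z_def)
  qed
qed

lemma up_row_surj:
  assumes "up_row a b s t x"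
  shows "\<exists>t' x'. (low_row a b s t' x' \<or> up_row a b s t' x') \<and>
    gen a b s t' x' = x \<and> gen a b s t' (Fin t') = Fin t"
proof -
  interpret m: ab "- b" "- a" by (rule mirror)
  have less: "a < b" using a_neg b_pos by linarith
  obtain t' x' where A: "low_row (- b) (- a) (\<not> s) t' x' \<or> up_row (- b) (- a) (\<not> s) t' x'"
    "gen (- b) (- a) (\<not> s) t' x' = neg x" "gen (- b) (- a) (\<not> s) t' (Fin t') = Fin (- t)"
    using m.low_row_surj[OF assms[unfolded up_row_mirror]] by blast
  have "low_row a b s (- t') (neg x') \<or> up_row a b s (- t') (neg x')"
    using A(1) low_row_mirror[of "- b" "- a" "\<not> s" t' x'] up_row_mirror[of "- b" "- a" "\<not> s" t' x']
    by auto
  moreover have "neg (gen a b s (- t') (neg x')) = neg x"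
    "neg (gen a b s (- t') (Fin (- t'))) = Fin (- t)"
    using A(2,3) gen_mirror[OF less, of s "- t'" "neg x'"] gen_mirror[OF less, of s "- t'" "Fin (- t')"]
    by simp_all
  ultimately show ?thesis by (metis neg_eq_iff neg_simps(1))
qed

lemma region_subset_image: "region a b \<subseteq> F a b ` region a b"
proof
  fix p assume p: "p \<in> region a b"
  obtain x y where xy: "p = (x, y)" by (cases p)
  show "p \<in> F a b ` region a b"
  proof (cases y)
    case Infty
    have "(T x, Infty) \<in> region a b" using p xy Infty by (auto simp: region_def)
    moreover have "F a b (T x, Infty) = p" using xy Infty by (simp add: F_def)
    ultimately show ?thesis by (metis imageI)
  next
    case (Fin t)
    then have "low_row a b True t x \<or> up_row a b True t x" and ne: "x \<noteq> Fin t"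
      using p xy by (auto simp: region_def)
    then obtain t' x' where A: "low_row a b True t' x' \<or> up_row a b True t' x'"
      "gen a b True t' x' = x" "gen a b True t' (Fin t') = Fin t"
      using low_row_surj up_row_surj by meson
    have "x' \<noteq> Fin t'" using A ne by auto
    then have "(x', Fin t') \<in> region a b" using A by (simp add: region_def)
    moreover have "F a b (x', Fin t') = p" using A xy Fin rho_eq_gen[of a b t'] by (simp add: F_def del: rho.simps)
    ultimately show ?thesis by (metis imageI)
  qed
qed

end

subsection \<open>The trapping region\<close>

text \<open>
  The rows of \<open>Theta_l\<close>, which are easier to reason about than the union of rectangles.
\<close>

definition theta_row :: "real \<Rightarrow> real \<Rightarrow> real \<Rightarrow> rbar \<Rightarrow> bool" where
  "theta_row a b t x \<longleftrightarrow> t \<le> a + 1 \<and>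
     (if a \<le> - 1 then 0 \<le> hi x \<and> (1 \<le> hi x \<or> t \<le> - 1 / b)
      else - 1 \<le> hi x \<and> (0 \<le> hi x \<or> t \<le> - 1 / (a + 1)) \<and>
        (1 \<le> hi x \<or> t \<le> max (a / (a + 1)) (- 1 / b)))"

lemma in_ivl_Infty: "Infty \<in> ivl p q \<longleftrightarrow> p \<le> q \<and> (p = - \<infinity> \<or> q = \<infinity>)"
proof
  assume "Infty \<in> ivl p q"
  then obtain e where "of_ereal e = Infty" "p \<le> e" "e \<le> q"
    by (metis atLeastAtMost_iff imageE ivl_def)
  then show "p \<le> q \<and> (p = - \<infinity> \<or> q = \<infinity>)" by (cases e) (auto simp: of_ereal_def)
next
  assume A: "p \<le> q \<and> (p = - \<infinity> \<or> q = \<infinity>)"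
  then have "(- \<infinity> \<in> {p..q} \<or> \<infinity> \<in> {p..q}) \<and> of_ereal \<infinity> = Infty \<and> of_ereal (- \<infinity>) = Infty"
    by (auto simp: of_ereal_def)
  then show "Infty \<in> ivl p q" unfolding ivl_def by (metis imageI)
qed

lemma neg_in_ivl: "neg z \<in> ivl p q \<longleftrightarrow> z \<in> ivl (- q) (- p)"
  by (cases z; cases p; cases q) (auto simp: in_ivl_Fin in_ivl_Infty)

lemma neg_in_Theta_l:
  "(neg x, neg y) \<in> Theta_l (- b) (- a) \<longleftrightarrow> (x, y) \<in> Theta_u a b"
proof (cases "b \<ge> 1")
  case True
  then show ?thesis unfolding Theta_l_def Theta_u_def by (auto simp: neg_in_ivl)
next
  case False
  define u v w where "u = - b / (b - 1)" and "v = - 1 / a" and "w = - 1 / (b - 1)"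
  have eqs: "- b / (- b + 1) = - u" "- 1 / - a = - v" "- 1 / (- b + 1) = - w"
    using False by (simp_all add: u_def v_def w_def field_simps)
  have "max (- u) (- v) = - min u v" by simp
  then show ?thesis using False
    unfolding Theta_l_def Theta_u_def eqs u_def[symmetric] v_def[symmetric] w_def[symmetric]
    by (auto simp: neg_in_ivl)
qed

context ab
begin

lemma theta_row_imp_Theta_l:
  assumes "theta_row a b t x"
  shows "(x, Fin t) \<in> Theta_l a b"
  using assms Sb_le_a unfolding theta_row_def Theta_l_def
  by (cases x) (auto simp: in_ivl_Fin in_ivl_Infty one_ereal_def zero_ereal_def le_max_iff_disj)

lemma Theta_l_imp_theta_row:
  assumes "(x, Fin t) \<in> Theta_l a b"
  shows "theta_row a b t x"
proof -
  have 1: "- 1 / b \<le> a + 1" using Sb_le_a by linarith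
  have 2: "a / (a + 1) \<le> a + 1" "- 1 / (a + 1) \<le> max (a / (a + 1)) (- 1 / b)" "- 1 / (a + 1) \<le> a + 1" if "- 1 < a"
  proof -
    have "a / (a + 1) \<le> 0" "- 1 / (a + 1) \<le> 0" using that a_neg by (auto simp: divide_nonpos_pos)
    then show "a / (a + 1) \<le> a + 1" "- 1 / (a + 1) \<le> a + 1" using that by linarith+
    have "- 1 / (a + 1) \<le> - 1 / b" using that gap b_pos by (simp add: field_simps)
    then show "- 1 / (a + 1) \<le> max (a / (a + 1)) (- 1 / b)" by simp
  qed
  show ?thesis
  proof (cases "a \<le> - 1")
    case True
    then show ?thesis using assms 1 unfolding theta_row_def Theta_l_def
      by (cases x) (auto simp: in_ivl_Fin in_ivl_Infty one_ereal_def zero_ereal_def)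
  next
    case False
    then show ?thesis using assms 1 2 unfolding theta_row_def Theta_l_def
      by (cases x) (auto simp: in_ivl_Fin in_ivl_Infty one_ereal_def zero_ereal_def le_max_iff_disj)
  qed
qed

lemma low_row_imp_theta_row:
  assumes "low_row a b s t x"
  shows "theta_row a b t x"
proof -
  have t: "below s t (a + 1)" and x: "hi (lwall a b s t) \<le> hi x"
    using assms by (auto simp: low_row_def)
  have end0: "lwall a b s t = Fin 0" if "below s t (- 1 / b)" "a + 1 < - 1 / t" for t
    using lwall_S[OF that(1)] lwall_top[of s "- 1 / t"] not_below_less[OF that(2)] by simp
  have ge1: "1 \<le> hi (lwall a b s t)" if "\<not> below s t (- 1 / b)" "0 \<le> hi (lwall a b s (t - 1))"
    using lwall_T[OF that(1) t] that(2) by (cases "lwall a b s (t - 1)") (auto simp: one_ereal_def)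
  have nb: "\<not> below s t (- 1 / b)" if "\<not> t \<le> - 1 / b"
    using that by (intro not_below_less) simp
  have neg: "t < 0" if "below s t (- 1 / b)" for t
    using that below_le Sb_neg by (meson order.strict_trans1)
  show ?thesis
  proof (cases "a \<le> - 1")
    case True
    have l0: "0 \<le> hi (lwall a b s t)" for t
    proof (cases "below s t (- 1 / b)")
      case b: True
      have "0 < - 1 / t" using neg[OF b] by simp
      then have "lwall a b s t = Fin 0" using True by (intro end0[OF b]) linarith
      then show ?thesis by simp
    qed (rule lwall_zone2)
    have "1 \<le> hi (lwall a b s t) \<or> t \<le> - 1 / b" using ge1 nb l0 by blast
    then show ?thesis using x l0[of t] True below_le[OF t]
      unfolding theta_row_def by (auto dest: order.trans)
  next
    case False
    have l0: "0 \<le> hi (lwall a b s t) \<or> t \<le> - 1 / (a + 1)" for t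
    proof (cases "below s t (- 1 / b)")
      case b: True
      have "a + 1 < - 1 / t" if "\<not> t \<le> - 1 / (a + 1)"
        using that neg[OF b] False by (simp add: field_simps)
      then show ?thesis using end0[OF b] by fastforce
    qed (use lwall_zone2 in blast)
    have "1 \<le> hi (lwall a b s t) \<or> t \<le> max (a / (a + 1)) (- 1 / b)"
    proof (rule ccontr)
      assume n: "\<not> ?thesis"
      then have "a / (a + 1) < t" by (auto simp: le_max_iff_disj not_le)
      moreover have "a / (a + 1) - 1 = - 1 / (a + 1)" using False by (simp add: field_simps)
      ultimately have "\<not> t - 1 \<le> - 1 / (a + 1)" by linarith
      then have "0 \<le> hi (lwall a b s (t - 1))" using l0 by blast
      then show False using n ge1 nb by auto
    qed
    then show ?thesis using x l0[of t] lwall_ge_m1[of s t] False below_le[OF t]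
      unfolding theta_row_def by (auto dest: order.trans)
  qed
qed

lemma region_subset_Theta: "region a b \<subseteq> Theta a b"
proof
  fix p assume p: "p \<in> region a b"
  interpret m: ab "- b" "- a" by (rule mirror)
  obtain x y where xy: "p = (x, y)" by (cases p)
  have nd: "p \<notin> diagonal" using p xy by (simp add: region_def diagonal_def)
  have "p \<in> Theta_u a b \<union> Theta_l a b"
  proof (cases y)
    case Infty
    then obtain r where r: "x = Fin r" using p xy by (cases x) (auto simp: region_def)
    consider "r \<le> - 1" | "- 1 \<le> r" "r \<le> 0" | "0 \<le> r" "r \<le> 1" | "1 \<le> r" by linarith
    then show ?thesis unfolding xy Infty r Theta_u_def Theta_l_def
      by cases (auto simp: in_ivl_Fin in_ivl_Infty one_ereal_def zero_ereal_def)
  next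
    case (Fin t)
    then consider "low_row a b True t x" | "up_row a b True t x"
      using p xy by (auto simp: region_def)
    then show ?thesis
    proof cases
      case 1
      then show ?thesis using low_row_imp_theta_row theta_row_imp_Theta_l Fin xy by auto
    next
      case 2
      then have "(neg x, Fin (- t)) \<in> Theta_l (- b) (- a)"
        unfolding up_row_mirror by (rule m.theta_row_imp_Theta_l[OF m.low_row_imp_theta_row])
      then show ?thesis using neg_in_Theta_l[of x "Fin t" b a] Fin xy by simp
    qed
  qed
  with nd show "p \<in> Theta a b" by (simp add: Theta_def)
qed

lemma region_subset_attractor: "region a b \<subseteq> attractor a b"
proof -
  have "region a b \<subseteq> (F a b ^^ n) ` region a b" for n
  proof (induction n)
    case (Suc n)
    have "region a b \<subseteq> F a b ` region a b" by (rule region_subset_image)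
    also have "\<dots> \<subseteq> F a b ` (F a b ^^ n) ` region a b" by (intro image_mono Suc)
    finally show ?case by (simp add: image_comp)
  qed simp
  moreover have "(F a b ^^ n) ` region a b \<subseteq> (F a b ^^ n) ` Theta a b" for n
    by (intro image_mono region_subset_Theta)
  ultimately show ?thesis unfolding attractor_def D_n_def by blast
qed

end

subsection \<open>Iterated images of the trapping region shrink to the region\<close>

text \<open>
  The distance of \<open>x\<close> to the wall that is still possible after \<open>n\<close> applications of \<open>F\<close>. The three
  bounds are staggered so that an isometric step from \<open>n\<close> to \<open>n + 1\<close> passes a bound on unchanged, while a contracting step turns
  \<open>3 / c\<close> into \<open>3 / (c + 3)\<close>. For \<open>1 < b\<close> there are levels \<open>t \<ge> -1\<close> below \<open>S b\<close>; there \<open>x \<ge> 0\<close> is demanded, so that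
  \<open>T x \<ge> 1\<close> holds at the level \<open>t + 1 \<ge> 0\<close>.
\<close>

definition low_near :: "real \<Rightarrow> real \<Rightarrow> bool \<Rightarrow> nat \<Rightarrow> real \<Rightarrow> rbar \<Rightarrow> bool" where
  "low_near a b s n t x \<longleftrightarrow> below s t (a + 1) \<and>
     (if below s t (- 1 / b)
      then - 1 \<le> hi x \<and> (- 1 \<le> t \<longrightarrow> 0 \<le> hi x) \<and>
        (hi x \<le> 0 \<longrightarrow> chi1 x \<le> chi1 (lwall a b s t) + 3 / (real n + 1))
      else if t < 0 then 0 \<le> hi x \<and> chi2 x \<le> chi2 (lwall a b s t) + 3 / (real n + 3)
      else 1 \<le> hi x \<and> chi3 x \<le> chi3 (lwall a b s t) + 3 / (real n + 2))"

definition up_near :: "real \<Rightarrow> real \<Rightarrow> bool \<Rightarrow> nat \<Rightarrow> real \<Rightarrow> rbar \<Rightarrow> bool" where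
  "up_near a b s n t x \<longleftrightarrow> low_near (- b) (- a) (\<not> s) n (- t) (neg x)"

lemma limit_le:
  fixes u v c :: real
  assumes "\<And>n :: nat. u \<le> v + 3 / (real n + c)" "0 < c"
  shows "u \<le> v"
proof (rule ccontr)
  assume "\<not> u \<le> v"
  then obtain n :: nat where n: "3 / (u - v) < real n" using reals_Archimedean2 by blast
  then have "3 < real n * (u - v)" using \<open>\<not> u \<le> v\<close> by (simp add: field_simps)
  also have "\<dots> \<le> (real n + c) * (u - v)"
    using \<open>\<not> u \<le> v\<close> assms(2) by (intro mult_right_mono) auto
  finally show False using assms(1)[of n] assms(2) by (simp add: field_simps)
qed

lemma eq_of_approx:
  fixes u v c :: real
  assumes "\<And>n :: nat. \<bar>u - v\<bar> \<le> 3 / (real n + c)" "0 < c"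
  shows "u = v"
proof -
  have "u \<le> v + 3 / (real n + c)" "v \<le> u + 3 / (real n + c)" for n
    using assms(1)[of n] by linarith+
  then have "u \<le> v" "v \<le> u" using limit_le assms(2) by blast+
  then show ?thesis by simp
qed

lemma shrink_three: "0 < c \<Longrightarrow> 3 / c / (1 + 3 / c) = 3 / (c + 3)" for c :: real
  by (simp add: field_simps)

lemma ge_one_T: "0 \<le> hi z \<Longrightarrow> 1 \<le> hi (T z)"
  by (cases z) (auto simp: one_ereal_def)

lemma ge_zero_T: "- 1 \<le> hi z \<Longrightarrow> 0 \<le> hi (T z)"
  by (cases z) (auto simp: one_ereal_def)

context ab
begin

lemma low_near_antimono:
  assumes "low_near a b s n t x" "m \<le> n"
  shows "low_near a b s m t x"
proof -
  have "3 / (real n + c) \<le> 3 / (real m + c)" if "0 < c" for c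
    using assms(2) that by (intro divide_left_mono) auto
  from this[of 1] this[of 2] this[of 3] show ?thesis
    using assms(1) unfolding low_near_def by (auto split: if_splits)
qed

lemma low_near_limit:
  assumes "\<And>n. low_near a b s n t x"
  shows "low_row a b s t x"
proof -
  let ?l = "lwall a b s t"
  have t: "below s t (a + 1)" using assms[of 0] by (simp add: low_near_def)
  have "hi ?l \<le> hi x"
  proof (cases "below s t (- 1 / b)")
    case True
    note z = lwall_zone1[OF True]
    have x: "- 1 \<le> hi x" using assms[of 0] True by (simp add: low_near_def)
    show ?thesis
    proof (cases "hi x \<le> 0")
      case x0: True
      have "chi1 x \<le> chi1 ?l"
      proof (rule limit_le)
        show "chi1 x \<le> chi1 ?l + 3 / (real n + 1)" for n
          using assms[of n] True x0 by (simp add: low_near_def)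
      qed simp
      then show ?thesis using z x x0 chi1_le_iff[of x ?l] by simp
    next
      case False
      then show ?thesis using z by (meson le_cases order.trans)
    qed
  next
    case n1: False
    show ?thesis
    proof (cases "t < 0")
      case True
      have x: "0 \<le> hi x" using assms[of 0] True n1 by (simp add: low_near_def)
      have "chi2 x \<le> chi2 ?l"
      proof (rule limit_le)
        show "chi2 x \<le> chi2 ?l + 3 / (real n + 3)" for n
          using assms[of n] True n1 by (simp add: low_near_def)
      qed simp
      then show ?thesis using x lwall_zone2[OF n1] chi2_le_iff[of x ?l] by simp
    next
      case False
      have x: "1 \<le> hi x" using assms[of 0] False n1 by (simp add: low_near_def)
      have "chi3 x \<le> chi3 ?l"
      proof (rule limit_le)
        show "chi3 x \<le> chi3 ?l + 3 / (real n + 2)" for n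
          using assms[of n] False n1 by (simp add: low_near_def)
      qed simp
      then show ?thesis using x lwall_zone3[of t s] False chi3_le_iff[of x ?l] by simp
    qed
  qed
  with t show ?thesis by (simp add: low_row_def)
qed

lemma low_near_T:
  assumes "low_near a b s n t x" "below s t a"
  shows "low_near a b s (Suc n) (t + 1) (T x)"
proof -
  let ?l = "lwall a b s t" and ?l' = "lwall a b s (t + 1)"
  have t0: "t < 0" using below_le[OF assms(2)] a_neg by linarith
  have t1: "below s (t + 1) (a + 1)" using assms(2) by (simp add: below_add)
  have xm: "- 1 \<le> hi x"
    using assms(1) t0 unfolding low_near_def by (auto split: if_splits intro: order.trans[of _ 0])
  then have Tx: "0 \<le> hi (T x)" by (rule ge_zero_T)
  show ?thesis
  proof (cases "below s (t + 1) (- 1 / b)")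
    case True
    have "chi1 (T x) \<le> chi1 ?l' + 3 / (real (Suc n) + 1)" if "hi (T x) \<le> 0"
    proof -
      have "hi (T x) = 0" using that Tx by (rule antisym)
      then have "chi1 (T x) = 0" by (cases "T x") (auto simp: chi1_def)
      moreover have "0 \<le> chi1 ?l'" using lwall_zone1[OF True] chi1_range by blast
      ultimately show ?thesis by simp
    qed
    moreover have "- 1 \<le> hi (T x)" by (rule order.trans[OF _ Tx]) simp
    ultimately show ?thesis using Tx t1 True by (simp add: low_near_def)
  next
    case n1: False
    have l': "?l' = T ?l" using lwall_T[OF n1 t1] by simp
    show ?thesis
    proof (cases "below s t (- 1 / b)")
      case z1: True
      note lz = lwall_zone1[OF z1]
      show ?thesis
      proof (cases "t + 1 < 0")
        case True
        have "chi2 (T x) \<le> chi2 (T ?l) + 3 / (real (Suc n) + 3)"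
        proof (cases "hi x \<le> 0")
          case x0: True
          have "chi1 x \<le> chi1 ?l + 3 / (real n + 1)"
            using assms(1) z1 x0 by (simp add: low_near_def)
          then have "1 / (2 - chi1 x) \<le> 1 / (2 - chi1 ?l) +
              3 / (real n + 1) / (1 + 3 / (real n + 1))"
            using chi1_range lz xm x0 by (intro shrink_ST) auto
          then show ?thesis
            using chi2_T_low[OF xm x0] chi2_T_low[of ?l] lz shrink_three[of "real n + 1"]
            by (simp add: add.commute add.left_commute)
        next
          case False
          then have "hi (T ?l) \<le> hi (T x)" using lz by (metis hi_T_le_iff le_cases order.trans)
          then have "chi2 (T x) \<le> chi2 (T ?l)"
            using Tx ge_zero_T[of ?l] lz by (subst chi2_le_iff) auto
          then show ?thesis by (smt (verit) divide_nonneg_nonneg of_nat_0_le_iff)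
        qed
        then show ?thesis using Tx t1 n1 True l' by (simp add: low_near_def)
      next
        case False
        \<comment> \<open>here \<open>1 < b\<close> and the wall at \<open>t\<close> is \<open>0\<close>\<close>
        have "0 \<le> hi x" using assms(1) z1 False by (simp add: low_near_def)
        then have "1 \<le> hi (T x)" by (rule ge_one_T)
        moreover have "?l = Fin 0"
        proof -
          have "1 \<le> - 1 / t" using False t0 by (simp add: field_simps)
          then have "\<not> below s (- 1 / t) (a + 1)" using a_neg by (intro not_below_less) linarith
          then show ?thesis using lwall_S[OF z1] lwall_top by simp
        qed
        moreover have "chi3 (T x) \<le> 1" using calculation(1) chi3_range by blast
        moreover have "0 \<le> 3 / (real (Suc n) + 2)" by simp
        moreover have "chi3 ?l' = 1" using l' calculation(2) by (simp add: chi3_def)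
        ultimately have "1 \<le> hi (T x)" "chi3 (T x) \<le> chi3 ?l' + 3 / (real (Suc n) + 2)"
          by linarith+
        then show ?thesis using t1 n1 False unfolding low_near_def by presburger
      qed
    next
      case z2: False
      have x0: "0 \<le> hi x" and c: "chi2 x \<le> chi2 ?l + 3 / (real n + 3)"
        using assms(1) z2 t0 by (auto simp: low_near_def)
      have l0: "0 \<le> hi ?l" using z2 by (rule lwall_zone2)
      show ?thesis
      proof (cases "t + 1 < 0")
        case True
        have "chi2 x / (1 + chi2 x) \<le> chi2 ?l / (1 + chi2 ?l) +
            3 / (real n + 3) / (1 + 3 / (real n + 3))"
          using c chi2_range[OF x0] chi2_range[OF l0] by (intro shrink_T) auto
        also have "3 / (real n + 3) / (1 + 3 / (real n + 3)) = 3 / (real n + 6)"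
          using shrink_three[of "real n + 3"] by (simp add: add.commute add.left_commute)
        also have "\<dots> \<le> 3 / (real (Suc n) + 3)" by (intro divide_left_mono) auto
        finally show ?thesis
          using Tx t1 n1 True l' by (simp add: low_near_def chi2_T[OF x0] chi2_T[OF l0])
      next
        case False
        then show ?thesis
          using t1 n1 c l' ge_one_T[OF x0]
          by (simp add: low_near_def chi3_T[OF x0] chi3_T[OF l0] add.commute add.left_commute)
      qed
    qed
  qed
qed

lemma low_near_S_pos:
  assumes "low_near a b s n t x" "0 < t" "below s t b"
  shows "low_near a b s (Suc n) (- 1 / t) (S x)"
proof -
  let ?t = "- 1 / t"
  have t0: "?t < 0" using assms(2) by simp
  have inv: "- 1 / ?t = t" using assms(2) by simp
  have tS: "below s ?t (- 1 / b)" using below_Sb[OF t0, of s] assms(3) inv by simp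
  have ta: "below s ?t (a + 1)" using tS by (rule below_mono) (use Sb_less_a1 in simp)
  have n1: "\<not> below s t (- 1 / b)" using assms(2) Sb_neg by (intro not_below_less) linarith
  have x: "1 \<le> hi x" and c: "chi3 x \<le> chi3 (lwall a b s t) + 3 / (real n + 2)"
    using assms n1 by (auto simp: low_near_def)
  have l: "1 \<le> hi (lwall a b s t)" using assms(2) by (intro lwall_zone3) simp
  have l': "lwall a b s ?t = S (lwall a b s t)" using lwall_S[OF tS] inv by simp
  have m1: "\<not> - 1 \<le> ?t"
  proof
    assume "- 1 \<le> ?t"
    then have "1 \<le> t" using assms(2) by (simp add: field_simps)
    moreover have "t \<le> a + 1" using assms(1) by (auto simp: low_near_def dest: below_le)
    ultimately show False using a_neg by linarith
  qed
  have "- 1 \<le> hi (S x)" using x by (cases x) (auto simp: one_ereal_def field_simps)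
  then show ?thesis
    unfolding low_near_def using ta tS m1 c l' chi1_S[OF x] chi1_S[OF l]
    by (simp add: add.commute add.left_commute)
qed

lemma low_near_S_neg:
  assumes "low_near a b s n t x" "t < 0" "\<not> below s t a"
  shows "up_near a b s (Suc n) (- 1 / t) (S x)"
proof -
  interpret m: ab "- b" "- a" by (rule mirror)
  let ?t = "- (- 1 / t)"
  have n1: "\<not> below s t (- 1 / b)" using assms(3) below_mono Sb_le_a by blast
  then have x: "0 \<le> hi x" using assms by (auto simp: low_near_def)
  have b1: "below (\<not> s) ?t (- 1 / - a)"
    using assms(2,3) a_neg by (auto simp: below_def field_simps split: if_splits)
  have b2: "below (\<not> s) ?t (- b + 1)"
    using b1 by (rule below_mono) (use m.Sb_less_a1 in simp)
  have x': "0 \<le> hi (neg (S x))" using x by (cases x) (auto simp: divide_nonneg_nonneg)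
  have "chi1 (neg (S x)) = 0" if "hi (neg (S x)) \<le> 0"
  proof -
    have "hi (neg (S x)) = 0" using that x' by (rule antisym)
    then show ?thesis by (cases "neg (S x)") (auto simp: chi1_def)
  qed
  moreover have "0 \<le> chi1 (lwall (- b) (- a) (\<not> s) ?t)"
    using m.lwall_zone1[OF b1] chi1_range by blast
  moreover have "- 1 \<le> hi (neg (S x))" by (rule order.trans[OF _ x']) simp
  moreover have "0 \<le> 3 / (real (Suc n) + 1)" by simp
  ultimately show ?thesis
    unfolding up_near_def low_near_def using b1 b2 x' by simp
qed

lemma low_near_step:
  assumes "low_near a b s n t x" "gen a b s t (Fin t) = Fin t'"
  shows "low_near a b s (Suc n) t' (gen a b s t x) \<or> up_near a b s (Suc n) t' (gen a b s t x)"
proof (cases "below s t a")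
  case True
  then show ?thesis using low_near_T[OF assms(1)] assms(2) by (simp add: gen_def)
next
  case na: False
  have "below s t (a + 1)" using assms(1) by (simp add: low_near_def)
  then have tb: "below s t b" by (rule below_mono) (use gap in simp)
  then have g: "gen a b s t = S" using na by (simp add: gen_def)
  then have t: "t \<noteq> 0" "t' = - 1 / t" using assms(2) by (auto split: if_splits)
  show ?thesis
  proof (cases "0 < t")
    case True
    then show ?thesis using low_near_S_pos[OF assms(1) _ tb] g t by simp
  next
    case False
    then show ?thesis using low_near_S_neg[OF assms(1) _ na] g t by simp
  qed
qed

lemma up_near_step:
  assumes "up_near a b s n t x" "gen a b s t (Fin t) = Fin t'"
  shows "low_near a b s (Suc n) t' (gen a b s t x) \<or> up_near a b s (Suc n) t' (gen a b s t x)"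
proof -
  interpret m: ab "- b" "- a" by (rule mirror)
  have less: "a < b" using a_neg b_pos by linarith
  have "gen (- b) (- a) (\<not> s) (- t) (Fin (- t)) = Fin (- t')"
    using gen_mirror[OF less, of s t "Fin t"] assms(2) by simp
  from m.low_near_step[OF assms(1)[unfolded up_near_def] this] show ?thesis
    using gen_mirror[OF less, of s t x] by (auto simp: up_near_def)
qed

lemma zone_imp_low_near:
  assumes "below s t (a + 1)" "- 1 \<le> hi x" "- 1 \<le> t \<Longrightarrow> 0 \<le> hi x"
    "\<not> below s t (- 1 / b) \<Longrightarrow> 0 \<le> hi x" "0 \<le> t \<Longrightarrow> 1 \<le> hi x"
  shows "low_near a b s 0 t x"
proof (cases "below s t (- 1 / b)")
  case True
  then have "0 \<le> chi1 (lwall a b s t)" using lwall_zone1 chi1_range by blast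
  moreover have "hi x \<le> 0 \<Longrightarrow> chi1 x \<le> 1" using assms(2) chi1_range by blast
  ultimately show ?thesis using assms True unfolding low_near_def by auto
next
  case n1: False
  show ?thesis
  proof (cases "t < 0")
    case True
    have "0 \<le> chi2 (lwall a b s t)" "chi2 x \<le> 1"
      using n1 lwall_zone2 assms(4) chi2_range by blast+
    then show ?thesis using assms n1 True unfolding low_near_def by auto
  next
    case False
    have "0 \<le> chi3 (lwall a b s t)" "chi3 x \<le> 1"
      using False lwall_zone3[of t s] assms(5) chi3_range by auto
    then show ?thesis using assms n1 False unfolding low_near_def by auto
  qed
qed

text \<open>
  The trapping region itself exceeds the bounds on its closed edges; its first image satisfies them.
\<close>

lemma theta_row_step:
  assumes "theta_row a b t x" "gen a b s t (Fin t) = Fin t'"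
  shows "low_near a b s 0 t' (gen a b s t x) \<or> up_near a b s 0 t' (gen a b s t x)"
proof -
  interpret m: ab "- b" "- a" by (rule mirror)
  have ta: "t \<le> a + 1" using assms(1) by (simp add: theta_row_def)
  have xm: "- 1 \<le> hi x"
    using assms(1) by (auto simp: theta_row_def split: if_splits intro: order.trans[of _ 0])
  have x0: "0 \<le> hi x" if "- 1 \<le> t"
  proof (cases "a \<le> - 1")
    case False
    then have "- 1 / (a + 1) < - 1" using a_neg by (simp add: field_simps)
    then have "\<not> t \<le> - 1 / (a + 1)" using that by linarith
    then show ?thesis using assms(1) False by (simp add: theta_row_def)
  qed (use assms(1) in \<open>simp add: theta_row_def\<close>)
  have x0': "0 \<le> hi x" if "a \<le> t"
  proof (cases "a \<le> - 1")
    case False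
    then show ?thesis using x0 that by simp
  qed (use assms(1) in \<open>simp add: theta_row_def\<close>)
  have x1: "1 \<le> hi x" if "0 < t"
  proof -
    have "- 1 < a" using that ta by linarith
    then have "a / (a + 1) \<le> 0" using a_neg by (simp add: divide_nonpos_pos)
    then have "\<not> t \<le> max (a / (a + 1)) (- 1 / b)" using that Sb_neg by linarith
    then show ?thesis using assms(1) \<open>- 1 < a\<close> by (auto simp: theta_row_def)
  qed
  consider (T) "below s t a" | (S) "\<not> below s t a" "below s t b" | (Ti) "\<not> below s t b"
    by blast
  then show ?thesis
  proof cases
    case T
    have t': "t' = t + 1" using assms(2) T by (simp add: gen_def)
    have "low_near a b s 0 (t + 1) (T x)"
    proof (rule zone_imp_low_near)
      show "below s (t + 1) (a + 1)" using T by (simp add: below_add)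
      show T0: "0 \<le> hi (T x)" using xm by (rule ge_zero_T)
      then show "0 \<le> hi (T x)" .
      show "- 1 \<le> hi (T x)" by (rule order.trans[OF _ T0]) simp
      show "1 \<le> hi (T x)" if "0 \<le> t + 1" using x0 that by (intro ge_one_T) simp
    qed
    then show ?thesis using T t' by (simp add: gen_def)
  next
    case S
    have g: "gen a b s t = S" using S by (simp add: gen_def)
    then have t: "t \<noteq> 0" "t' = - 1 / t" using assms(2) by (auto split: if_splits)
    show ?thesis
    proof (cases "0 < t")
      case True
      have t0: "- 1 / t < 0" and inv: "- 1 / (- 1 / t) = t" using True by auto
      have tS: "below s (- 1 / t) (- 1 / b)" using below_Sb[OF t0, of s] S inv by simp
      have t1: "- 1 / t < - 1" using True ta a_neg by (simp add: field_simps)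
      have "low_near a b s 0 (- 1 / t) (S x)"
      proof (rule zone_imp_low_near)
        show "below s (- 1 / t) (a + 1)"
          using tS by (rule below_mono) (use Sb_less_a1 in simp)
        show "- 1 \<le> hi (S x)" using x1[OF True] by (cases x) (auto simp: one_ereal_def field_simps)
      qed (use tS t1 t0 in auto)
      then show ?thesis using g t by simp
    next
      case False
      then have tn: "t < 0" using t by simp
      have x: "0 \<le> hi x" using x0' not_below_ge S(1) by blast
      have x': "0 \<le> hi (neg (S x))" using x by (cases x) (auto simp: divide_nonneg_nonneg)
      have b1: "below (\<not> s) (- (- 1 / t)) (- 1 / - a)"
        using S(1) tn a_neg by (auto simp: below_def field_simps split: if_splits)
      have "low_near (- b) (- a) (\<not> s) 0 (- (- 1 / t)) (neg (S x))"
      proof (rule m.zone_imp_low_near)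
        show "below (\<not> s) (- (- 1 / t)) (- b + 1)"
          using b1 by (rule below_mono) (use m.Sb_less_a1 in simp)
        show "- 1 \<le> hi (neg (S x))" by (rule order.trans[OF _ x']) simp
        show "1 \<le> hi (neg (S x))" if "0 \<le> - (- 1 / t)" using that tn by (simp add: divide_nonpos_neg field_simps)
      qed (use x' in auto)
      then show ?thesis using g t by (simp add: up_near_def)
    qed
  next
    case Ti
    \<comment> \<open>only possible for \<open>t = b = a + 1\<close>\<close>
    have tb: "t = b" "b = a + 1" using not_below_ge[OF Ti] ta gap by linarith+
    have x: "1 \<le> hi x" using x1 tb b_pos by simp
    have g: "gen a b s t = Tinv" using Ti below_mono[of s t a b] tb by (auto simp: gen_def)
    have t': "t' = a" using assms(2) g tb by simp
    have x': "0 \<le> hi (Tinv x)" using x by (cases x) (auto simp: one_ereal_def)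
    have "low_near a b s 0 a (Tinv x)"
    proof (rule zone_imp_low_near)
      show "- 1 \<le> hi (Tinv x)" by (rule order.trans[OF _ x']) simp
    qed (use x' a_neg in \<open>auto intro: less_below\<close>)
    then show ?thesis using g t' by simp
  qed
qed

lemma Theta_image_near:
  assumes "(x, Fin t) \<in> (F a b ^^ Suc n) ` Theta a b"
  shows "low_near a b True n t x \<or> up_near a b True n t x"
  using assms
proof (induction n arbitrary: x t)
  case 0
  interpret m: ab "- b" "- a" by (rule mirror)
  have less: "a < b" using a_neg b_pos by linarith
  obtain x' y' where p: "(x', y') \<in> Theta a b" "F a b (x', y') = (x, Fin t)" using 0 by auto
  obtain t' where y': "y' = Fin t'" using p(2) by (cases y') (auto simp: F_def)
  have g: "gen a b True t' x' = x" "gen a b True t' (Fin t') = Fin t"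
    using p(2) y' rho_eq_gen[of a b t'] by (auto simp: F_def simp del: rho.simps)
  consider "(x', Fin t') \<in> Theta_l a b" | "(x', Fin t') \<in> Theta_u a b"
    using p(1) y' by (auto simp: Theta_def)
  then show ?case
  proof cases
    case 1
    then show ?thesis using theta_row_step[OF Theta_l_imp_theta_row] g by metis
  next
    case 2
    then have th: "theta_row (- b) (- a) (- t') (neg x')"
      using neg_in_Theta_l[of x' "Fin t'" b a] by (intro m.Theta_l_imp_theta_row) simp
    have "gen (- b) (- a) (\<not> True) (- t') (Fin (- t')) = Fin (- t)"
      using gen_mirror[OF less, of True t' "Fin t'"] g by simp
    from m.theta_row_step[OF th this] show ?thesis
      using gen_mirror[OF less, of True t' x'] g by (auto simp: up_near_def)
  qed
next
  case (Suc n)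
  then obtain q where q: "q \<in> Theta a b" "F a b ((F a b ^^ Suc n) q) = (x, Fin t)"
    by auto
  then obtain x' y' where p: "(x', y') \<in> (F a b ^^ Suc n) ` Theta a b" "F a b (x', y') = (x, Fin t)"
    by (metis imageI prod.exhaust)
  obtain t' where y': "y' = Fin t'" using p(2) by (cases y') (auto simp: F_def)
  have g: "gen a b True t' x' = x" "gen a b True t' (Fin t') = Fin t"
    using p(2) y' rho_eq_gen[of a b t'] by (auto simp: F_def simp del: rho.simps)
  from Suc.IH[of x' t'] p(1) y' have "low_near a b True n t' x' \<or> up_near a b True n t' x'" by simp
  then show ?case using low_near_step up_near_step g by metis
qed

text \<open>
  A point outside the region is far from the left wall or far from the right wall, and the contraction excludes
  both for large \<open>n\<close>.
\<close>

theorem attractor_eq_region: "attractor a b = region a b"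
proof
  show "region a b \<subseteq> attractor a b" by (rule region_subset_attractor)
  show "attractor a b \<subseteq> region a b"
  proof
    fix p assume p: "p \<in> attractor a b"
    interpret m: ab "- b" "- a" by (rule mirror)
    obtain x y where xy: "p = (x, y)" by (cases p)
    have im: "(x, y) \<in> (F a b ^^ n) ` Theta a b" for n
      using p unfolding xy attractor_def D_n_def
      by (metis INT_E UNIV_I atLeastAtMost_iff le_refl zero_le)
    have ne: "x \<noteq> y" using im[of 0] by (auto simp: Theta_def diagonal_def)
    have "low_row a b True t x \<or> up_row a b True t x" if t: "y = Fin t" for t
    proof (cases "\<forall>n. low_near a b True n t x")
      case True
      then show ?thesis using low_near_limit by blast
    next
      case False
      then obtain n0 where n0: "\<not> low_near a b True n0 t x" by blast
      have "up_near a b True n t x" for n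
      proof -
        have "\<not> low_near a b True (max n n0) t x" using n0 low_near_antimono by (meson max.cobounded2)
        then have "up_near a b True (max n n0) t x" using Theta_image_near im t by blast
        then show ?thesis unfolding up_near_def by (rule m.low_near_antimono) simp
      qed
      then have "up_row a b True t x"
        unfolding up_near_def up_row_mirror by (intro m.low_near_limit)
      then show ?thesis ..
    qed
    with ne xy show "p \<in> region a b" by (cases y) (auto simp: region_def)
  qed
qed

end

section \<open>Live lower orbits\<close>

lemma lower_walk_Suc:
  "lower_walk a b c (Suc n) = rho_low a b (lower_orbit a b c n) \<circ> lower_walk a b c n"
  by (cases c) (auto simp: lower_orbit_def)

lemma lower_orbit_Suc:
  "lower_orbit a b c (Suc n) = rho_low a b (lower_orbit a b c n) (lower_orbit a b c n)"
  unfolding lower_orbit_def lower_walk_Suc by (simp add: lower_orbit_def)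

lemma lower_orbit_0: "lower_orbit a b c 0 = (case c of At_a \<Rightarrow> Fin (a + 1) | At_b \<Rightarrow> S (Fin b))"
  by (cases c) (auto simp: lower_orbit_def)

lemma lower_walk_0: "lower_walk a b c 0 = (case c of At_a \<Rightarrow> T | At_b \<Rightarrow> S)"
  by (cases c) auto

text \<open>
  The levels \<open>z\<close> with the property that the recursion for the left wall at the next level of a lower orbit leads back to \<open>z\<close>.
  The level \<open>S b\<close> has two predecessors, \<open>b\<close> and \<open>S b - 1\<close>; the left limit of the wall comes from the first and the
  right limit from the second.
\<close>

definition steppable :: "real \<Rightarrow> real \<Rightarrow> rbar \<Rightarrow> bool" where
  "steppable a b z \<longleftrightarrow> (case z of Fin t \<Rightarrow> 0 < t \<and> t \<le> b \<or> - 1 / b - 1 \<le> t \<and> t \<le> a | Infty \<Rightarrow> False)"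

text \<open>
  The part of a lower orbit on which the wall can jump.
\<close>

definition live :: "real \<Rightarrow> real \<Rightarrow> disc \<Rightarrow> nat \<Rightarrow> bool" where
  "live a b c n \<longleftrightarrow> (\<forall>j<n. steppable a b (lower_orbit a b c j))"

lemma live_0 [simp]: "live a b c 0"
  by (simp add: live_def)

lemma live_Suc: "live a b c (Suc n) \<longleftrightarrow> live a b c n \<and> steppable a b (lower_orbit a b c n)"
  by (auto simp: live_def less_Suc_eq)

lemma live_mono: "live a b c n \<Longrightarrow> m \<le> n \<Longrightarrow> live a b c m"
  by (auto simp: live_def)

definition visits :: "real \<Rightarrow> real \<Rightarrow> disc \<Rightarrow> rbar \<Rightarrow> bool" where
  "visits a b c y \<longleftrightarrow> (\<exists>n. live a b c n \<and> lower_orbit a b c n = y)"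

definition live_values :: "real \<Rightarrow> real \<Rightarrow> real set" where
  "live_values a b = {t. \<exists>c. visits a b c (Fin t)}"

definition jump :: "real \<Rightarrow> real \<Rightarrow> real \<Rightarrow> rbar set" where
  "jump a b t = arc (lwall a b False t) (lwall a b True t)"

context ab
begin

lemma rho_low_T: "t \<le> a \<Longrightarrow> rho_low a b (Fin t) = T"
  by simp

lemma rho_low_S: "0 < t \<Longrightarrow> t \<le> b \<Longrightarrow> rho_low a b (Fin t) = S"
  using a_neg by simp

lemma steppable_cases:
  assumes "steppable a b z"
  obtains (S) t where "z = Fin t" "0 < t" "t \<le> b" "rho_low a b z = S"
    | (T) t where "z = Fin t" "- 1 / b - 1 \<le> t" "t \<le> a" "rho_low a b z = T"
proof (cases z)
  case (Fin t)
  then consider "0 < t" "t \<le> b" | "- 1 / b - 1 \<le> t" "t \<le> a"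
    using assms by (auto simp: steppable_def)
  then show ?thesis
  proof cases
    case 1
    then show ?thesis using S[of t] Fin rho_low_S by blast
  next
    case 2
    then show ?thesis using T[of t] Fin rho_low_T by blast
  qed
qed (use assms in \<open>simp add: steppable_def\<close>)

lemma lower_start: "lower_orbit a b At_a 0 = Fin (a + 1)" "lower_orbit a b At_b 0 = Fin (- 1 / b)"
  using b_pos by (simp_all add: lower_orbit_0)

lemma live_Fin:
  assumes "live a b c n"
  shows "\<exists>t. lower_orbit a b c n = Fin t \<and> t \<le> a + 1"
proof (cases n)
  case 0
  then show ?thesis using lower_start Sb_less_a1 by (cases c) auto
next
  case (Suc m)
  then have "steppable a b (lower_orbit a b c m)" using assms by (simp add: live_Suc)
  then show ?thesis
  proof (cases rule: steppable_cases)
    case (S t)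
    have "- 1 / t \<le> - 1 / b" using S by (simp add: field_simps)
    then have "- 1 / t \<le> a + 1" using Sb_less_a1 by linarith
    then show ?thesis using S Suc by (simp add: lower_orbit_Suc del: rho_low.simps)
  next
    case (T t)
    then show ?thesis using Suc by (simp add: lower_orbit_Suc del: rho_low.simps)
  qed
qed

lemma visits_start: "visits a b At_a (Fin (a + 1))" "visits a b At_b (Fin (- 1 / b))"
  using lower_start live_0 unfolding visits_def by blast+

lemma visits_step: "visits a b c z \<Longrightarrow> steppable a b z \<Longrightarrow> visits a b c (rho_low a b z z)"
  unfolding visits_def by (metis live_Suc lower_orbit_Suc)

lemma live_values_step_T:
  assumes "t \<in> live_values a b" "- 1 / b - 1 \<le> t" "t \<le> a"
  shows "t + 1 \<in> live_values a b"
proof -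
  obtain c where c: "visits a b c (Fin t)" using assms by (auto simp: live_values_def)
  have "steppable a b (Fin t)" using assms by (simp add: steppable_def)
  from visits_step[OF c this] have "visits a b c (Fin (t + 1))" using assms by simp
  then show ?thesis by (auto simp: live_values_def)
qed

lemma live_values_step_S:
  assumes "t \<in> live_values a b" "0 < t" "t \<le> b"
  shows "- 1 / t \<in> live_values a b"
proof -
  obtain c where c: "visits a b c (Fin t)" using assms by (auto simp: live_values_def)
  have "steppable a b (Fin t)" using assms by (simp add: steppable_def)
  from visits_step[OF c this] have "visits a b c (Fin (- 1 / t))" using assms a_neg by simp
  then show ?thesis by (auto simp: live_values_def)
qed

lemma live_values_start: "a + 1 \<in> live_values a b" "- 1 / b \<in> live_values a b"
  using visits_start by (auto simp: live_values_def)

subsection \<open>The left wall only jumps at live values\<close>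

definition agree :: "bool \<Rightarrow> real \<Rightarrow> bool \<Rightarrow> real \<Rightarrow> bool" where
  "agree s y s' y' \<longleftrightarrow> (\<forall>c\<in>live_values a b. below s y c \<longleftrightarrow> below s' y' c)"

lemma agree_T:
  assumes "agree s y s' y'" "\<not> below s y (- 1 / b)" "below s y (a + 1)"
  shows "agree s (y - 1) s' (y' - 1)"
  unfolding agree_def
proof
  fix c assume c: "c \<in> live_values a b"
  have y': "\<not> below s' y' (- 1 / b)" "below s' y' (a + 1)"
    using assms live_values_start unfolding agree_def by auto
  consider "c < - 1 / b - 1" | "- 1 / b - 1 \<le> c" "c \<le> a" | "a < c" by linarith
  then show "below s (y - 1) c \<longleftrightarrow> below s' (y' - 1) c"
  proof cases
    case 1
    then have "\<not> below s y (c + 1)" "\<not> below s' y' (c + 1)"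
      using assms(2) y'(1) below_mono[of s y "c + 1" "- 1 / b"] below_mono[of s' y' "c + 1" "- 1 / b"]
      by auto
    then show ?thesis by (simp add: below_diff)
  next
    case 2
    then have "c + 1 \<in> live_values a b" using c live_values_step_T by blast
    then show ?thesis using assms(1) by (simp add: agree_def below_diff)
  next
    case 3
    then have "below s y (c + 1)" "below s' y' (c + 1)"
      using assms(3) y'(2) below_mono[of s y "a + 1" "c + 1"] below_mono[of s' y' "a + 1" "c + 1"]
      by auto
    then show ?thesis by (simp add: below_diff)
  qed
qed

lemma agree_S:
  assumes "agree s y s' y'" "below s y (- 1 / b)"
  shows "agree s (- 1 / y) s' (- 1 / y')"
  unfolding agree_def
proof
  fix c assume c: "c \<in> live_values a b"
  have yS': "below s' y' (- 1 / b)" using assms live_values_start unfolding agree_def by auto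
  have y: "y < 0" "y' < 0" using assms(2) yS' below_le Sb_neg by (meson order.strict_trans1)+
  have yb: "below s (- 1 / y) b" "below s' (- 1 / y') b" using y assms(2) yS' below_Sb by auto
  consider "c \<le> 0" | "0 < c" "c \<le> b" | "b < c" by linarith
  then show "below s (- 1 / y) c \<longleftrightarrow> below s' (- 1 / y') c"
  proof cases
    case 1
    then have "c < - 1 / y" "c < - 1 / y'" using y by (auto intro: order.strict_trans1)
    then show ?thesis using not_below_less by blast
  next
    case 2
    then have "- 1 / c \<in> live_values a b" using c live_values_step_S by blast
    then have "below s y (- 1 / c) \<longleftrightarrow> below s' y' (- 1 / c)" using assms(1) by (simp add: agree_def)
    moreover have "below s (- 1 / y) c \<longleftrightarrow> below s y (- 1 / c)" if "y < 0" for s y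
      using that 2 by (auto simp: below_def field_simps)
    ultimately show ?thesis using y by blast
  next
    case 3
    then have "below s (- 1 / y) c" "below s' (- 1 / y') c"
      using yb below_mono less_imp_le by blast+
    then show ?thesis by blast
  qed
qed

lemma agree_approx:
  assumes "agree s y s' y'"
  shows "(\<not> below s y (- 1 / b) \<longrightarrow>
      \<bar>chi2 (lwall a b s y) - chi2 (lwall a b s' y')\<bar> \<le> 3 / (real n + 3)) \<and>
    (0 \<le> y \<and> 0 \<le> y' \<longrightarrow> \<bar>chi3 (lwall a b s y) - chi3 (lwall a b s' y')\<bar> \<le> 3 / (real n + 2)) \<and>
    (below s y (- 1 / b) \<longrightarrow>
      \<bar>chi1 (lwall a b s y) - chi1 (lwall a b s' y')\<bar> \<le> 3 / (real n + 1))"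
  using assms
proof (induction n arbitrary: s y s' y')
  case 0
  have bb: "below s y (- 1 / b) \<longleftrightarrow> below s' y' (- 1 / b)"
    using 0 live_values_start by (auto simp: agree_def)
  have "\<bar>u - v\<bar> \<le> 1" if "0 \<le> u \<and> u \<le> 1" "0 \<le> v \<and> v \<le> 1" for u v :: real
    using that by linarith
  note d = this
  have "\<bar>chi2 (lwall a b s y) - chi2 (lwall a b s' y')\<bar> \<le> 1" if "\<not> below s y (- 1 / b)"
    using that bb lwall_zone2 chi2_range d by blast
  moreover have "\<bar>chi3 (lwall a b s y) - chi3 (lwall a b s' y')\<bar> \<le> 1" if "0 \<le> y" "0 \<le> y'"
    using that lwall_zone3 chi3_range d by blast
  moreover have "\<bar>chi1 (lwall a b s y) - chi1 (lwall a b s' y')\<bar> \<le> 1" if "below s y (- 1 / b)"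
    using that bb lwall_zone1 chi1_range d by blast
  ultimately show ?case by fastforce
next
  case (Suc n)
  have bb: "below s y (- 1 / b) \<longleftrightarrow> below s' y' (- 1 / b)"
    and ba: "below s y (a + 1) \<longleftrightarrow> below s' y' (a + 1)"
    using Suc.prems live_values_start by (auto simp: agree_def)
  let ?l = "lwall a b s y" and ?l' = "lwall a b s' y'"
  let ?m = "lwall a b s (y - 1)" and ?m' = "lwall a b s' (y' - 1)"
  have top: "?l = ?l'" if "\<not> below s y (a + 1)" using that ba lwall_top by simp
  have prev: "?l = T ?m" "?l' = T ?m'" "agree s (y - 1) s' (y' - 1)"
    if "\<not> below s y (- 1 / b)" "below s y (a + 1)"
    using that bb ba lwall_T agree_T[OF Suc.prems] by blast+
  have pb: "below s (y - 1) (- 1 / b) \<longleftrightarrow> below s' (y' - 1) (- 1 / b)"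
    if "agree s (y - 1) s' (y' - 1)"
    using that live_values_start by (auto simp: agree_def)
  have two: "\<bar>chi2 ?l - chi2 ?l'\<bar> \<le> 3 / (real (Suc n) + 3)" if A: "\<not> below s y (- 1 / b)"
  proof (cases "below s y (a + 1)")
    case True
    note P = prev[OF A True]
    show ?thesis
    proof (cases "below s (y - 1) (- 1 / b)")
      case z: True
      then have z': "below s' (y' - 1) (- 1 / b)" using pb P by blast
      have "\<bar>chi1 ?m - chi1 ?m'\<bar> \<le> 3 / (real n + 1)" using Suc.IH[OF P(3)] z by blast
      then have "\<bar>1 / (2 - chi1 ?m) - 1 / (2 - chi1 ?m')\<bar> \<le> 3 / (real n + 1) / (1 + 3 / (real n + 1))"
        using chi1_range lwall_zone1[OF z] lwall_zone1[OF z'] by (intro shrink_ST_abs) auto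
      then show ?thesis
        using P chi2_T_low lwall_zone1[OF z] lwall_zone1[OF z'] shrink_three[of "real n + 1"]
        by (simp add: add.commute add.left_commute)
    next
      case z: False
      then have z': "\<not> below s' (y' - 1) (- 1 / b)" using pb P by blast
      note m = lwall_zone2[OF z] lwall_zone2[OF z']
      have "\<bar>chi2 ?m - chi2 ?m'\<bar> \<le> 3 / (real n + 3)" using Suc.IH[OF P(3)] z by blast
      then have "\<bar>chi2 ?m / (1 + chi2 ?m) - chi2 ?m' / (1 + chi2 ?m')\<bar>
          \<le> 3 / (real n + 3) / (1 + 3 / (real n + 3))"
        using chi2_range m by (intro shrink_T_abs) auto
      also have "3 / (real n + 3) / (1 + 3 / (real n + 3)) = 3 / (real n + 6)"
        using shrink_three[of "real n + 3"] by (simp add: add.commute add.left_commute)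
      also have "\<dots> \<le> 3 / (real (Suc n) + 3)" by (intro divide_left_mono) auto
      finally show ?thesis using P chi2_T m by simp
    qed
  qed (use top in simp)
  have three: "\<bar>chi3 ?l - chi3 ?l'\<bar> \<le> 3 / (real (Suc n) + 2)" if A: "0 \<le> y" "0 \<le> y'"
  proof (cases "below s y (a + 1)")
    case True
    have nb: "\<not> below s y (- 1 / b)" using A Sb_neg by (intro not_below_less) linarith
    note P = prev[OF nb True]
    show ?thesis
    proof (cases "below s (y - 1) (- 1 / b)")
      case z: True
      then have z': "below s' (y' - 1) (- 1 / b)" using pb P by blast
      have zero: "lwall a b s (y - 1) = Fin 0" if "below s (y - 1) (- 1 / b)" "0 \<le> y" for s y
      proof -
        have "y - 1 < 0" using that(1) below_le Sb_neg by (meson order.strict_trans1)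
        then have "1 \<le> - 1 / (y - 1)" using that(2) by (simp add: field_simps)
        then have "\<not> below s (- 1 / (y - 1)) (a + 1)" using a_neg by (intro not_below_less) linarith
        then show ?thesis using lwall_S[OF that(1)] lwall_top by simp
      qed
      show ?thesis using P zero[OF z A(1)] zero[OF z' A(2)] by simp
    next
      case z: False
      then have z': "\<not> below s' (y' - 1) (- 1 / b)" using pb P by blast
      have "\<bar>chi2 ?m - chi2 ?m'\<bar> \<le> 3 / (real n + 3)" using Suc.IH[OF P(3)] z by blast
      then show ?thesis using P chi3_T lwall_zone2[OF z] lwall_zone2[OF z']
        by (simp add: add.commute add.left_commute)
    qed
  qed (use top in simp)
  have one: "\<bar>chi1 ?l - chi1 ?l'\<bar> \<le> 3 / (real (Suc n) + 1)" if A: "below s y (- 1 / b)"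
  proof -
    have A': "below s' y' (- 1 / b)" using A bb by blast
    have y: "y < 0" "y' < 0" using A A' below_le Sb_neg by (meson order.strict_trans1)+
    have pos: "0 \<le> - 1 / y" "0 \<le> - 1 / y'" using y by (auto simp: divide_nonpos_neg)
    have "\<bar>chi3 (lwall a b s (- 1 / y)) - chi3 (lwall a b s' (- 1 / y'))\<bar> \<le> 3 / (real n + 2)"
      using Suc.IH[OF agree_S[OF Suc.prems A]] pos by blast
    then show ?thesis
      using lwall_S[OF A] lwall_S[OF A'] chi1_S lwall_zone3[OF pos(1), of s] lwall_zone3[OF pos(2), of s']
      by (simp add: add.commute add.left_commute)
  qed
  show ?case using one two three by blast
qed

text \<open>
  Two sided levels that no live value separates follow the same recursion for ever, because the live values are closed
  under the forward steps; then the contraction identifies the walls.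
\<close>

theorem lwall_agree:
  assumes "agree s y s' y'"
  shows "lwall a b s y = lwall a b s' y'"
proof -
  have bb: "below s y (- 1 / b) \<longleftrightarrow> below s' y' (- 1 / b)"
    using assms live_values_start by (auto simp: agree_def)
  show ?thesis
  proof (cases "below s y (- 1 / b)")
    case True
    then have z: "- 1 \<le> hi (lwall a b s y)" "hi (lwall a b s y) \<le> 0"
      "- 1 \<le> hi (lwall a b s' y')" "hi (lwall a b s' y') \<le> 0"
      using bb lwall_zone1 by blast+
    have "chi1 (lwall a b s y) = chi1 (lwall a b s' y')"
      by (rule eq_of_approx[of _ _ 1]) (use agree_approx[OF assms] True in auto)
    then have "hi (lwall a b s y) = hi (lwall a b s' y')"
      using z chi1_le_iff[of "lwall a b s y" "lwall a b s' y'"]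
        chi1_le_iff[of "lwall a b s' y'" "lwall a b s y"] by simp
    then show ?thesis by (simp add: hi_inj)
  next
    case False
    then have z: "0 \<le> hi (lwall a b s y)" "0 \<le> hi (lwall a b s' y')" using bb lwall_zone2 by blast+
    have "chi2 (lwall a b s y) = chi2 (lwall a b s' y')"
      by (rule eq_of_approx[of _ _ 3]) (use agree_approx[OF assms] False in auto)
    then have "hi (lwall a b s y) = hi (lwall a b s' y')"
      using z chi2_le_iff[of "lwall a b s y" "lwall a b s' y'"]
        chi2_le_iff[of "lwall a b s' y'" "lwall a b s y"] by simp
    then show ?thesis by (simp add: hi_inj)
  qed
qed

text \<open>
  The case of an interval that contains no live value.
\<close>

lemma lwall_const:
  assumes "y \<le> y'" "\<And>c. c \<in> live_values a b \<Longrightarrow> \<not> (y < c \<and> c < y')"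
    "s \<or> y \<notin> live_values a b" "\<not> s' \<or> y' \<notin> live_values a b" "y < y' \<or> s = s'"
  shows "lwall a b s y = lwall a b s' y'"
proof (rule lwall_agree)
  show "agree s y s' y'" unfolding agree_def
  proof
    fix c assume c: "c \<in> live_values a b"
    then consider "c < y" | "c = y" | "y < c" "c = y'" | "y < c" "y' < c" using assms(2)
      by (metis linorder_less_linear)
    then show "below s y c \<longleftrightarrow> below s' y' c"
      using assms(1,3-5) c by cases (auto simp: below_def)
  qed
qed

subsection \<open>Jumps are carried along live orbits\<close>

lemma jump_T:
  assumes "- 1 / b - 1 \<le> t" "t \<le> a"
  shows "T ` jump a b t \<subseteq> jump a b (t + 1)"
    "t \<noteq> a \<Longrightarrow> t + 1 \<noteq> - 1 / b \<Longrightarrow> T ` jump a b t = jump a b (t + 1)"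
proof -
  have m: "lwall a b False (t + 1) = T (lwall a b False t)" if "t + 1 \<noteq> - 1 / b"
  proof -
    have "\<not> below False (t + 1) (- 1 / b)" using that assms by (intro not_below_less) linarith
    moreover have "below False (t + 1) (a + 1)" using assms by (simp add: below_def)
    ultimately show ?thesis using lwall_T by fastforce
  qed
  have m': "hi (lwall a b False (t + 1)) \<le> hi (T (lwall a b False t))"
  proof (cases "t + 1 = - 1 / b")
    case True
    then have "below False (t + 1) (- 1 / b)" by (simp add: below_def)
    then have "hi (lwall a b False (t + 1)) \<le> 0" using lwall_zone1 by blast
    also have "\<dots> \<le> hi (T (lwall a b False t))" by (rule ge_zero_T) (rule lwall_ge_m1)
    finally show ?thesis .
  qed (use m in simp)
  have p: "lwall a b True (t + 1) = T (lwall a b True t)" if "t \<noteq> a"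
  proof -
    have "\<not> below True (t + 1) (- 1 / b)" "below True (t + 1) (a + 1)"
      using that assms by (auto simp: below_def)
    then show ?thesis using lwall_T by fastforce
  qed
  have p': "hi (T (lwall a b True t)) \<le> hi (lwall a b True (t + 1))"
  proof (cases "t = a")
    case True
    then have "lwall a b True (t + 1) = Infty" by (intro lwall_top) (simp add: below_def)
    then show ?thesis by simp
  qed (use p in simp)
  show "T ` jump a b t \<subseteq> jump a b (t + 1)"
    unfolding jump_def T_image_arc using m' p' by (auto simp: arc_def)
  show "T ` jump a b t = jump a b (t + 1)" if "t \<noteq> a" "t + 1 \<noteq> - 1 / b"
    unfolding jump_def T_image_arc using m p that by simp
qed

lemma jump_ge_one: "0 \<le> t \<Longrightarrow> z \<in> jump a b t \<Longrightarrow> 1 \<le> hi z"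
  unfolding jump_def arc_def using lwall_zone3[of t False] by (auto intro: order.trans)

lemma jump_S:
  assumes "0 < t" "t \<le> b"
  shows "S ` jump a b t \<subseteq> jump a b (- 1 / t)"
    "t \<noteq> b \<Longrightarrow> S ` jump a b t = jump a b (- 1 / t)"
proof -
  have neg: "- 1 / t < 0" and inv: "- 1 / (- 1 / t) = t" using assms by auto
  have "1 \<le> hi (lwall a b False t)" using assms by (intro lwall_zone3) simp
  then have pos: "0 < hi (lwall a b False t)"
    by (cases "lwall a b False t") (auto simp: one_ereal_def)
  have im: "S ` jump a b t = arc (S (lwall a b False t)) (S (lwall a b True t))"
    unfolding jump_def by (rule S_image_arc[OF pos lwall_sides])
  have m: "lwall a b False (- 1 / t) = S (lwall a b False t)"
    using lwall_S[of False "- 1 / t"] below_Sb[OF neg, of False] assms inv by (simp add: below_def)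
  have p: "lwall a b True (- 1 / t) = S (lwall a b True t)" if "t \<noteq> b"
    using lwall_S[of True "- 1 / t"] below_Sb[OF neg, of True] assms inv that by (simp add: below_def)
  have p': "hi (S (lwall a b True t)) \<le> hi (lwall a b True (- 1 / t))"
  proof (cases "t = b")
    case True
    then have "lwall a b True t = Infty" using gap by (intro lwall_top) (simp add: below_def)
    moreover have "0 \<le> hi (lwall a b True (- 1 / t))"
      using True by (intro lwall_zone2) (simp add: below_def)
    ultimately show ?thesis by (simp add: zero_ereal_def)
  qed (use p in simp)
  show "S ` jump a b t \<subseteq> jump a b (- 1 / t)"
    unfolding im using p' m by (auto simp: jump_def arc_def)
  show "S ` jump a b t = jump a b (- 1 / t)" if "t \<noteq> b"
    unfolding im using m p that by (simp add: jump_def)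
qed

text \<open>
  The transport is onto unless the next level is \<open>T a\<close> or \<open>S b\<close>: there a new piece of the jump starts, which is
  the segment of the discontinuity point itself.
\<close>

lemma jump_step:
  assumes "steppable a b (Fin t)" "rho_low a b (Fin t) (Fin t) = Fin t'"
  shows "rho_low a b (Fin t) ` jump a b t \<subseteq> jump a b t'"
    "t' \<noteq> a + 1 \<Longrightarrow> t' \<noteq> - 1 / b \<Longrightarrow> rho_low a b (Fin t) ` jump a b t = jump a b t'"
    "z \<in> jump a b t \<Longrightarrow> w \<in> jump a b t \<Longrightarrow>
      hi (rho_low a b (Fin t) z) \<le> hi (rho_low a b (Fin t) w) \<longleftrightarrow> hi z \<le> hi w"
proof -
  have "(rho_low a b (Fin t) ` jump a b t \<subseteq> jump a b t') \<and>
    (t' \<noteq> a + 1 \<longrightarrow> t' \<noteq> - 1 / b \<longrightarrow> rho_low a b (Fin t) ` jump a b t = jump a b t') \<and>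
    (z \<in> jump a b t \<longrightarrow> w \<in> jump a b t \<longrightarrow>
      (hi (rho_low a b (Fin t) z) \<le> hi (rho_low a b (Fin t) w) \<longleftrightarrow> hi z \<le> hi w))"
    using assms(1)
  proof (cases rule: steppable_cases)
    case (S u)
    then have t': "t' = - 1 / t" using assms(2) by (simp del: rho_low.simps)
    have pos: "0 < hi v" if "v \<in> jump a b t" for v
      using jump_ge_one[of t v] that S by (cases v) (auto simp: one_ereal_def)
    have "t' \<noteq> - 1 / b \<Longrightarrow> t \<noteq> b" using t' by auto
    then show ?thesis using S t' jump_S[of t] pos hi_S_le_iff by (auto simp del: rho_low.simps)
  next
    case (T u)
    then have "t' = t + 1" using assms(2) by (simp del: rho_low.simps)
    then show ?thesis using T jump_T[of t] hi_T_le_iff by (auto simp del: rho_low.simps)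
  qed
  then show "rho_low a b (Fin t) ` jump a b t \<subseteq> jump a b t'"
    "t' \<noteq> a + 1 \<Longrightarrow> t' \<noteq> - 1 / b \<Longrightarrow> rho_low a b (Fin t) ` jump a b t = jump a b t'"
    "z \<in> jump a b t \<Longrightarrow> w \<in> jump a b t \<Longrightarrow>
      hi (rho_low a b (Fin t) z) \<le> hi (rho_low a b (Fin t) w) \<longleftrightarrow> hi z \<le> hi w"
    by blast+
qed

text \<open>
  A value of a live orbit determines the preceding one, except for \<open>S b\<close>.
\<close>

lemma steppable_inj:
  assumes "steppable a b z" "steppable a b w" "rho_low a b z z = y" "rho_low a b w w = y"
    "y \<noteq> Fin (- 1 / b)"
  shows "z = w"
proof -
  have S_le: "\<exists>v. S (Fin u) = Fin v \<and> v \<le> - 1 / b" if "0 < u" "u \<le> b" for u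
    using that by (intro exI[of _ "- 1 / u"]) (simp add: field_simps)
  show ?thesis using assms(1)
  proof (cases rule: steppable_cases)
    case z: (S t)
    show ?thesis using assms(2)
    proof (cases rule: steppable_cases)
      case w: (S u)
      then show ?thesis using z assms(3,4) by (metis S_inj)
    next
      case w: (T u)
      obtain v where v: "S z = Fin v" "v \<le> - 1 / b" using S_le z by blast
      then have y: "y = Fin v" using z assms(3) by metis
      moreover have "y = Fin (u + 1)" using w assms(4) by (metis T.simps(1))
      ultimately have "v = - 1 / b" using v w by simp
      then show ?thesis using y assms(5) by blast
    qed
  next
    case z: (T t)
    show ?thesis using assms(2)
    proof (cases rule: steppable_cases)
      case w: (S u)
      obtain v where v: "S w = Fin v" "v \<le> - 1 / b" using S_le w by blast
      then have y: "y = Fin v" using w assms(4) by metis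
      moreover have "y = Fin (t + 1)" using z assms(3) by (metis T.simps(1))
      ultimately have "v = - 1 / b" using v z by simp
      then show ?thesis using y assms(5) by blast
    next
      case w: (T u)
      then show ?thesis using z assms(3,4) by (metis T_inj)
    qed
  qed
qed

end

section \<open>First visits and segments\<close>

lemma lower_orbit_shift:
  "lower_orbit a b c i = lower_orbit a b c j \<Longrightarrow> lower_orbit a b c (i + k) = lower_orbit a b c (j + k)"
  by (induction k) (auto simp: lower_orbit_Suc)

definition first_visit :: "real \<Rightarrow> real \<Rightarrow> disc \<Rightarrow> rbar \<Rightarrow> nat" where
  "first_visit a b c y = (LEAST n. lower_orbit a b c n = y)"

lemma lower_map_eq: "lower_map a b (c, y) = lower_walk a b c (first_visit a b c y)"
  by (simp add: lower_map_def first_visit_def)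

lemma first_visit_orbit: "lower_orbit a b c n = y \<Longrightarrow> lower_orbit a b c (first_visit a b c y) = y"
  unfolding first_visit_def by (rule LeastI)

lemma first_visit_le: "lower_orbit a b c n = y \<Longrightarrow> first_visit a b c y \<le> n"
  unfolding first_visit_def by (rule Least_le)

lemma first_visit_not_less: "n < first_visit a b c y \<Longrightarrow> lower_orbit a b c n \<noteq> y"
  using first_visit_le[of a b c n y] by auto

lemma visits_first:
  assumes "visits a b c y"
  shows "live a b c (first_visit a b c y)" "lower_orbit a b c (first_visit a b c y) = y"
  using assms first_visit_orbit first_visit_le live_mono unfolding visits_def by blast+

lemma ray_a_iff: "z \<in> ray xa xb At_a \<longleftrightarrow> ereal xa \<le> hi z"
  by (cases z) (auto simp: ray_def in_ivl_Fin in_ivl_Infty)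

lemma ray_b_iff: "z \<in> ray xa xb At_b \<longleftrightarrow> lo z \<le> ereal xb"
  by (cases z) (auto simp: ray_def in_ivl_Fin in_ivl_Infty)

lemma ray_left_in: "ray_left xa xb c \<in> ray xa xb c"
  by (cases c) (auto simp: ray_a_iff ray_b_iff)

lemma lo_le_iff_S:
  assumes "x < 0"
  shows "lo z \<le> ereal x \<longleftrightarrow> 0 \<le> hi (S z) \<and> hi (S z) \<le> hi (S (Fin x))"
proof (cases z)
  case (Fin u)
  show ?thesis
  proof (cases "u < 0")
    case True
    have "inverse x \<le> inverse u \<longleftrightarrow> u \<le> x" by (rule inverse_le_iff_le_neg) (use True assms in auto)
    moreover have "0 \<le> - inverse u" using True by simp
    ultimately show ?thesis using Fin True assms by (simp add: divide_inverse)
  next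
    case u: False
    show ?thesis
    proof (cases "u = 0")
      case True
      then show ?thesis using Fin assms by simp
    next
      case False
      then have "- inverse u < 0" using u by simp
      then show ?thesis using Fin u False assms by (simp add: divide_inverse)
    qed
  qed
next
  case Infty
  have "0 \<le> - inverse x" using assms by simp
  then show ?thesis using Infty assms by (simp add: divide_inverse zero_ereal_def)
qed

lemma mono_real_fixpoint:
  fixes g :: "real \<Rightarrow> real"
  assumes "p \<le> q" and into: "\<And>x. p \<le> x \<Longrightarrow> x \<le> q \<Longrightarrow> p \<le> g x \<and> g x \<le> q"
    and mono: "\<And>x y. p \<le> x \<Longrightarrow> x \<le> y \<Longrightarrow> y \<le> q \<Longrightarrow> g x \<le> g y"
  shows "\<exists>x. p \<le> x \<and> x \<le> q \<and> g x = x"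
proof -
  define X where "X = {x. p \<le> x \<and> x \<le> q \<and> x \<le> g x}"
  have pX: "p \<in> X" using assms(1) into by (auto simp: X_def)
  have bdd: "bdd_above X" by (rule bdd_aboveI[of _ q]) (simp add: X_def)
  let ?s = "Sup X"
  have s: "p \<le> ?s" using pX bdd by (rule cSup_upper)
  have s': "?s \<le> q" by (rule cSup_least) (use pX in \<open>auto simp: X_def\<close>)
  have le: "?s \<le> g ?s"
  proof (rule cSup_least)
    fix x assume x: "x \<in> X"
    then have "x \<le> g x" "p \<le> x" by (auto simp: X_def)
    moreover have "g x \<le> g ?s" using \<open>p \<le> x\<close> cSup_upper[OF x bdd] s' by (rule mono)
    ultimately show "x \<le> g ?s" by linarith
  qed (use pX in auto)
  then have "g ?s \<le> g (g ?s)" using into[OF s s'] by (intro mono[OF s]) auto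
  then have "g ?s \<in> X" using into[OF s s'] by (simp add: X_def)
  then have "g ?s \<le> ?s" using bdd by (rule cSup_upper)
  with le s s' show ?thesis by (metis antisym)
qed

context ab
begin

lemma lower_map_start:
  "lower_map a b (At_a, Fin (a + 1)) = T" "lower_map a b (At_b, Fin (- 1 / b)) = S"
proof -
  have "first_visit a b At_a (Fin (a + 1)) = 0" "first_visit a b At_b (Fin (- 1 / b)) = 0"
    using first_visit_le lower_start by (metis le_zero_eq)+
  then show "lower_map a b (At_a, Fin (a + 1)) = T" "lower_map a b (At_b, Fin (- 1 / b)) = S"
    by (simp_all add: lower_map_eq)
qed

lemma visits_Fin: "visits a b c y \<Longrightarrow> \<exists>t. y = Fin t \<and> t \<le> a + 1"
  unfolding visits_def using live_Fin by metis

lemma first_visit_step: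
  assumes "visits a b c z" "steppable a b z" "rho_low a b z z = y" "y \<noteq> lower_orbit a b c 0"
    "y \<noteq> Fin (- 1 / b)"
  shows "first_visit a b c y = Suc (first_visit a b c z)"
proof (rule antisym)
  note z = visits_first[OF assms(1)]
  have y: "lower_orbit a b c (Suc (first_visit a b c z)) = y" using z assms by (simp add: lower_orbit_Suc)
  then show "first_visit a b c y \<le> Suc (first_visit a b c z)" by (rule first_visit_le)
  have vy: "visits a b c y" using visits_step assms by metis
  note fy = visits_first[OF vy]
  then obtain m where m: "first_visit a b c y = Suc m" using assms(4) by (metis old.nat.exhaust)
  have "steppable a b (lower_orbit a b c m)" using fy m by (simp add: live_Suc)
  moreover have "rho_low a b (lower_orbit a b c m) (lower_orbit a b c m) = y"
    using fy m by (simp add: lower_orbit_Suc)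
  ultimately have "lower_orbit a b c m = z" using steppable_inj assms by metis
  then have "first_visit a b c z \<le> m" by (rule first_visit_le)
  then show "Suc (first_visit a b c z) \<le> first_visit a b c y" using m by simp
qed

lemma lower_map_step:
  assumes "visits a b c z" "steppable a b z" "rho_low a b z z = y" "y \<noteq> lower_orbit a b c 0"
    "y \<noteq> Fin (- 1 / b)"
  shows "lower_map a b (c, y) = rho_low a b z \<circ> lower_map a b (c, z)"
  using first_visit_step[OF assms] visits_first(2)[OF assms(1)]
  by (simp add: lower_map_eq lower_walk_Suc)

lemma seg_subset_jump:
  assumes "lower_walk a b c 0 ` X \<subseteq> jump a b t0" "lower_orbit a b c 0 = Fin t0"
    and "live a b c n" "lower_orbit a b c n = Fin t"
  shows "lower_walk a b c n ` X \<subseteq> jump a b t"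
  using assms(3,4)
proof (induction n arbitrary: t)
  case 0
  then show ?case using assms by simp
next
  case (Suc n)
  then obtain u where u: "lower_orbit a b c n = Fin u" using live_Fin[of c n] by (auto simp: live_Suc)
  have "lower_walk a b c (Suc n) ` X = rho_low a b (Fin u) ` lower_walk a b c n ` X"
    unfolding lower_walk_Suc u by (simp add: image_comp)
  also have "\<dots> \<subseteq> rho_low a b (Fin u) ` jump a b u"
    using Suc u by (intro image_mono) (simp add: live_Suc)
  also have "\<dots> \<subseteq> jump a b t"
    using Suc.prems u jump_step(1)[of u t] by (simp add: live_Suc lower_orbit_Suc del: rho_low.simps)
  finally show ?case .
qed

lemma seg_order:
  assumes "lower_walk a b c 0 ` X \<subseteq> jump a b t0" "lower_orbit a b c 0 = Fin t0"
    and "live a b c n" "z \<in> X" "w \<in> X"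
  shows "hi (lower_walk a b c n z) \<le> hi (lower_walk a b c n w) \<longleftrightarrow>
    hi (lower_walk a b c 0 z) \<le> hi (lower_walk a b c 0 w)"
  using assms(3)
proof (induction n)
  case (Suc n)
  then obtain u where u: "lower_orbit a b c n = Fin u" using live_Fin[of c n] by (auto simp: live_Suc)
  have st: "steppable a b (Fin u)" using Suc u by (simp add: live_Suc)
  obtain t where t: "lower_orbit a b c (Suc n) = Fin t" using live_Fin[OF Suc.prems] by blast
  have r: "rho_low a b (Fin u) (Fin u) = Fin t" using t u by (simp add: lower_orbit_Suc del: rho_low.simps)
  have "lower_walk a b c n ` X \<subseteq> jump a b u"
    using seg_subset_jump[OF assms(1,2) _ u] Suc by (simp add: live_Suc)
  then have "lower_walk a b c n z \<in> jump a b u" "lower_walk a b c n w \<in> jump a b u"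
    using assms(4,5) by blast+
  from jump_step(3)[OF st r this] show ?case
    using Suc u by (simp add: lower_walk_Suc live_Suc del: rho_low.simps)
qed simp

text \<open>The start values are the only places at which a jump can be larger than the transported one.\<close>

lemma seg_onto_jump:
  assumes "lower_walk a b c 0 ` X = jump a b t0" "lower_orbit a b c 0 = Fin t0"
    and "live a b c n" "lower_orbit a b c n = Fin t"
    and "\<And>j. 0 < j \<Longrightarrow> j \<le> n \<Longrightarrow> lower_orbit a b c j \<notin> {Fin (a + 1), Fin (- 1 / b)}"
  shows "lower_walk a b c n ` X = jump a b t"
  using assms(3-5)
proof (induction n arbitrary: t)
  case 0
  then show ?case using assms(1,2) by simp
next
  case (Suc n)
  then obtain u where u: "lower_orbit a b c n = Fin u" using live_Fin[of c n] by (auto simp: live_Suc)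
  have st: "steppable a b (Fin u)" using Suc u by (simp add: live_Suc)
  have r: "rho_low a b (Fin u) (Fin u) = Fin t"
    using Suc.prems u by (simp add: lower_orbit_Suc del: rho_low.simps)
  have "lower_walk a b c (Suc n) ` X = rho_low a b (Fin u) ` lower_walk a b c n ` X"
    unfolding lower_walk_Suc u by (simp add: image_comp)
  also have "lower_walk a b c n ` X = jump a b u"
    using Suc.IH[OF _ u] Suc.prems by (simp add: live_Suc)
  also have "rho_low a b (Fin u) ` jump a b u = jump a b t"
    using jump_step(2)[OF st r] Suc.prems(2) Suc.prems(3)[of "Suc n"] by simp
  finally show ?case .
qed

subsection \<open>Covering jumps by segments\<close>

text \<open>
  The jump at \<open>t\<close> is filled by the segments of the construction, taken at the first visits of the two orbits.
\<close>

definition covered :: "real \<Rightarrow> real \<Rightarrow> real \<Rightarrow> bool" where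
  "covered xa xb t \<longleftrightarrow> jump a b t \<subseteq>
     (\<Union>c\<in>{c. visits a b c (Fin t)}. lower_map a b (c, Fin t) ` ray xa xb c)"

text \<open>
  Only the two start values need a special choice of endpoints; from there the live orbits carry the coverage
  to all other levels.
\<close>

lemma covered_all:
  assumes "covered xa xb (a + 1)" "covered xa xb (- 1 / b)" "visits a b c (Fin t)"
  shows "covered xa xb t"
proof -
  obtain n where "live a b c n" "lower_orbit a b c n = Fin t"
    using assms(3) unfolding visits_def by blast
  then show ?thesis
  proof (induction n arbitrary: t)
    case 0
    then show ?case using assms(1,2) lower_start by (cases c) auto
  next
    case (Suc n)
    then obtain u where u: "lower_orbit a b c n = Fin u" using live_Fin[of c n] by (auto simp: live_Suc)
    have st: "steppable a b (Fin u)" using Suc u by (simp add: live_Suc)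
    have r: "rho_low a b (Fin u) (Fin u) = Fin t"
      using Suc.prems u by (simp add: lower_orbit_Suc del: rho_low.simps)
    show ?case
    proof (cases "t = a + 1 \<or> t = - 1 / b")
      case True
      then show ?thesis using assms by auto
    next
      case False
      have "covered xa xb u" using Suc u by (simp add: live_Suc)
      have "jump a b t = rho_low a b (Fin u) ` jump a b u"
        using jump_step(2)[OF st r] False by simp
      also have "\<dots> \<subseteq> rho_low a b (Fin u) `
          (\<Union>c\<in>{c. visits a b c (Fin u)}. lower_map a b (c, Fin u) ` ray xa xb c)"
        using \<open>covered xa xb u\<close> unfolding covered_def by (rule image_mono)
      also have "\<dots> = (\<Union>c\<in>{c. visits a b c (Fin u)}.
          (rho_low a b (Fin u) \<circ> lower_map a b (c, Fin u)) ` ray xa xb c)"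
        by (simp add: image_UN image_comp)
      also have "\<dots> \<subseteq> (\<Union>c\<in>{c. visits a b c (Fin t)}. lower_map a b (c, Fin t) ` ray xa xb c)"
      proof (rule UN_mono)
        show "{c. visits a b c (Fin u)} \<subseteq> {c. visits a b c (Fin t)}"
          using visits_step[OF _ st] r by fastforce
        fix c' assume "c' \<in> {c. visits a b c (Fin u)}"
        moreover have "Fin t \<noteq> lower_orbit a b c' 0" using False lower_start by (cases c') auto
        ultimately have "lower_map a b (c', Fin t) = rho_low a b (Fin u) \<circ> lower_map a b (c', Fin u)"
          using st r False by (intro lower_map_step) auto
        then show "(rho_low a b (Fin u) \<circ> lower_map a b (c', Fin u)) ` ray xa xb c' \<subseteq>
            lower_map a b (c', Fin t) ` ray xa xb c'" by simp
      qed
      finally show ?thesis unfolding covered_def .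
    qed
  qed
qed

subsection \<open>Values of the walls at the discontinuity points\<close>

lemma lwall_Sb_plus: "lwall a b True (- 1 / b) = T (lwall a b True (- 1 / b - 1))"
  using Sb_less_a1 by (intro lwall_T) (auto simp: below_def)

lemma lwall_Sb_minus: "lwall a b False (- 1 / b) = S (lwall a b False b)"
  using lwall_S[of False "- 1 / b"] b_pos by (simp add: below_def)

lemma lwall_Sb_minus_0: "a + 1 < b \<Longrightarrow> lwall a b False (- 1 / b) = Fin 0"
  using lwall_Sb_minus lwall_top[of False b] by (simp add: below_def)

text \<open>
  Away from the curve \<open>a b = -1\<close> the jump at \<open>S b\<close> ends at the image of the right wall at \<open>b\<close>: the level \<open>b\<close> is then below
  \<open>S a\<close>, so that the walls match there from the right.
\<close>

lemma lwall_Sb_plus_eq: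
  assumes "- (a * b) < 1"
  shows "lwall a b True (- 1 / b) = S (rwall a b True b)"
proof -
  have inv: "- 1 / (- 1 / b) = b" using b_pos by simp
  have "b < - 1 / a" using assms a_neg by (simp add: field_simps)
  then have "T (lwall a b True (- 1 / b - 1)) = S (rwall a b True (- 1 / (- 1 / b)))"
    using Sb_neg by (intro T_lwall_eq_S_rwall) (auto simp: below_def)
  then show ?thesis by (simp add: lwall_Sb_plus inv del: divide_minus_left)
qed

lemma T_lwall_Sb_minus: "T (lwall a b False (- 1 / b - 1)) = S (rwall a b False b)"
proof -
  have inv: "- 1 / (- 1 / b) = b" using b_pos by simp
  have "T (lwall a b False (- 1 / b - 1)) = S (rwall a b False (- 1 / (- 1 / b)))"
    using Sb_neg b_le_Sa inv by (intro T_lwall_eq_S_rwall) (auto simp: below_def)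
  then show ?thesis by (simp add: inv del: divide_minus_left)
qed

lemma rwall_Sa_minus_eq:
  assumes "- (a * b) < 1"
  shows "rwall a b False (- 1 / a) = S (lwall a b False a)"
proof -
  interpret m: ab "- b" "- a" by (rule mirror)
  have "- (- b * - a) < 1" using assms by (simp add: mult.commute)
  then have "lwall (- b) (- a) True (- 1 / - a) = S (rwall (- b) (- a) True (- a))"
    by (rule m.lwall_Sb_plus_eq)
  then show ?thesis by (simp add: rwall_def neg_S)
qed

lemma lwall_a_ge_1:
  assumes "- (a * b) < 1"
  shows "1 \<le> hi (lwall a b False a)"
proof -
  have "below False (- 1 / a) (- 1 / a)" "\<not> below False (- 1 / a) (b - 1)"
    using b_le_Sa by (auto simp: below_def)
  then have "rwall a b False (- 1 / a) = Tinv (rwall a b False (- 1 / a + 1))" by (rule rwall_Tinv)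
  moreover have "\<not> below False (- 1 / a + 1) (- 1 / a)" by (simp add: below_def)
  then have "0 \<le> lo (rwall a b False (- 1 / a + 1)) \<and> lo (rwall a b False (- 1 / a + 1)) \<le> 1"
    by (rule rwall_zone1)
  moreover have "lwall a b False a = S (rwall a b False (- 1 / a))"
    using rwall_Sa_minus_eq[OF assms] by simp
  ultimately show ?thesis
    by (cases "rwall a b False (- 1 / a + 1)") (auto simp: one_ereal_def field_simps)
qed

lemma rwall_b_le_m1:
  assumes "- (a * b) < 1"
  shows "lo (rwall a b True b) \<le> - 1"
proof -
  interpret m: ab "- b" "- a" by (rule mirror)
  have "1 \<le> hi (lwall (- b) (- a) False (- b))"
    using assms by (intro m.lwall_a_ge_1) (simp add: mult.commute)
  then show ?thesis
    by (cases "lwall (- b) (- a) False (- b)") (auto simp: rwall_def one_ereal_def)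
qed

lemma jump_a1: "jump a b (a + 1) = arc (T (lwall a b False a)) Infty"
proof -
  have "lwall a b False (a + 1) = T (lwall a b False a)"
    using lwall_T[of False "a + 1"] Sb_less_a1 by (simp add: below_def)
  moreover have "lwall a b True (a + 1) = Infty" by (rule lwall_top) (simp add: below_def)
  ultimately show ?thesis by (simp add: jump_def)
qed

lemma T_mem_jump_a1: "T z \<in> jump a b (a + 1) \<longleftrightarrow> hi (lwall a b False a) \<le> hi z"
  unfolding jump_a1 arc_def by (simp add: hi_T_le_iff)

end

section \<open>The endpoints of the two rays\<close>

text \<open>
  In the two exceptional cases the orbit of one discontinuity point runs into the other one, so that one of its
  segments shares a jump with a ray. For \<open>b = a + 1\<close> the orbit of \<open>a\<close> passes through \<open>b\<close> at once; that case is
  handled by the general choice.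
\<close>

definition b_meets_a :: "real \<Rightarrow> real \<Rightarrow> bool" where
  "b_meets_a a b \<longleftrightarrow> a + 1 < b \<and> visits a b At_b (Fin a)"

definition a_meets_Sb :: "real \<Rightarrow> real \<Rightarrow> bool" where
  "a_meets_Sb a b \<longleftrightarrow> a + 1 < b \<and> visits a b At_a (Fin (- 1 / b))"

text \<open>
  In general the ray at level \<open>a\<close> starts at the left limit of the wall, and \<open>S\<close> maps the end of the ray at level \<open>b\<close> to
  the right end of the jump at \<open>S b\<close>. If the lower orbit of \<open>b\<close> meets \<open>a\<close>, its segment there fills the left part of the jump at
  \<open>a\<close>, and the ray starts where this segment ends. If the lower orbit of \<open>a\<close> meets \<open>S b\<close>, its
  segment there fills the right part of the jump, and the segment of \<open>b\<close> ends where it starts.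
\<close>

definition ray_ends :: "real \<Rightarrow> real \<Rightarrow> real \<Rightarrow> real \<Rightarrow> bool" where
  "ray_ends a b xa xb \<longleftrightarrow> 1 \<le> xa \<and> xb \<le> - 1 \<and>
     hi (lwall a b False a) \<le> ereal xa \<and> hi (S (Fin xb)) \<le> hi (lwall a b True (- 1 / b)) \<and>
     (if b_meets_a a b then lower_map a b (At_b, Fin a) (Fin xb) = Fin xa
      else lwall a b False a = Fin xa) \<and>
     (if a_meets_Sb a b then lower_map a b (At_a, Fin (- 1 / b)) (Fin xa) = S (Fin xb)
      else lwall a b True (- 1 / b) = S (Fin xb))"

context ab
begin

lemma T_vimage_jump: "lower_walk a b At_a 0 ` {z. hi (lwall a b False a) \<le> hi z} = jump a b (a + 1)"
proof -
  have "z \<in> T ` {z. hi (lwall a b False a) \<le> hi z}" if "z \<in> jump a b (a + 1)" for z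
    using that T_mem_jump_a1[of "Tinv z"] by (metis (mono_tags, lifting) T_Tinv imageI mem_Collect_eq)
  then show ?thesis using T_mem_jump_a1 by (auto simp: lower_walk_0)
qed

lemma S_vimage_jump: "lower_walk a b At_b 0 ` (S ` jump a b (- 1 / b)) = jump a b (- 1 / b)"
  by (simp add: lower_walk_0 image_comp o_def)

lemma orbit_not_repeat:
  assumes "j < first_visit a b c y" "visits a b c y" "0 < j"
  shows "lower_orbit a b c j \<noteq> lower_orbit a b c 0"
proof
  assume "lower_orbit a b c j = lower_orbit a b c 0"
  from lower_orbit_shift[OF this, of "first_visit a b c y - j"] assms
  have "y = lower_orbit a b c (first_visit a b c y - j)" using visits_first(2) by simp
  then have "first_visit a b c y \<le> first_visit a b c y - j" by (intro first_visit_le) simp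
  then show False using assms by simp
qed

lemma pred_a1:
  assumes "steppable a b z" "rho_low a b z z = Fin (a + 1)"
  shows "z = Fin a"
  using assms(1)
proof (cases rule: steppable_cases)
  case (S t)
  then have "- 1 / t = a + 1" using assms(2) by (auto simp del: rho_low.simps)
  moreover have "- 1 / t \<le> - 1 / b" using S by (simp add: field_simps)
  ultimately show ?thesis using Sb_less_a1 by linarith
next
  case (T t)
  then show ?thesis using assms(2) by (simp del: rho_low.simps)
qed

lemma pred_Sb:
  assumes "steppable a b (Fin t)" "rho_low a b (Fin t) (Fin t) = Fin (- 1 / b)" "t \<noteq> b"
  shows "t = - 1 / b - 1" "rho_low a b (Fin t) = T"
proof -
  have "t = - 1 / b - 1 \<and> rho_low a b (Fin t) = T"
    using assms(1)
  proof (cases rule: steppable_cases)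
    case (S u)
    then have "- 1 / t = - 1 / b" using assms(2) by (auto simp del: rho_low.simps)
    then show ?thesis using assms(3) S b_pos by (simp add: field_simps)
  next
    case (T u)
    then show ?thesis using assms(2) by (simp del: rho_low.simps)
  qed
  then show "t = - 1 / b - 1" "rho_low a b (Fin t) = T" by blast+
qed

text \<open>
  After its start, the orbit of \<open>b\<close> avoids both start values until its first visit of \<open>a\<close>.
\<close>

lemma b_meets_a_onto:
  assumes "b_meets_a a b"
  shows "lower_map a b (At_b, Fin a) ` (S ` jump a b (- 1 / b)) = jump a b a"
    "\<And>z w. S z \<in> jump a b (- 1 / b) \<Longrightarrow> S w \<in> jump a b (- 1 / b) \<Longrightarrow>
      hi (lower_map a b (At_b, Fin a) z) \<le> hi (lower_map a b (At_b, Fin a) w) \<longleftrightarrow> hi (S z) \<le> hi (S w)"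
proof -
  let ?n = "first_visit a b At_b (Fin a)"
  have v: "visits a b At_b (Fin a)" using assms by (simp add: b_meets_a_def)
  note n = visits_first[OF v]
  have clean: "lower_orbit a b At_b j \<notin> {Fin (a + 1), Fin (- 1 / b)}" if j: "0 < j" "j \<le> ?n" for j
  proof -
    have "lower_orbit a b At_b j \<noteq> Fin (- 1 / b)"
    proof (cases "j = ?n")
      case True
      show ?thesis
      proof
        assume "lower_orbit a b At_b j = Fin (- 1 / b)"
        then have "lower_orbit a b At_b 0 = Fin a" using True n lower_start by simp
        then have "?n \<le> 0" by (rule first_visit_le)
        then show False using j by simp
      qed
    next
      case False
      then show ?thesis using orbit_not_repeat[of j At_b "Fin a"] v j lower_start by simp
    qed
    moreover have "lower_orbit a b At_b j \<noteq> Fin (a + 1)"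
    proof
      assume A: "lower_orbit a b At_b j = Fin (a + 1)"
      obtain i where i: "j = Suc i" using j by (cases j) auto
      have "live a b At_b (Suc i)" using n j i live_mono by blast
      then have "lower_orbit a b At_b i = Fin a"
        using A i by (intro pred_a1) (auto simp: live_Suc lower_orbit_Suc)
      then have "?n \<le> i" by (rule first_visit_le)
      then show False using i j by simp
    qed
    ultimately show ?thesis by simp
  qed
  show "lower_map a b (At_b, Fin a) ` (S ` jump a b (- 1 / b)) = jump a b a"
    unfolding lower_map_eq
    by (rule seg_onto_jump[OF S_vimage_jump lower_start(2) n]) (rule clean)
  show "hi (lower_map a b (At_b, Fin a) z) \<le> hi (lower_map a b (At_b, Fin a) w) \<longleftrightarrow> hi (S z) \<le> hi (S w)"
    if "S z \<in> jump a b (- 1 / b)" "S w \<in> jump a b (- 1 / b)" for z w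
  proof -
    have "z \<in> S ` jump a b (- 1 / b)" "w \<in> S ` jump a b (- 1 / b)"
      using that by (metis S_S imageI)+
    from seg_order[OF equalityD1[OF S_vimage_jump] lower_start(2) n(1) this]
    show ?thesis by (simp add: lower_map_eq lower_walk_0)
  qed
qed

lemma a_meets_Sb_onto:
  assumes "a_meets_Sb a b"
  shows "lower_map a b (At_a, Fin (- 1 / b)) ` {z. hi (lwall a b False a) \<le> hi z} =
      T ` jump a b (- 1 / b - 1)"
    "\<And>z w. hi (lwall a b False a) \<le> hi z \<Longrightarrow> hi (lwall a b False a) \<le> hi w \<Longrightarrow>
      hi (lower_map a b (At_a, Fin (- 1 / b)) z) \<le> hi (lower_map a b (At_a, Fin (- 1 / b)) w)
        \<longleftrightarrow> hi z \<le> hi w"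
proof -
  let ?X = "{z. hi (lwall a b False a) \<le> hi z}"
  have v: "visits a b At_a (Fin (- 1 / b))" and ab1: "a + 1 < b"
    using assms by (auto simp: a_meets_Sb_def)
  note n' = visits_first[OF v]
  have "first_visit a b At_a (Fin (- 1 / b)) \<noteq> 0"
    using n'(2) lower_start(1) Sb_less_a1 by (metis less_irrefl rbar.inject)
  then obtain m where m: "first_visit a b At_a (Fin (- 1 / b)) = Suc m"
    by (metis old.nat.exhaust)
  have lm: "live a b At_a m" and st: "steppable a b (lower_orbit a b At_a m)"
    using n'(1) m by (auto simp: live_Suc)
  obtain t where t: "lower_orbit a b At_a m = Fin t" "t \<le> a + 1" using live_Fin[OF lm] by blast
  have r: "rho_low a b (Fin t) (Fin t) = Fin (- 1 / b)"
    using n'(2) m t by (simp add: lower_orbit_Suc del: rho_low.simps)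
  have tt: "t = - 1 / b - 1" "rho_low a b (Fin t) = T"
    using pred_Sb[OF _ r] st t ab1 by auto
  have W: "lower_map a b (At_a, Fin (- 1 / b)) = T \<circ> lower_walk a b At_a m"
    unfolding lower_map_eq m lower_walk_Suc using t tt by (simp del: rho_low.simps)
  have clean: "lower_orbit a b At_a j \<notin> {Fin (a + 1), Fin (- 1 / b)}" if j: "0 < j" "j \<le> m" for j
    using orbit_not_repeat[of j At_a "Fin (- 1 / b)"] v j m lower_start(1)
      first_visit_not_less[of j a b At_a "Fin (- 1 / b)"] by simp
  have J: "lower_walk a b At_a m ` ?X = jump a b t"
    by (rule seg_onto_jump[OF T_vimage_jump lower_start(1) lm t(1)]) (rule clean)
  show "lower_map a b (At_a, Fin (- 1 / b)) ` ?X = T ` jump a b (- 1 / b - 1)"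
    unfolding W image_comp[symmetric] J tt(1) ..
  show "hi (lower_map a b (At_a, Fin (- 1 / b)) z) \<le> hi (lower_map a b (At_a, Fin (- 1 / b)) w)
        \<longleftrightarrow> hi z \<le> hi w"
    if "hi (lwall a b False a) \<le> hi z" "hi (lwall a b False a) \<le> hi w" for z w
    using seg_order[OF equalityD1[OF T_vimage_jump] lower_start(1) lm, of z w] that
    unfolding W by (simp add: hi_T_le_iff lower_walk_0)
qed

lemma jump_Sb: "a + 1 < b \<Longrightarrow> z \<in> jump a b (- 1 / b) \<longleftrightarrow> 0 \<le> hi z \<and> hi z \<le> hi (lwall a b True (- 1 / b))"
  using lwall_Sb_minus_0 by (simp add: jump_def arc_def zero_ereal_def)

lemma T_jump_Sb1:
  "z \<in> T ` jump a b (- 1 / b - 1) \<longleftrightarrow>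
    hi (T (lwall a b False (- 1 / b - 1))) \<le> hi z \<and> hi z \<le> hi (lwall a b True (- 1 / b))"
  unfolding jump_def T_image_arc using lwall_Sb_plus by (simp add: arc_def)

lemma segI:
  assumes "visits a b c (Fin t)" "u \<in> ray xa xb c" "lower_map a b (c, Fin t) u = z"
  shows "z \<in> (\<Union>c\<in>{c. visits a b c (Fin t)}. lower_map a b (c, Fin t) ` ray xa xb c)"
  using assms(1) imageI[OF assms(2), of "lower_map a b (c, Fin t)"]
  unfolding assms(3) by (intro UN_I[of c]) simp_all

text \<open>
  The jump at \<open>T a\<close> consists of the segment of the ray at \<open>a\<close>, preceded by a segment of \<open>b\<close> in the exceptional case. The jump at \<open>S b\<close>
  consists of the segment of the ray at \<open>b\<close>, followed by a segment of \<open>a\<close> in the exceptional case and preceded by one for \<open>b = a + 1\<close>.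
\<close>

lemma ray_ends_covered:
  assumes g: "ray_ends a b xa xb"
  shows "covered xa xb (a + 1)" "covered xa xb (- 1 / b)"
proof -
  have xa: "1 \<le> xa" "hi (lwall a b False a) \<le> ereal xa"
    and xb: "xb < 0" "hi (S (Fin xb)) \<le> hi (lwall a b True (- 1 / b))"
    using g by (auto simp: ray_ends_def)
  have seg_a: "T ` ray xa xb At_a \<subseteq>
      (\<Union>c\<in>{c. visits a b c (Fin (a + 1))}. lower_map a b (c, Fin (a + 1)) ` ray xa xb c)"
    using visits_start(1) lower_map_start(1) by force
  have seg_b: "S ` ray xa xb At_b \<subseteq>
      (\<Union>c\<in>{c. visits a b c (Fin (- 1 / b))}. lower_map a b (c, Fin (- 1 / b)) ` ray xa xb c)"
    using visits_start(2) lower_map_start(2) by force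
  have in_b: "z \<in> S ` ray xa xb At_b" if "0 \<le> hi z" "hi z \<le> hi (S (Fin xb))" for z
  proof -
    have "S z \<in> ray xa xb At_b" unfolding ray_b_iff lo_le_iff_S[OF xb(1)] using that by simp
    then show ?thesis by (metis S_S imageI)
  qed
  show "covered xa xb (a + 1)" unfolding covered_def
  proof
    fix z assume "z \<in> jump a b (a + 1)"
    then obtain w where w: "z = T w" "hi (lwall a b False a) \<le> hi w"
      using T_vimage_jump by (auto simp: lower_walk_0)
    show "z \<in> (\<Union>c\<in>{c. visits a b c (Fin (a + 1))}. lower_map a b (c, Fin (a + 1)) ` ray xa xb c)"
    proof (cases "ereal xa \<le> hi w")
      case True
      then have "z \<in> T ` ray xa xb At_a" using w by (auto simp: ray_a_iff)
      with seg_a show ?thesis by (rule subsetD)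
    next
      case False
      then have P: "b_meets_a a b" using g w by (auto simp: ray_ends_def split: if_splits)
      have ab1: "a + 1 < b" using P by (simp add: b_meets_a_def)
      let ?V = "lower_map a b (At_b, Fin a)"
      have V: "?V (Fin xb) = Fin xa" using g P by (simp add: ray_ends_def)
      have Sxb: "S (Fin xb) \<in> jump a b (- 1 / b)"
        unfolding jump_Sb[OF ab1] using xb by (simp add: divide_nonneg_neg)
      have "?V (Fin xb) \<in> jump a b a"
        using b_meets_a_onto(1)[OF P] Sxb by (metis S_S imageI)
      then have "w \<in> jump a b a" using False w unfolding V by (auto simp: jump_def arc_def)
      then obtain j where j: "j \<in> jump a b (- 1 / b)" "w = ?V (S j)"
        unfolding b_meets_a_onto(1)[OF P, symmetric] by blast
      define u where "u = S j"
      have u: "S u \<in> jump a b (- 1 / b)" "w = ?V u" using j by (simp_all add: u_def)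
      have "\<not> hi (?V (Fin xb)) \<le> hi (?V u)" using False u V by simp
      then have "hi (S u) \<le> hi (S (Fin xb))" using b_meets_a_onto(2)[OF P Sxb u(1)] by simp
      then have "u \<in> ray xa xb At_b"
        unfolding ray_b_iff lo_le_iff_S[OF xb(1)] using u(1) jump_Sb[OF ab1] by simp
      then have ub: "u \<in> ray xa xb At_b" .
      have v: "visits a b At_b (Fin a)" using P by (simp add: b_meets_a_def)
      have st: "steppable a b (Fin a)" using Sb_le_a by (simp add: steppable_def)
      have ne: "a + 1 \<noteq> - 1 / b" using Sb_less_a1 by simp
      have "lower_map a b (At_b, Fin (a + 1)) = rho_low a b (Fin a) \<circ> ?V"
        by (rule lower_map_step[OF v st]) (use ne lower_start(2) in auto)
      then have "lower_map a b (At_b, Fin (a + 1)) u = z" using w u by simp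
      moreover have "visits a b At_b (Fin (a + 1))" using visits_step[OF v st] by simp
      ultimately show ?thesis using ub by (intro segI)
    qed
  qed
  show "covered xa xb (- 1 / b)" unfolding covered_def
  proof
    fix z assume z: "z \<in> jump a b (- 1 / b)"
    show "z \<in> (\<Union>c\<in>{c. visits a b c (Fin (- 1 / b))}. lower_map a b (c, Fin (- 1 / b)) ` ray xa xb c)"
    proof (cases "0 \<le> hi z \<and> hi z \<le> hi (S (Fin xb))")
      case True
      then have "z \<in> S ` ray xa xb At_b" by (intro in_b) auto
      with seg_b show ?thesis by (rule subsetD)
    next
      case out: False
      show ?thesis
      proof (cases "a + 1 < b")
        case ab1: True
        have Q: "a_meets_Sb a b"
          using out z g unfolding jump_Sb[OF ab1] by (auto simp: ray_ends_def split: if_splits)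
        let ?L = "lower_map a b (At_a, Fin (- 1 / b))"
        have L: "?L (Fin xa) = S (Fin xb)" using g Q by (simp add: ray_ends_def)
        have "?L (Fin xa) \<in> T ` jump a b (- 1 / b - 1)"
          using a_meets_Sb_onto(1)[OF Q] xa by auto
        then have zi: "z \<in> T ` jump a b (- 1 / b - 1)"
          using out z unfolding T_jump_Sb1 jump_Sb[OF ab1] L by auto
        then obtain u where u: "hi (lwall a b False a) \<le> hi u" "z = ?L u"
          unfolding a_meets_Sb_onto(1)[OF Q, symmetric] by blast
        have "hi (?L (Fin xa)) \<le> hi (?L u)" using out z u unfolding jump_Sb[OF ab1] L by auto
        then have "ereal xa \<le> hi u" using a_meets_Sb_onto(2)[OF Q, of "Fin xa" u] xa u by simp
        then have "u \<in> ray xa xb At_a" by (simp add: ray_a_iff)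
        moreover have "visits a b At_a (Fin (- 1 / b))" using Q by (simp add: a_meets_Sb_def)
        ultimately show ?thesis using u by (intro segI) simp_all
      next
        case False
        then have b: "b = a + 1" using gap by simp
        have l: "lwall a b False a = Fin xa" "lwall a b True (- 1 / b) = S (Fin xb)"
          using g False by (auto simp: ray_ends_def b_meets_a_def a_meets_Sb_def)
        have "lwall a b False b = T (Fin xa)"
          using lwall_T[of False b] Sb_less_a1 l b by (simp add: below_def)
        then have lm: "lwall a b False (- 1 / b) = S (Fin (xa + 1))" using lwall_Sb_minus by simp
        have zl: "hi (S (Fin (xa + 1))) \<le> hi z" "hi z \<le> hi (S (Fin xb))"
          using z lm l by (auto simp: jump_def arc_def)
        then have zneg: "hi z < 0" using out by auto
        then have p: "0 < hi (S z)" by (cases z) (auto simp: divide_neg_neg)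
        have "hi (S (Fin (xa + 1))) \<le> hi (S (S z))" using zl by simp
        then have "hi (Fin (xa + 1)) \<le> hi (S z)"
          using hi_S_le_iff[OF _ p, of "Fin (xa + 1)"] xa by simp
        then have "hi (T (Fin xa)) \<le> hi (T (Tinv (S z)))" by simp
        then have ry: "Tinv (S z) \<in> ray xa xb At_a"
          unfolding hi_T_le_iff by (simp add: ray_a_iff)
        have v: "visits a b At_a (Fin b)" using visits_start(1) b by simp
        have st: "steppable a b (Fin b)" using b_pos by (simp add: steppable_def)
        have rb: "rho_low a b (Fin b) = S" using rho_low_S b_pos by blast
        have "first_visit a b At_a (Fin (- 1 / b)) = 1"
        proof (rule antisym)
          have o1: "lower_orbit a b At_a 1 = Fin (- 1 / b)"
            using lower_orbit_Suc[of a b At_a 0] lower_start(1) b rb b_pos by (simp del: rho_low.simps)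
          then show "first_visit a b At_a (Fin (- 1 / b)) \<le> 1" by (rule first_visit_le)
          have "first_visit a b At_a (Fin (- 1 / b)) \<noteq> 0"
            using first_visit_orbit[OF o1] lower_start(1) Sb_less_a1 by (metis less_irrefl rbar.inject)
          then show "1 \<le> first_visit a b At_a (Fin (- 1 / b))" by simp
        qed
        then have "lower_map a b (At_a, Fin (- 1 / b)) = S \<circ> T"
          using lower_walk_Suc[of a b At_a 0] lower_start(1) b rb
          by (simp add: lower_map_eq lower_walk_0 del: rho_low.simps)
        then have "lower_map a b (At_a, Fin (- 1 / b)) (Tinv (S z)) = z" by simp
        moreover have "visits a b At_a (Fin (- 1 / b))"
          using visits_step[OF v st] rb b_pos by (simp del: rho_low.simps)
        ultimately show ?thesis using ry by (intro segI)
      qed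
    qed
  qed
qed

lemma ray_ends_rays_in_jumps:
  assumes "ray_ends a b xa xb"
  shows "lower_walk a b At_a 0 ` ray xa xb At_a \<subseteq> jump a b (a + 1)"
    "lower_walk a b At_b 0 ` ray xa xb At_b \<subseteq> jump a b (- 1 / b)"
proof -
  have xa: "hi (lwall a b False a) \<le> ereal xa" and xb: "xb < 0"
    "hi (S (Fin xb)) \<le> hi (lwall a b True (- 1 / b))"
    using assms by (auto simp: ray_ends_def)
  show "lower_walk a b At_a 0 ` ray xa xb At_a \<subseteq> jump a b (a + 1)"
    using xa by (auto simp: lower_walk_0 ray_a_iff T_mem_jump_a1 intro: order.trans)
  have "hi (lwall a b False (- 1 / b)) \<le> 0"
    by (rule conjunct2[OF lwall_zone1]) (simp add: below_def)
  then show "lower_walk a b At_b 0 ` ray xa xb At_b \<subseteq> jump a b (- 1 / b)"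
    using xb by (auto simp: lower_walk_0 ray_b_iff lo_le_iff_S jump_def arc_def intro: order.trans)
qed

lemma ray_ends_seg_subset_jump:
  assumes "ray_ends a b xa xb" "live a b c n" "lower_orbit a b c n = Fin t"
  shows "lower_walk a b c n ` ray xa xb c \<subseteq> jump a b t"
  using ray_ends_rays_in_jumps[OF assms(1)] seg_subset_jump[OF _ _ assms(2,3)] lower_start
  by (cases c) auto

subsection \<open>Existence of the endpoints\<close>

text \<open>
  If both exceptional cases occur, the two conditions depend on each other. All cases are treated at once as a
  fixed point of an increasing map of the jump at \<open>a\<close> into itself.
\<close>

lemma ray_ends_exists_nonextremal:
  assumes "- (a * b) < 1"
  shows "\<exists>xa xb. ray_ends a b xa xb"
proof -
  obtain p where p: "lwall a b False a = Fin p"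
    using lwall_finite[of False a] by (auto simp: below_def)
  have p1: "1 \<le> p" using lwall_a_ge_1[OF assms] p by (simp add: one_ereal_def)
  have "rwall a b True b \<noteq> Infty" unfolding rwall_eq_Infty_iff by (simp add: below_def)
  then obtain r where r: "rwall a b True b = Fin r" by (cases "rwall a b True b") auto
  have r1: "r \<le> - 1" using rwall_b_le_m1[OF assms] r by (simp add: one_ereal_def)
  have lS: "lwall a b True (- 1 / b) = S (Fin r)" using lwall_Sb_plus_eq[OF assms] r by simp
  obtain q where q: "lwall a b True a = Fin q"
    using lwall_finite[of True a] by (auto simp: below_def)
  have pq: "p \<le> q" using lwall_sides[of a] p q by simp
  define L where "L = lower_map a b (At_a, Fin (- 1 / b))"
  define V where "V = lower_map a b (At_b, Fin a)"
  define B where "B z = (if a_meets_Sb a b then S (L z) else Fin r)" for z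
  define A where "A z = (if b_meets_a a b then V z else Fin p)" for z
  have B: "\<exists>v. B (Fin x) = Fin v \<and> v \<le> - 1 \<and> v \<le> r" if x: "p \<le> x" for x
  proof (cases "a_meets_Sb a b")
    case True
    have "L (Fin x) \<in> T ` jump a b (- 1 / b - 1)"
      using a_meets_Sb_onto(1)[OF True] x p unfolding L_def by auto
    then have Lx: "hi (S (rwall a b False b)) \<le> hi (L (Fin x))" "hi (L (Fin x)) \<le> hi (S (Fin r))"
      unfolding T_jump_Sb1 T_lwall_Sb_minus lS by auto
    have "lo (rwall a b False b) \<le> 0"
      using b_le_Sa by (intro rwall_zone2) (simp add: below_def)
    moreover have "rwall a b False b \<noteq> Infty"
      unfolding rwall_eq_Infty_iff by (simp add: below_def)
    ultimately have "0 < hi (S (rwall a b False b))"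
      by (cases "rwall a b False b") (auto simp: divide_neg_neg zero_less_divide_iff)
    then have pos: "0 < hi (L (Fin x))" using Lx(1) by (rule order.strict_trans2)
    then obtain v where v: "L (Fin x) = Fin v" "0 < v" "v \<le> - 1 / r"
      using Lx(2) r1 by (cases "L (Fin x)") auto
    have "- 1 / v \<le> r" using v r1 by (simp add: field_simps)
    moreover have "- 1 / v \<le> - 1" using calculation r1 by linarith
    ultimately show ?thesis using True v r1 by (simp add: B_def)
  next
    case False
    then show ?thesis using r1 by (simp add: B_def)
  qed
  have Bmono: "lo (B (Fin x)) \<le> lo (B (Fin y))" if px: "p \<le> x" and xy: "x \<le> y" for x y
  proof (cases "a_meets_Sb a b")
    case True
    have Lxy: "hi (L (Fin x)) \<le> hi (L (Fin y))"
      using a_meets_Sb_onto(2)[OF True, of "Fin x" "Fin y"] px xy p unfolding L_def by simp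
    obtain v w where "S (L (Fin x)) = Fin v" "v \<le> - 1" "S (L (Fin y)) = Fin w" "w \<le> - 1"
      using B[OF px] B[OF order.trans[OF px xy]] True by (auto simp: B_def)
    then have "L (Fin x) = S (Fin v)" "L (Fin y) = S (Fin w)" by (metis S_S)+
    then have "lo (Fin v) \<le> ereal w"
      using Lxy lo_le_iff_S[of w "Fin v"] \<open>w \<le> - 1\<close> \<open>v \<le> - 1\<close> by (simp add: divide_nonneg_neg)
    then show ?thesis using True \<open>S (L (Fin x)) = Fin v\<close> \<open>S (L (Fin y)) = Fin w\<close> by (simp add: B_def)
  qed (simp add: B_def)
  have SinJ: "S (Fin v) \<in> jump a b (- 1 / b)" if "b_meets_a a b" "v \<le> r" for v
  proof -
    have "a + 1 < b" using that by (simp add: b_meets_a_def)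
    then show ?thesis unfolding jump_Sb[OF \<open>a + 1 < b\<close>] lS
      using that(2) r1 lo_le_iff_S[of r "Fin v"] by simp
  qed
  have A: "\<exists>u. A (Fin v) = Fin u \<and> p \<le> u \<and> u \<le> q" if v: "v \<le> r" for v
  proof (cases "b_meets_a a b")
    case True
    have "V (Fin v) \<in> jump a b a"
      using b_meets_a_onto(1)[OF True] SinJ[OF True v] unfolding V_def by (metis S_S imageI)
    then show ?thesis using p q True by (cases "V (Fin v)") (auto simp: A_def jump_def arc_def)
  qed (use pq in \<open>simp add: A_def\<close>)
  have Amono: "hi (A (Fin v)) \<le> hi (A (Fin w))" if "v \<le> w" "w \<le> r" for v w
  proof (cases "b_meets_a a b")
    case True
    have "hi (S (Fin v)) \<le> hi (S (Fin w))" using lo_le_iff_S[of w "Fin v"] that r1 by simp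
    then have "hi (V (Fin v)) \<le> hi (V (Fin w))"
      using b_meets_a_onto(2)[OF True SinJ[OF True] SinJ[OF True], of v w] that
      unfolding V_def by auto
    then show ?thesis using True by (simp add: A_def)
  qed (simp add: A_def)
  define h where "h x = real_of_ereal (hi (A (B (Fin x))))" for x
  have AB: "A (B (Fin x)) = Fin (h x) \<and> p \<le> h x \<and> h x \<le> q" if "p \<le> x" for x
    using B[OF that] A by (force simp: h_def)
  have "\<exists>x. p \<le> x \<and> x \<le> q \<and> h x = x"
  proof (rule mono_real_fixpoint[OF pq])
    fix x y assume xy: "p \<le> x" "x \<le> y" "y \<le> q"
    obtain v w where vw: "B (Fin x) = Fin v" "v \<le> r" "B (Fin y) = Fin w" "w \<le> r"
      using B[OF xy(1)] B[OF order.trans[OF xy(1,2)]] by blast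
    then have "v \<le> w" using Bmono[OF xy(1,2)] by simp
    then have "hi (A (Fin v)) \<le> hi (A (Fin w))" using vw by (intro Amono)
    then show "h x \<le> h y" using AB[of x] AB[of y] xy vw by simp
  qed (use AB in blast)
  then obtain x where x: "p \<le> x" "x \<le> q" "h x = x" by blast
  obtain v where v: "B (Fin x) = Fin v" "v \<le> - 1" "v \<le> r" using B[OF x(1)] by blast
  have Ax: "A (Fin v) = Fin x" using AB[OF x(1)] x v by simp
  have "ray_ends a b x v"
    unfolding ray_ends_def
  proof (intro conjI)
    show "1 \<le> x" using x p1 by simp
    show "v \<le> - 1" by (rule v)
    show "hi (lwall a b False a) \<le> ereal x" using x p by simp
    show "hi (S (Fin v)) \<le> hi (lwall a b True (- 1 / b))"
      unfolding lS using lo_le_iff_S[of r "Fin v"] v r1 by simp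
    show "if b_meets_a a b then lower_map a b (At_b, Fin a) (Fin v) = Fin x
      else lwall a b False a = Fin x"
      using Ax p by (auto simp: A_def V_def)
    show "if a_meets_Sb a b then lower_map a b (At_a, Fin (- 1 / b)) (Fin x) = S (Fin v)
      else lwall a b True (- 1 / b) = S (Fin v)"
    proof (cases "a_meets_Sb a b")
      case True
      then have "S (L (Fin x)) = Fin v" using v by (simp add: B_def)
      then show ?thesis using True unfolding L_def by (metis S_S)
    next
      case False
      then show ?thesis using v lS by (simp add: B_def)
    qed
  qed
  then show ?thesis by blast
qed

end

section \<open>The extremal curve\<close>

context ab
begin

text \<open>
  Here \<open>S b = a\<close>, so the orbit of \<open>b\<close> starts at \<open>a\<close>. The jump at this level is \<open>[0, 1]\<close>, and \<open>S\<close> maps the ray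
  from infinity to \<open>-1\<close> onto it.
\<close>

lemma ray_ends_extremal:
  assumes e: "- (a * b) = 1" and ne: "(a, b) \<noteq> (- 1, 1)"
  shows "ray_ends a b 1 (- 1)"
proof -
  have Sb: "- 1 / b = a" using e b_pos by (simp add: field_simps)
  have a2: "0 < a * a + a + 1"
  proof -
    have "a * a + a + 1 = (a + 1 / 2)\<^sup>2 + 3 / 4" by (simp add: power2_eq_square algebra_simps)
    then show ?thesis using zero_le_power2[of "a + 1 / 2"] by linarith
  qed
  have ab1: "a + 1 < b"
  proof (rule ccontr)
    assume "\<not> a + 1 < b"
    then have "b = a + 1" using gap by simp
    then show False using e a2 by (simp add: algebra_simps)
  qed
  have o0: "lower_orbit a b At_b 0 = Fin a" using lower_start(2) Sb by simp
  then have "first_visit a b At_b (Fin a) = 0" using first_visit_le by (metis le_zero_eq)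
  then have V: "lower_map a b (At_b, Fin a) = S" by (simp add: lower_map_eq lower_walk_0)
  have P: "b_meets_a a b" using ab1 visits_start(2) Sb by (simp add: b_meets_a_def)
  have notQ: "\<not> visits a b At_a (Fin a)"
  proof
    assume "visits a b At_a (Fin a)"
    then obtain n where n: "live a b At_a n" "lower_orbit a b At_a n = Fin a"
      by (auto simp: visits_def)
    have n0: "n \<noteq> 0"
    proof
      assume "n = 0"
      then show False using n(2) lower_start(1) by simp
    qed
    then have "live a b At_a 1" using n live_mono by fastforce
    then have "steppable a b (Fin (a + 1))" using lower_start(1) by (simp add: live_def)
    then have a1: "0 < a + 1" by (simp add: steppable_def)
    then have o1: "lower_orbit a b At_a 1 = Fin (- 1 / (a + 1))"
      using lower_orbit_Suc[of a b At_a 0] lower_start(1) rho_low_S[of "a + 1"] gap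
      by (simp del: rho_low.simps)
    have "n \<noteq> 1"
    proof
      assume "n = 1"
      then have "- 1 / (a + 1) = a" using n o1 by simp
      then show False using a1 a2 by (simp add: field_simps)
    qed
    then have "2 \<le> n" using n0 by linarith
    then have "live a b At_a 2" using n live_mono by blast
    then have st: "steppable a b (lower_orbit a b At_a 1)" by (simp add: live_def)
    have neg: "- 1 / (a + 1) < 0" using a1 by simp
    have "- 1 / (a + 1) < a - 1"
    proof -
      have "(a - 1) * (a + 1) = a * a - 1" by (simp add: algebra_simps)
      then have "- 1 < (a - 1) * (a + 1)" using a_neg mult_neg_neg[of a a] by simp
      then show ?thesis using pos_divide_less_eq[OF a1, of "- 1" "a - 1"] by simp
    qed
    then show False using st neg unfolding o1 steppable_def Sb by simp
  qed
  then have Q: "\<not> a_meets_Sb a b" using Sb by (simp add: a_meets_Sb_def)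
  have low: "hi (lwall a b False a) \<le> 0"
    using lwall_zone1[of False a] Sb by (simp add: below_def)
  obtain x where x: "lwall a b True a = Fin x" using lwall_finite[of True a] by (auto simp: below_def)
  have x0: "0 \<le> x" using lwall_zone2[of True a] Sb x by (simp add: below_def)
  have "a \<le> a / (1 - a)" using a_neg by (simp add: field_simps)
  then have "dom_M True a" using a_neg Sb by (simp add: dom_M_def below_def)
  from walls_match_M[OF this] have r: "rwall a b True (a / (1 - a)) = S (T (S (Fin x)))" using x by simp
  have "a / (1 - a) \<le> 0" using a_neg by (simp add: divide_nonpos_pos)
  then have "lo (rwall a b True (a / (1 - a))) \<le> - 1" by (rule rwall_zone3)
  then have le: "lo (S (T (S (Fin x)))) \<le> - 1" unfolding r .
  have x1: "1 \<le> x"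
  proof (rule ccontr)
    assume "\<not> 1 \<le> x"
    then have "x < 1" "x / (x - 1) \<le> 0" using x0 by (auto simp: divide_nonneg_neg)
    then show False using le x0 by (cases "x = 0") (auto simp: one_ereal_def field_simps)
  qed
  have "lwall a b True a = T (lwall a b True (a - 1))" using lwall_Sb_plus Sb by simp
  moreover have "hi (lwall a b True (a - 1)) \<le> 0"
    using lwall_zone1[of True "a - 1"] Sb by (simp add: below_def)
  ultimately have "x \<le> 1" using x by (cases "lwall a b True (a - 1)") auto
  then have lp: "lwall a b True a = Fin 1" using x x1 by simp
  have "hi (lwall a b False a) \<le> ereal 1" using low by (rule order.trans) simp
  then show ?thesis unfolding ray_ends_def using P Q V lp Sb by (simp del: divide_minus_left)
qed

lemma ray_ends_exists: "(a, b) \<noteq> (- 1, 1) \<Longrightarrow> \<exists>xa xb. ray_ends a b xa xb"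
  using ray_ends_extremal ray_ends_exists_nonextremal prod by (metis less_le)

end

section \<open>Upper orbits as mirror images of lower orbits\<close>

fun swap :: "disc \<Rightarrow> disc" where
  "swap At_a = At_b"
| "swap At_b = At_a"

lemma swap_swap [simp]: "swap (swap c) = c"
  by (cases c) auto

abbreviation ulive :: "real \<Rightarrow> real \<Rightarrow> disc \<Rightarrow> nat \<Rightarrow> bool" where
  "ulive a b c m \<equiv> live (- b) (- a) (swap c) m"

abbreviation usteppable :: "real \<Rightarrow> real \<Rightarrow> rbar \<Rightarrow> bool" where
  "usteppable a b z \<equiv> steppable (- b) (- a) (neg z)"

lemma upper_walk_Suc:
  "upper_walk a b c (Suc n) = rho a b (upper_orbit a b c n) \<circ> upper_walk a b c n"
  by (cases c) (auto simp: upper_orbit_def)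

lemma upper_orbit_Suc:
  "upper_orbit a b c (Suc n) = rho a b (upper_orbit a b c n) (upper_orbit a b c n)"
  unfolding upper_orbit_def upper_walk_Suc by (simp add: upper_orbit_def)

lemma steppable_not_Infty: "steppable a b z \<Longrightarrow> z \<noteq> Infty"
  by (auto simp: steppable_def)

lemma lower_walk_inj: "lower_walk a b c n z = lower_walk a b c n w \<longleftrightarrow> z = w"
proof (induction n)
  case 0
  show ?case by (cases c) (auto simp: T_inj S_inj)
next
  case (Suc n)
  then show ?case
    by (cases "lower_orbit a b c n") (auto simp: lower_walk_Suc T_inj S_inj Tinv_inj)
qed

lemma lower_walk_surj: "\<exists>z. lower_walk a b c n z = w"
proof (induction n arbitrary: w)
  case 0
  show ?case by (cases c) (auto intro: exI[of _ "Tinv w"] exI[of _ "S w"])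
next
  case (Suc n)
  have "\<exists>v. rho_low a b (lower_orbit a b c n) v = w"
    by (cases "lower_orbit a b c n")
      (auto intro: exI[of _ "Tinv w"] exI[of _ "S w"] exI[of _ "T w"])
  then show ?case using Suc.IH by (auto simp: lower_walk_Suc) metis
qed

lemma strong_end_iff:
  "strong_end a b c m k \<longleftrightarrow> upper_walk a b c m = lower_walk a b c k \<and> upper_orbit a b c m \<noteq> Infty"
proof -
  have inj: "inj (lower_walk a b c k)" by (simp add: inj_def lower_walk_inj)
  have surj: "surj (lower_walk a b c k)" unfolding surj_def by (metis lower_walk_surj)
  have "inv (lower_walk a b c k) \<circ> upper_walk a b c m = id \<longleftrightarrow> upper_walk a b c m = lower_walk a b c k"
  proof
    assume "inv (lower_walk a b c k) \<circ> upper_walk a b c m = id"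
    then have "lower_walk a b c k \<circ> (inv (lower_walk a b c k) \<circ> upper_walk a b c m) = lower_walk a b c k"
      by simp
    then show "upper_walk a b c m = lower_walk a b c k"
      using surj by (simp add: fun_eq_iff surj_f_inv_f)
  qed (use inj in simp)
  then show ?thesis
    unfolding strong_end_def common_value_def upper_orbit_def lower_orbit_def by auto
qed

lemma upper_after_Infty: "upper_orbit a b c m = Infty \<Longrightarrow> upper_orbit a b c (m + n) = Infty"
  by (induction n) (auto simp: upper_orbit_Suc)

lemma lower_after_Infty: "lower_orbit a b c m = Infty \<Longrightarrow> lower_orbit a b c (m + n) = Infty"
  by (induction n) (auto simp: lower_orbit_Suc)

lemma mirror_jump_iff:
  "neg z \<in> jump (- b) (- a) (- v) \<longleftrightarrow>
    lo (rwall a b False v) \<le> lo z \<and> lo z \<le> lo (rwall a b True v)"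
  by (auto simp: jump_def arc_def rwall_def hi_neg lo_neg)
    (metis ereal_minus_le_minus ereal_uminus_uminus)+

lemma rho_mirror:
  assumes "a < b" "y \<noteq> Infty"
  shows "rho_low (- b) (- a) (neg y) (neg z) = neg (rho a b y z)"
proof -
  obtain t where t: "y = Fin t" using assms(2) by (cases y) auto
  have "rho_low (- b) (- a) (neg y) (neg z) = gen (- b) (- a) (\<not> True) (- t) (neg z)"
    using rho_low_eq_gen[of "- b" "- a" "- t"] t by (simp del: rho_low.simps)
  also have "\<dots> = neg (rho a b y z)"
    unfolding t rho_eq_gen by (rule gen_mirror[OF assms(1)])
  finally show ?thesis .
qed

context ab
begin

lemma less_ab: "a < b"
  using a_neg b_pos by linarith

text \<open>
  At infinity both conventions apply \<open>T\<inverse>\<close>, which is not invariant under the reflection; so the products correspond only up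
  to the time at which infinity is reached.
\<close>

lemma upper_walk_mirror':
  assumes "\<And>j. j < m \<Longrightarrow> lower_orbit (- b) (- a) (swap c) j \<noteq> Infty"
  shows "upper_walk a b c m z = neg (lower_walk (- b) (- a) (swap c) m (neg z))"
    "upper_orbit a b c m = neg (lower_orbit (- b) (- a) (swap c) m)"
proof -
  have pt: "neg (pt a b c) = pt (- b) (- a) (swap c)" by (cases c) auto
  have "(\<forall>z. upper_walk a b c m z = neg (lower_walk (- b) (- a) (swap c) m (neg z))) \<and>
    upper_orbit a b c m = neg (lower_orbit (- b) (- a) (swap c) m)"
    using assms
  proof (induction m)
    case 0
    show ?case
      by (cases c) (auto simp: upper_orbit_def lower_orbit_def neg_T neg_S)
  next
    case (Suc m)
    then have IH: "upper_walk a b c m z = neg (lower_walk (- b) (- a) (swap c) m (neg z))"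
      "upper_orbit a b c m = neg (lower_orbit (- b) (- a) (swap c) m)" for z
      by auto
    have fin: "upper_orbit a b c m \<noteq> Infty" using IH(2) Suc.prems[of m] by auto
    have w: "upper_walk a b c (Suc m) z = neg (lower_walk (- b) (- a) (swap c) (Suc m) (neg z))" for z
    proof -
      have "neg (upper_walk a b c (Suc m) z) =
          rho_low (- b) (- a) (neg (upper_orbit a b c m)) (neg (upper_walk a b c m z))"
        using rho_mirror[OF less_ab fin] by (simp add: upper_walk_Suc)
      also have "\<dots> = lower_walk (- b) (- a) (swap c) (Suc m) (neg z)"
        unfolding IH lower_walk_Suc by simp
      finally show ?thesis by (metis neg_neg)
    qed
    then show ?case unfolding upper_orbit_def lower_orbit_def using pt by simp
  qed
  then show "upper_walk a b c m z = neg (lower_walk (- b) (- a) (swap c) m (neg z))"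
    "upper_orbit a b c m = neg (lower_orbit (- b) (- a) (swap c) m)" by blast+
qed

lemma upper_walk_mirror:
  assumes "ulive a b c m"
  shows "upper_walk a b c m z = neg (lower_walk (- b) (- a) (swap c) m (neg z))"
    "upper_orbit a b c m = neg (lower_orbit (- b) (- a) (swap c) m)"
proof -
  have "lower_orbit (- b) (- a) (swap c) j \<noteq> Infty" if "j < m" for j
    using assms that steppable_not_Infty unfolding live_def by blast
  note fin = this
  show "upper_walk a b c m z = neg (lower_walk (- b) (- a) (swap c) m (neg z))"
    by (rule upper_walk_mirror'(1)[OF fin])
  show "upper_orbit a b c m = neg (lower_orbit (- b) (- a) (swap c) m)"
    by (rule upper_walk_mirror'(2)[OF fin])
qed

lemma upper_walk_mirror_finite:
  assumes "upper_orbit a b c m \<noteq> Infty"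
  shows "upper_walk a b c m z = neg (lower_walk (- b) (- a) (swap c) m (neg z))"
    "upper_orbit a b c m = neg (lower_orbit (- b) (- a) (swap c) m)"
proof -
  have up: "upper_orbit a b c j \<noteq> Infty" if "j \<le> m" for j
  proof
    assume inf: "upper_orbit a b c j = Infty"
    have "upper_orbit a b c (j + n) = Infty" for n
      by (induction n) (auto simp: inf upper_orbit_Suc)
    from this[of "m - j"] show False using assms that by simp
  qed
  have "lower_orbit (- b) (- a) (swap c) j \<noteq> Infty" if "j < m" for j
    using that
  proof (induction j rule: less_induct)
    case (less j)
    then have "upper_orbit a b c j = neg (lower_orbit (- b) (- a) (swap c) j)"
      by (intro upper_walk_mirror'(2)) auto
    then show ?case using up[of j] less.prems by auto
  qed
  note fin = this
  show "upper_walk a b c m z = neg (lower_walk (- b) (- a) (swap c) m (neg z))"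
    by (rule upper_walk_mirror'(1)[OF fin])
  show "upper_orbit a b c m = neg (lower_orbit (- b) (- a) (swap c) m)"
    by (rule upper_walk_mirror'(2)[OF fin])
qed

lemma ulive_Suc: "ulive a b c (Suc m) \<longleftrightarrow> ulive a b c m \<and> usteppable a b (upper_orbit a b c m)"
  using upper_walk_mirror(2) by (auto simp: live_Suc)

lemma usteppable_iff:
  "usteppable a b (Fin u) \<longleftrightarrow> a \<le> u \<and> u < 0 \<or> b \<le> u \<and> u \<le> - 1 / a + 1"
  by (auto simp: steppable_def)

lemma ulive_Fin:
  assumes "ulive a b c m"
  shows "\<exists>u. upper_orbit a b c m = Fin u \<and> b - 1 \<le> u"
proof -
  interpret m: ab "- b" "- a" by (rule mirror)
  obtain t where "lower_orbit (- b) (- a) (swap c) m = Fin t" "t \<le> - b + 1"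
    using m.live_Fin[OF assms] by blast
  then show ?thesis using upper_walk_mirror(2)[OF assms] by auto
qed

subsection \<open>Lower orbits stay between the left limits of the walls\<close>

lemma low_row_step:
  assumes "low_row a b s t x" "gen a b s t (Fin t) = Fin t'"
  shows "low_row a b s t' (gen a b s t x) \<or> up_row a b s t' (gen a b s t x)"
proof -
  have t: "below s t (a + 1)" and x: "hi (lwall a b s t) \<le> hi x"
    using assms by (auto simp: low_row_def)
  show ?thesis
  proof (cases "below s t a")
    case True
    then have g: "gen a b s t = T" "t' = t + 1" using assms(2) by (auto simp: gen_def)
    have t1: "below s (t + 1) (a + 1)" using True by (simp add: below_add)
    have "hi (lwall a b s (t + 1)) \<le> hi (T (lwall a b s t))"
    proof (cases "below s (t + 1) (- 1 / b)")
      case True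
      then have "hi (lwall a b s (t + 1)) \<le> 0" using lwall_zone1 by blast
      also have "\<dots> \<le> hi (T (lwall a b s t))" by (rule ge_zero_T) (rule lwall_ge_m1)
      finally show ?thesis .
    qed (use lwall_T[OF _ t1] in simp)
    also have "\<dots> \<le> hi (T x)" using x by (simp add: hi_T_le_iff)
    finally show ?thesis using t1 g by (simp add: low_row_def)
  next
    case na: False
    have tb: "below s t b" using t by (rule below_mono) (use gap in simp)
    then have g: "gen a b s t = S" using na by (simp add: gen_def)
    then have t0: "t \<noteq> 0" "t' = - 1 / t" using assms(2) by (auto split: if_splits)
    show ?thesis
    proof (cases "0 < t")
      case True
      have neg: "- 1 / t < 0" and inv: "- 1 / (- 1 / t) = t" using True by auto
      have tS: "below s (- 1 / t) (- 1 / b)" using below_Sb[OF neg, of s] tb inv by simp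
      have l: "lwall a b s (- 1 / t) = S (lwall a b s t)" using lwall_S[OF tS] inv by simp
      have "1 \<le> hi (lwall a b s t)" using True by (intro lwall_zone3) simp
      then have "0 < hi (lwall a b s t)" by (cases "lwall a b s t") (auto simp: one_ereal_def)
      then have "hi (S (lwall a b s t)) \<le> hi (S x)"
        using x hi_S_le_iff[of "lwall a b s t" x] by (auto dest: order.strict_trans2)
      moreover have "below s (- 1 / t) (a + 1)"
        using tS by (rule below_mono) (use Sb_less_a1 in simp)
      ultimately show ?thesis using g l t0 by (simp add: low_row_def)
    next
      case False
      then have tn: "t < 0" using t0 by simp
      have "\<not> below s t (- 1 / b)" using na below_mono Sb_le_a by blast
      then have x0: "0 \<le> hi x" using lwall_zone2 x order.trans by blast
      have nSa: "\<not> below s (- 1 / t) (- 1 / a)"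
        using na tn a_neg by (auto simp: below_def field_simps split: if_splits)
      then have "\<not> below s (- 1 / t) (b - 1)"
        using below_mono[of s "- 1 / t" "b - 1" "- 1 / a"] b_le_Sa by auto
      moreover have "lo (S x) \<le> 0" using x0 by (cases x) (auto simp: zero_ereal_def)
      then have "lo (S x) \<le> lo (rwall a b s (- 1 / t))"
        using rwall_zone1[OF nSa] by (auto intro: order.trans)
      ultimately show ?thesis using g t0 by (simp add: up_row_def)
    qed
  qed
qed

lemma up_row_step:
  assumes "up_row a b s t x" "gen a b s t (Fin t) = Fin t'"
  shows "low_row a b s t' (gen a b s t x) \<or> up_row a b s t' (gen a b s t x)"
proof -
  interpret m: ab "- b" "- a" by (rule mirror)
  have "gen (- b) (- a) (\<not> s) (- t) (Fin (- t)) = Fin (- t')"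
    using gen_mirror[OF less_ab, of s t "Fin t"] assms(2) by simp
  from m.low_row_step[OF assms(1)[unfolded up_row_mirror] this] show ?thesis
    using gen_mirror[OF less_ab, of s t x]
      low_row_mirror[of a b s t' "gen a b s t x"] up_row_mirror[of a b s t' "gen a b s t x"] by auto
qed

text \<open>
  The transport along a lower orbit keeps points between the left limits of the walls, also after the live part.
\<close>

lemma lower_walk_row:
  assumes "lower_orbit a b c 0 = Fin t0" "low_row a b False t0 (lower_walk a b c 0 x)"
    and "lower_orbit a b c k = Fin t"
  shows "low_row a b False t (lower_walk a b c k x) \<or> up_row a b False t (lower_walk a b c k x)"
  using assms(3)
proof (induction k arbitrary: t)
  case (Suc k)
  then obtain u where u: "lower_orbit a b c k = Fin u"
    by (cases "lower_orbit a b c k") (auto simp: lower_orbit_Suc)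
  have "gen a b False u (Fin u) = Fin t"
    using Suc.prems u rho_low_eq_gen[of a b u] by (simp add: lower_orbit_Suc del: rho_low.simps)
  moreover have "lower_walk a b c (Suc k) x = gen a b False u (lower_walk a b c k x)"
    using u rho_low_eq_gen[of a b u] by (simp add: lower_walk_Suc del: rho_low.simps)
  ultimately show ?case using Suc.IH[OF u] low_row_step up_row_step by metis
qed (use assms in simp)

lemma jump_imp_low_row: "t \<le> a + 1 \<Longrightarrow> z \<in> jump a b t \<Longrightarrow> low_row a b False t z"
  by (simp add: jump_def arc_def low_row_def below_def)

lemma row_inter_mirror_jump:
  assumes "low_row a b False v z \<or> up_row a b False v z" "neg z \<in> jump (- b) (- a) (- v)"
  shows "z \<in> {rwall a b False v, Fin 1, Fin (- 1), Infty}"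
  using assms(1)
proof
  assume "up_row a b False v z"
  then have "lo z = lo (rwall a b False v)"
    using assms(2) unfolding mirror_jump_iff up_row_def by auto
  then show ?thesis by (simp add: lo_inj)
next
  assume "low_row a b False v z"
  then have l: "hi (lwall a b False v) \<le> hi z" by (simp add: low_row_def)
  have r: "lo z \<le> lo (rwall a b True v)" using assms(2) mirror_jump_iff by blast
  show ?thesis
  proof (cases "0 \<le> v")
    case True
    have "1 \<le> hi z" using order.trans[OF lwall_zone3[OF True] l] .
    moreover have "lo z \<le> 1" using order.trans[OF r rwall_le_1] .
    ultimately show ?thesis by (cases z) (auto simp: one_ereal_def)
  next
    case False
    have "- 1 \<le> hi z" using order.trans[OF lwall_ge_m1 l] .
    moreover have "lo z \<le> - 1" using order.trans[OF r rwall_zone3] False by simp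
    ultimately show ?thesis by (cases z) (auto simp: one_ereal_def)
  qed
qed

text \<open>
  With a trivial product, one infinite set would be carried into a jump of the right wall and between the left limits of the walls.
  These have at most four points in common.
\<close>

lemma upper_live_not_lower:
  assumes ne: "(a, b) \<noteq> (- 1, 1)" and m: "ulive a b c m"
    and eq: "upper_walk a b c m = lower_walk a b c k"
  shows False
proof -
  interpret m: ab "- b" "- a" by (rule mirror)
  obtain xa xb where g: "ray_ends a b xa xb" using ray_ends_exists[OF ne] by blast
  obtain ya yb where g': "ray_ends (- b) (- a) ya yb" using m.ray_ends_exists ne by auto
  define X where "X = ray xa xb c \<inter> ray (- yb) (- ya) c"
  have negray: "neg z \<in> ray ya yb (swap c) \<longleftrightarrow> z \<in> ray (- yb) (- ya) c" for z
  proof (cases c)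
    case At_a
    then show ?thesis by (cases z) (auto simp: ray_a_iff ray_b_iff)
  next
    case At_b
    then show ?thesis by (cases z) (auto simp: ray_a_iff ray_b_iff)
  qed
  have inf: "infinite X"
  proof (cases c)
    case At_a
    have "Fin ` {max xa (- yb)..} \<subseteq> X" unfolding X_def At_a by (auto simp: ray_a_iff)
    moreover have "infinite (Fin ` {max xa (- yb)..})"
      by (subst finite_image_iff) (auto simp: inj_on_def infinite_Ici)
    ultimately show ?thesis using infinite_super by blast
  next
    case At_b
    have "Fin ` {..min xb (- ya)} \<subseteq> X" unfolding X_def At_b by (auto simp: ray_b_iff)
    moreover have "infinite (Fin ` {..min xb (- ya)})"
      by (subst finite_image_iff) (auto simp: inj_on_def infinite_Iic)
    ultimately show ?thesis using infinite_super by blast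
  qed
  obtain v where v: "upper_orbit a b c m = Fin v" using ulive_Fin[OF m] by blast
  then have vm: "lower_orbit (- b) (- a) (swap c) m = Fin (- v)"
    using upper_walk_mirror(2)[OF m] by (simp add: neg_eq_Fin_iff)
  have vl: "lower_orbit a b c k = Fin v" using v eq by (simp add: upper_orbit_def lower_orbit_def)
  obtain t0 where t0: "lower_orbit a b c 0 = Fin t0" "t0 \<le> a + 1" using live_Fin[of c 0] by auto
  have "upper_walk a b c m z \<in> {rwall a b False v, Fin 1, Fin (- 1), Infty}" if z: "z \<in> X" for z
  proof (rule row_inter_mirror_jump)
    have "lower_walk a b c 0 z \<in> jump a b t0"
      using ray_ends_seg_subset_jump[OF g live_0 t0(1)] z by (auto simp: X_def)
    then have "low_row a b False t0 (lower_walk a b c 0 z)" using t0 jump_imp_low_row by blast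
    from lower_walk_row[OF t0(1) this vl]
    show "low_row a b False v (upper_walk a b c m z) \<or> up_row a b False v (upper_walk a b c m z)"
      unfolding eq .
    have "neg z \<in> ray ya yb (swap c)" using z negray by (auto simp: X_def)
    then have "lower_walk (- b) (- a) (swap c) m (neg z) \<in> jump (- b) (- a) (- v)"
      using m.ray_ends_seg_subset_jump[OF g' m vm] by blast
    then show "neg (upper_walk a b c m z) \<in> jump (- b) (- a) (- v)"
      using upper_walk_mirror(1)[OF m] by simp
  qed
  then have "upper_walk a b c m ` X \<subseteq> {rwall a b False v, Fin 1, Fin (- 1), Infty}" by blast
  then have "finite (upper_walk a b c m ` X)" by (rule finite_subset) simp
  moreover have "inj_on (upper_walk a b c m) X"
    unfolding eq by (auto simp: inj_on_def lower_walk_inj)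
  ultimately show False using inf finite_imageD by blast
qed

end

section \<open>The shape of the cycles\<close>

context ab
begin

text \<open>
  The times at which the upper and the lower orbit of a discontinuity point correspond under \<open>S T S\<close>, that is
  \<open>p = q / (1 - q)\<close> for their values \<open>p\<close> and \<open>q\<close>. Both orbits are live up to these times. The bounds on \<open>p\<close> and \<open>q\<close>
  decide which generators come next.
\<close>

definition linked :: "disc \<Rightarrow> nat \<Rightarrow> nat \<Rightarrow> real \<Rightarrow> bool" where
  "linked c m k q \<longleftrightarrow> ulive a b c m \<and> live a b c k \<and>
     upper_walk a b c m = S \<circ> T \<circ> S \<circ> lower_walk a b c k \<and>
     lower_orbit a b c k = Fin q \<and> upper_orbit a b c m = Fin (q / (1 - q)) \<and>
     q < 1 \<and> - 1 / b + 1 \<le> q \<and> q \<le> a + 1 \<and> b - 1 \<le> q / (1 - q) \<and> q / (1 - q) \<le> - 1 / a - 1"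

text \<open>
  The orbits of \<open>a\<close> and of \<open>b\<close> get linked after one step, by the relation between \<open>S\<close> and \<open>T\<close>.
\<close>

lemma linked_start: "linked At_a 1 0 (a + 1)" "linked At_b 0 1 (- 1 / b + 1)"
proof -
  have b1: "b - 1 \<le> - 1 / a - 1" using b_le_Sa by simp
  have u0: "upper_orbit a b At_a 0 = Fin (- 1 / a)" using a_neg by (simp add: upper_orbit_def)
  have st: "usteppable a b (Fin (- 1 / a))" using b_le_Sa by (simp only: usteppable_iff) simp
  have ul: "ulive a b At_a 1" using ulive_Suc[of At_a 0] u0 st by simp
  have r: "rho a b (Fin (- 1 / a)) = Tinv" using b_le_Sa less_ab by simp
  have w: "upper_walk a b At_a 1 = Tinv \<circ> S"
    using upper_walk_Suc[of a b At_a 0] u0 r by (simp del: rho.simps)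
  have u1: "upper_orbit a b At_a 1 = Fin (- 1 / a - 1)"
    using upper_orbit_Suc[of a b At_a 0] u0 r by (simp del: rho.simps)
  have q: "(a + 1) / (1 - (a + 1)) = - 1 / a - 1" using a_neg by (simp add: field_simps)
  show "linked At_a 1 0 (a + 1)"
    unfolding linked_def q using ul w u1 b1 Sb_le_a a_neg lower_start(1)
    by (auto simp: lower_walk_0 STST fun_eq_iff)
  have l0: "lower_orbit a b At_b 0 = Fin (- 1 / b)" by (rule lower_start(2))
  have st': "steppable a b (Fin (- 1 / b))" using Sb_le_a by (simp add: steppable_def)
  have ll: "live a b At_b 1" using live_Suc[of a b At_b 0] l0 st' by simp
  have r': "rho_low a b (Fin (- 1 / b)) = T" using Sb_le_a by (rule rho_low_T)
  have w': "lower_walk a b At_b 1 = T \<circ> S"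
    using lower_walk_Suc[of a b At_b 0] l0 r' by (simp del: rho_low.simps)
  have l1: "lower_orbit a b At_b 1 = Fin (- 1 / b + 1)"
    using lower_orbit_Suc[of a b At_b 0] l0 r' by (simp del: rho_low.simps)
  have q': "(- 1 / b + 1) / (1 - (- 1 / b + 1)) = b - 1" using b_pos by (simp add: field_simps)
  have "upper_orbit a b At_b 0 = Fin (b - 1)" by (simp add: upper_orbit_def)
  then show "linked At_b 0 1 (- 1 / b + 1)"
    unfolding linked_def q' using ll w' l1 b1 Sb_le_a Sb_neg
    by (auto simp: STST fun_eq_iff simp del: divide_minus_left)
qed

text \<open>
  Both orbits hit \<open>0\<close> and remain distinct: a weak cycle.
\<close>

lemma linked_zero:
  assumes "linked c m k 0"
  shows "\<not> steppable a b (lower_orbit a b c k)" "\<not> usteppable a b (upper_orbit a b c m)"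
    "lower_orbit a b c k = Fin 0" "upper_orbit a b c m = Fin 0"
  using assms a_neg b_pos by (auto simp: linked_def steppable_def)

lemma linked_pos:
  assumes "linked c m k q" "0 < q"
  defines "p \<equiv> q / (1 - q)"
  shows "0 < p" "live a b c (k + 1)" "lower_orbit a b c (k + 1) = Fin (- 1 / p - 1)"
    "lower_walk a b c (k + 1) = S \<circ> lower_walk a b c k" "upper_orbit a b c m = Fin p"
    "lower_orbit a b c k = Fin q"
proof -
  have q: "q < 1" "q \<le> b" "live a b c k" "lower_orbit a b c k = Fin q"
    using assms(1) gap by (auto simp: linked_def)
  show "0 < p" using q(1) assms(2) by (simp add: p_def)
  show "upper_orbit a b c m = Fin p" using assms(1) by (simp add: linked_def p_def)
  have st: "steppable a b (Fin q)" using q assms(2) by (simp add: steppable_def)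
  have r: "rho_low a b (Fin q) = S" using assms(2) q(2) by (rule rho_low_S)
  show "live a b c (k + 1)" using live_Suc[of a b c k] q st by simp
  have "- 1 / q = - 1 / p - 1" using q(1) assms(2) by (simp add: p_def field_simps)
  then show "lower_orbit a b c (k + 1) = Fin (- 1 / p - 1)"
    using lower_orbit_Suc[of a b c k] q r assms(2) by (simp del: rho_low.simps)
  show "lower_walk a b c (k + 1) = S \<circ> lower_walk a b c k"
    using lower_walk_Suc[of a b c k] q r by (simp del: rho_low.simps)
  show "lower_orbit a b c k = Fin q" by (rule q(4))
qed

text \<open>
  Now \<open>f\<close> applies \<open>S\<close> to the upper value, and the orbits close up because \<open>S\<close> composed with \<open>S T S\<close> is \<open>T S\<close>, the product of the
  next two steps of the lower orbit.
\<close>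

lemma linked_pos_close:
  assumes "linked c m k q" "0 < q"
  defines "p \<equiv> q / (1 - q)"
  assumes "p < b"
  shows "\<not> steppable a b (lower_orbit a b c (k + 1))" "\<not> usteppable a b (upper_orbit a b c m)"
    "upper_walk a b c (m + 1) = lower_walk a b c (k + 2)" "upper_orbit a b c (m + 1) \<noteq> Infty"
    "- 1 / p - 1 < a"
proof -
  note P = linked_pos[OF assms(1,2), folded p_def]
  have less: "- 1 / p < - 1 / b" using P(1) assms(4) by (simp add: field_simps)
  show a: "- 1 / p - 1 < a" using less Sb_le_a by linarith
  have neg: "- 1 / p - 1 < 0" using less Sb_neg by linarith
  show "\<not> steppable a b (lower_orbit a b c (k + 1))"
    unfolding P(3) steppable_def using less neg by simp
  show "\<not> usteppable a b (upper_orbit a b c m)"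
    unfolding P(5) usteppable_iff using P(1) assms(4) by simp
  have ru: "rho a b (Fin p) = S" using P(1) assms(4) a_neg by simp
  have rl: "rho_low a b (Fin (- 1 / p - 1)) = T" by (rule rho_low_T) (use a in simp)
  have "upper_walk a b c (m + 1) = S \<circ> (S \<circ> T \<circ> S \<circ> lower_walk a b c k)"
    using upper_walk_Suc[of a b c m] P(5) ru assms(1) by (simp add: linked_def del: rho.simps)
  also have "\<dots> = T \<circ> (S \<circ> lower_walk a b c k)" by (simp add: fun_eq_iff)
  also have "\<dots> = lower_walk a b c (k + 2)"
    using lower_walk_Suc[of a b c "k + 1"] P(3,4) rl by (simp del: rho_low.simps)
  finally show "upper_walk a b c (m + 1) = lower_walk a b c (k + 2)" .
  show "upper_orbit a b c (m + 1) \<noteq> Infty"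
    using upper_orbit_Suc[of a b c m] P(1,5) ru by (simp del: rho.simps)
qed

text \<open>
  The lower orbit applies \<open>S\<close> and \<open>T\<close>, which makes the values correspond under \<open>S\<close>; then both orbits make a
  translation.
\<close>

lemma linked_pos_step:
  assumes "linked c m k q" "0 < q"
  defines "p \<equiv> q / (1 - q)"
  assumes "b \<le> p"
  shows "linked c (m + 1) (k + 3) (- 1 / p + 1)" "lower_orbit a b c (k + 2) = Fin (- 1 / p)"
    "- 1 / p < a" "p < - 1 / a"
proof -
  note P = linked_pos[OF assms(1,2), folded p_def]
  have pSa: "p \<le> - 1 / a - 1" using assms(1) by (simp add: linked_def p_def)
  have ge: "- 1 / b \<le> - 1 / p" using P(1) assms(4) b_pos by (simp add: field_simps)
  show pSa': "p < - 1 / a" using pSa by simp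
  then show lt: "- 1 / p < a" using P(1) a_neg by (simp add: field_simps)
  have st1: "steppable a b (Fin (- 1 / p - 1))" using ge lt by (simp add: steppable_def)
  have st2: "steppable a b (Fin (- 1 / p))" using ge lt by (simp add: steppable_def)
  have r1: "rho_low a b (Fin (- 1 / p - 1)) = T" by (rule rho_low_T) (use lt in simp)
  have r2: "rho_low a b (Fin (- 1 / p)) = T" by (rule rho_low_T) (use lt in simp)
  have o2: "lower_orbit a b c (k + 2) = Fin (- 1 / p)"
    using lower_orbit_Suc[of a b c "k + 1"] P(3) r1 by (simp del: rho_low.simps)
  then show "lower_orbit a b c (k + 2) = Fin (- 1 / p)" .
  have o3: "lower_orbit a b c (k + 3) = Fin (- 1 / p + 1)"
    using lower_orbit_Suc[of a b c "k + 2"] o2 r2 by (simp add: eval_nat_numeral del: rho_low.simps)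
  have l2: "live a b c (k + 2)" using live_Suc[of a b c "k + 1"] P(2,3) st1 by simp
  have l3: "live a b c (k + 3)"
    using live_Suc[of a b c "k + 2"] l2 o2 st2 by (simp add: eval_nat_numeral)
  have w2: "lower_walk a b c (k + 2) = T \<circ> (S \<circ> lower_walk a b c k)"
    using lower_walk_Suc[of a b c "k + 1"] P(3,4) r1 by (simp del: rho_low.simps)
  have w3: "lower_walk a b c (k + 3) = T \<circ> (T \<circ> (S \<circ> lower_walk a b c k))"
    using lower_walk_Suc[of a b c "k + 2"] w2 o2 r2 by (simp add: eval_nat_numeral del: rho_low.simps)
  have ru: "rho a b (Fin p) = Tinv" using assms(4) less_ab by simp
  have ust: "usteppable a b (Fin p)" unfolding usteppable_iff using assms(4) pSa by simp
  have ul: "ulive a b c (m + 1)" using ulive_Suc[of c m] P(5) ust assms(1) by (simp add: linked_def)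
  have uo: "upper_orbit a b c (m + 1) = Fin (p - 1)"
    using upper_orbit_Suc[of a b c m] P(5) ru by (simp del: rho.simps)
  have uw: "upper_walk a b c (m + 1) = S \<circ> T \<circ> S \<circ> lower_walk a b c (k + 3)"
  proof -
    have "upper_walk a b c (m + 1) = Tinv \<circ> (S \<circ> T \<circ> S \<circ> lower_walk a b c k)"
      using upper_walk_Suc[of a b c m] P(5) ru assms(1) by (simp add: linked_def del: rho.simps)
    also have "\<dots> = S \<circ> T \<circ> S \<circ> lower_walk a b c (k + 3)"
      unfolding w3 by (simp add: fun_eq_iff STST)
    finally show ?thesis .
  qed
  have e: "(- 1 / p + 1) / (1 - (- 1 / p + 1)) = p - 1" using P(1) by (simp add: field_simps)
  show "linked c (m + 1) (k + 3) (- 1 / p + 1)"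
    unfolding linked_def e using ul l3 uw o3 uo ge lt P(1) assms(4) pSa by simp
qed

text \<open>
  A negative value of the lower orbit exchanges the roles of the two orbits.
\<close>

lemma linked_neg:
  assumes "linked c m k q" "q < 0"
  defines "p \<equiv> q / (1 - q)"
  shows "p < 0" "ulive a b c (m + 1)" "upper_orbit a b c (m + 1) = Fin (- 1 / q + 1)"
    "upper_walk a b c (m + 1) = T \<circ> S \<circ> lower_walk a b c k" "upper_orbit a b c m = Fin p"
    "lower_orbit a b c k = Fin q" "- 1 / p = - 1 / q + 1"
proof -
  have q: "q < 1" "live a b c k" "lower_orbit a b c k = Fin q" "ulive a b c m" "b - 1 \<le> p"
    using assms(1) by (auto simp: linked_def p_def)
  show p0: "p < 0" using assms(2) by (simp add: p_def field_simps)
  show uo: "upper_orbit a b c m = Fin p" using assms(1) by (simp add: linked_def p_def)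
  show "lower_orbit a b c k = Fin q" by (rule q(3))
  have pa: "a \<le> p" using q(5) gap by linarith
  have st: "usteppable a b (Fin p)" unfolding usteppable_iff using pa p0 by simp
  have r: "rho a b (Fin p) = S" using pa p0 b_pos by simp
  show "ulive a b c (m + 1)" using ulive_Suc[of c m] uo q st by simp
  show e: "- 1 / p = - 1 / q + 1" using assms(2) by (simp add: p_def field_simps)
  then show "upper_orbit a b c (m + 1) = Fin (- 1 / q + 1)"
    using upper_orbit_Suc[of a b c m] uo r p0 by (simp del: rho.simps)
  have "upper_walk a b c (m + 1) = S \<circ> (S \<circ> T \<circ> S \<circ> lower_walk a b c k)"
    using upper_walk_Suc[of a b c m] uo r assms(1) by (simp add: linked_def del: rho.simps)
  then show "upper_walk a b c (m + 1) = T \<circ> S \<circ> lower_walk a b c k"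
    by (simp add: fun_eq_iff)
qed

lemma linked_neg_close:
  assumes "linked c m k q" "q < 0" "a < q"
  shows "\<not> steppable a b (lower_orbit a b c k)" "\<not> usteppable a b (upper_orbit a b c (m + 1))"
    "upper_walk a b c (m + 2) = lower_walk a b c (k + 1)" "upper_orbit a b c (m + 2) \<noteq> Infty"
    "- 1 / a < - 1 / q"
proof -
  note P = linked_neg[OF assms(1,2)]
  show less: "- 1 / a < - 1 / q" using assms(2,3) by (simp add: field_simps)
  have q0: "0 < - 1 / q" using assms(2) by simp
  show "\<not> steppable a b (lower_orbit a b c k)"
    unfolding P(6) steppable_def using assms by simp
  show "\<not> usteppable a b (upper_orbit a b c (m + 1))"
    unfolding P(3) usteppable_iff using less q0 by linarith
  have big: "b \<le> - 1 / q + 1" using less b_le_Sa by linarith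
  have ru: "rho a b (Fin (- 1 / q + 1)) = Tinv" using big less_ab by simp
  have rl: "rho_low a b (Fin q) = S" using assms b_pos by simp
  have "upper_walk a b c (m + 2) = Tinv \<circ> (T \<circ> S \<circ> lower_walk a b c k)"
    using upper_walk_Suc[of a b c "m + 1"] P(3,4) ru by (simp del: rho.simps)
  also have "\<dots> = S \<circ> lower_walk a b c k" by (simp add: fun_eq_iff)
  also have "\<dots> = lower_walk a b c (k + 1)"
    using lower_walk_Suc[of a b c k] P(6) rl by (simp del: rho_low.simps)
  finally show "upper_walk a b c (m + 2) = lower_walk a b c (k + 1)" .
  show "upper_orbit a b c (m + 2) \<noteq> Infty"
    using upper_orbit_Suc[of a b c "m + 1"] P(3) ru by (simp del: rho.simps)
qed

lemma linked_neg_step: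
  assumes "linked c m k q" "q < 0" "q \<le> a"
  shows "linked c (m + 3) (k + 1) (q + 1)" "upper_orbit a b c (m + 2) = Fin (- 1 / q)"
    "upper_walk a b c (m + 2) = S \<circ> lower_walk a b c k" "ulive a b c (m + 2)"
proof -
  note P = linked_neg[OF assms(1,2)]
  have qS: "- 1 / b \<le> q" using assms(1) by (simp add: linked_def)
  have ge: "b \<le> - 1 / q" using qS assms(2) b_pos by (simp add: field_simps)
  have le: "- 1 / q \<le> - 1 / a" using assms(2,3) a_neg by (simp add: field_simps)
  have ust1: "usteppable a b (Fin (- 1 / q + 1))" unfolding usteppable_iff using ge le by linarith
  have ust2: "usteppable a b (Fin (- 1 / q))" unfolding usteppable_iff using ge le by linarith
  have ru1: "rho a b (Fin (- 1 / q + 1)) = Tinv" using ge less_ab by simp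
  have ru2: "rho a b (Fin (- 1 / q)) = Tinv" using ge less_ab by simp
  have o2: "upper_orbit a b c (m + 2) = Fin (- 1 / q)"
    using upper_orbit_Suc[of a b c "m + 1"] P(3) ru1 by (simp del: rho.simps)
  then show "upper_orbit a b c (m + 2) = Fin (- 1 / q)" .
  have o3: "upper_orbit a b c (m + 3) = Fin (- 1 / q - 1)"
    using upper_orbit_Suc[of a b c "m + 2"] o2 ru2 by (simp add: eval_nat_numeral del: rho.simps)
  have u2: "ulive a b c (m + 2)" using ulive_Suc[of c "m + 1"] P(2,3) ust1 by simp
  then show "ulive a b c (m + 2)" .
  have u3: "ulive a b c (m + 3)"
    using ulive_Suc[of c "m + 2"] u2 o2 ust2 by (simp add: eval_nat_numeral)
  have "upper_walk a b c (m + 2) = Tinv \<circ> (T \<circ> S \<circ> lower_walk a b c k)"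
    using upper_walk_Suc[of a b c "m + 1"] P(3,4) ru1 by (simp del: rho.simps)
  then show w2: "upper_walk a b c (m + 2) = S \<circ> lower_walk a b c k" by (simp add: fun_eq_iff)
  have w3: "upper_walk a b c (m + 3) = Tinv \<circ> (S \<circ> lower_walk a b c k)"
    using upper_walk_Suc[of a b c "m + 2"] w2 o2 ru2 by (simp add: eval_nat_numeral del: rho.simps)
  have st: "steppable a b (Fin q)" using qS assms(3) by (simp add: steppable_def)
  have rl: "rho_low a b (Fin q) = T" using assms(3) by (rule rho_low_T)
  have l1: "live a b c (k + 1)" using live_Suc[of a b c k] P(6) st assms(1) by (simp add: linked_def)
  have lo1: "lower_orbit a b c (k + 1) = Fin (q + 1)"
    using lower_orbit_Suc[of a b c k] P(6) rl by (simp del: rho_low.simps)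
  have lw1: "lower_walk a b c (k + 1) = T \<circ> lower_walk a b c k"
    using lower_walk_Suc[of a b c k] P(6) rl by (simp del: rho_low.simps)
  have uw: "upper_walk a b c (m + 3) = S \<circ> T \<circ> S \<circ> lower_walk a b c (k + 1)"
    unfolding w3 lw1 by (simp add: fun_eq_iff STST)
  have e: "(q + 1) / (1 - (q + 1)) = - 1 / q - 1" using assms(2) by (simp add: field_simps)
  show "linked c (m + 3) (k + 1) (q + 1)"
    unfolding linked_def e using u3 l1 uw lo1 o3 qS assms(2,3) ge le by simp
qed

lemma live_iff_le: "live a b c k \<Longrightarrow> \<not> steppable a b (lower_orbit a b c k) \<Longrightarrow> live a b c n \<longleftrightarrow> n \<le> k"
  unfolding live_def by (metis linorder_not_less order.strict_trans2 order.trans)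

lemma ulive_iff_le:
  assumes "ulive a b c m" "\<not> usteppable a b (upper_orbit a b c m)"
  shows "ulive a b c n \<longleftrightarrow> n \<le> m"
proof -
  interpret m: ab "- b" "- a" by (rule mirror)
  show ?thesis
    using assms upper_walk_mirror(2)[OF assms(1)] m.live_iff_le[of "swap c" m n] by simp
qed

definition strong_shape :: "disc \<Rightarrow> nat \<Rightarrow> nat \<Rightarrow> bool" where
  "strong_shape c m k \<longleftrightarrow> (\<forall>n. ulive a b c n \<longleftrightarrow> n < m) \<and> (\<forall>n. live a b c n \<longleftrightarrow> n < k) \<and>
     upper_walk a b c m = lower_walk a b c k \<and> upper_orbit a b c m \<noteq> Infty"

definition weak_shape :: "disc \<Rightarrow> nat \<Rightarrow> nat \<Rightarrow> bool" where
  "weak_shape c m k \<longleftrightarrow> (\<forall>n. ulive a b c n \<longleftrightarrow> n \<le> m) \<and> (\<forall>n. live a b c n \<longleftrightarrow> n \<le> k) \<and>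
     upper_orbit a b c m = Fin 0 \<and> lower_orbit a b c k = Fin 0"

text \<open>
  As long as the orbits neither close up nor hit \<open>0\<close>, both times of the link increase.
\<close>

lemma cycle_trichotomy:
  "(\<exists>m k. strong_shape c m k) \<or> (\<exists>m k. weak_shape c m k) \<or> (\<forall>n. ulive a b c n \<and> live a b c n)"
proof (rule ccontr)
  assume no: "\<not> ?thesis"
  have start: "\<exists>m k q. linked c m k q" using linked_start by (cases c) blast+
  have next_pair: "\<exists>m' k' q'. linked c m' k' q' \<and> m < m' \<and> k < k'" if L: "linked c m k q" for m k q
  proof -
    have ul: "ulive a b c m" "live a b c k" using L by (auto simp: linked_def)
    consider "q = 0" | "0 < q" "q / (1 - q) < b" | "0 < q" "b \<le> q / (1 - q)"
      | "q < 0" "a < q" | "q < 0" "q \<le> a" by linarith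
    then show ?thesis
    proof cases
      case 1
      then have "weak_shape c m k"
        using linked_zero[of c m k] L ulive_iff_le[OF ul(1)] live_iff_le[OF ul(2)]
        unfolding weak_shape_def by blast
      then show ?thesis using no by blast
    next
      case 2
      note P = linked_pos(2)[OF L 2(1)] linked_pos_close[OF L 2]
      have "strong_shape c (m + 1) (k + 2)"
        unfolding strong_shape_def using P ulive_iff_le[OF ul(1)] live_iff_le[OF P(1)] by auto
      then show ?thesis using no by blast
    next
      case 3
      then show ?thesis using linked_pos_step(1)[OF L 3]
        by (intro exI[of _ "m + 1"] exI[of _ "k + 3"]) auto
    next
      case 4
      note P = linked_neg(2)[OF L 4(1)] linked_neg_close[OF L 4]
      have "strong_shape c (m + 2) (k + 1)"
        unfolding strong_shape_def using P ulive_iff_le[OF P(1)] live_iff_le[OF ul(2)] by auto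
      then show ?thesis using no by blast
    next
      case 5
      then show ?thesis using linked_neg_step(1)[OF L 5]
        by (intro exI[of _ "m + 3"] exI[of _ "k + 1"]) auto
    qed
  qed
  have "\<exists>m k q. linked c m k q \<and> n \<le> m \<and> n \<le> k" for n
  proof (induction n)
    case 0
    then show ?case using start by auto
  next
    case (Suc n)
    then obtain m k q where "linked c m k q" "n \<le> m" "n \<le> k" by blast
    moreover from next_pair[OF this(1)] obtain m' k' q' where "linked c m' k' q'" "m < m'" "k < k'"
      by blast
    ultimately show ?case by (intro exI[of _ m'] exI[of _ k'] exI[of _ q']) auto
  qed
  then have "\<forall>n. ulive a b c n \<and> live a b c n" unfolding linked_def by (meson live_mono)
  then show False using no by blast
qed

end

section \<open>The truncated orbits are the live parts of the orbits\<close>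

context ab
begin

lemma lower_live_not_upper:
  assumes ne: "(a, b) \<noteq> (- 1, 1)" and k: "live a b c k"
    and eq: "upper_walk a b c m = lower_walk a b c k" and fin: "upper_orbit a b c m \<noteq> Infty"
  shows False
proof -
  interpret m: ab "- b" "- a" by (rule mirror)
  have "upper_walk (- b) (- a) (swap c) k z = lower_walk (- b) (- a) (swap c) m z" for z
    using m.upper_walk_mirror(1)[of "swap c" k z] k upper_walk_mirror_finite(1)[OF fin, of "neg z"] eq
    by simp
  then have "upper_walk (- b) (- a) (swap c) k = lower_walk (- b) (- a) (swap c) m" ..
  moreover have "(- b, - a) \<noteq> (- 1, 1)" using ne by auto
  ultimately show False using m.upper_live_not_lower[of "swap c" k m] k by simp
qed

lemma strong_end_not_live:
  assumes "(a, b) \<noteq> (- 1, 1)" "strong_end a b c m k"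
  shows "\<not> ulive a b c m" "\<not> live a b c k"
  using assms upper_live_not_lower lower_live_not_upper unfolding strong_end_iff by blast+

text \<open>
  Steppable levels of the upper orbit lie in \<open>[a, 0)\<close> or are at least \<open>b\<close>, those of the lower orbit lie in \<open>(0, b]\<close> or are
  at most \<open>a\<close>; only \<open>a\<close> and \<open>b\<close> can be common to both.
\<close>

lemma weak_end_cases:
  assumes "weak_end a b c m k" "ulive a b c m" "live a b c k"
  shows "\<not> usteppable a b (upper_orbit a b c m) \<or> \<not> steppable a b (lower_orbit a b c k)"
proof (rule ccontr)
  assume n: "\<not> ?thesis"
  obtain u where u: "upper_orbit a b c m = Fin u" using ulive_Fin[OF assms(2)] by blast
  then have "lower_orbit a b c k = Fin u" "u \<noteq> a" "u \<noteq> b"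
    using assms(1) by (auto simp: weak_end_def common_value_def)
  then show False using n u less_ab unfolding u usteppable_iff by (auto simp: steppable_def usteppable_iff)
qed

text \<open>
  A strong end cannot occur in the live parts, so the first one is where they end.
\<close>

lemma strong_shape_trunc:
  assumes ne: "(a, b) \<noteq> (- 1, 1)" and sh: "strong_shape c m k"
  shows "upper_trunc a b c = upper_orbit a b c ` {n. ulive a b c n}"
    "lower_trunc a b c = lower_orbit a b c ` {n. live a b c n}"
proof -
  have se: "strong_end a b c m k" using sh by (simp add: strong_end_iff strong_shape_def)
  then have sc: "strong_cycle a b c" by (auto simp: strong_cycle_def)
  have min: "m \<le> m' \<and> k \<le> k'" if "strong_end a b c m' k'" for m' k'
    using strong_end_not_live[OF ne that] sh by (auto simp: strong_shape_def not_less)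
  have ce: "cycle_end a b c = strong_end a b c" using sc by (simp add: cycle_end_def)
  have ul: "upper_length a b c = m"
    unfolding upper_length_def ce by (rule Least_equality) (use se min in blast)+
  have ll: "lower_length a b c = k"
    unfolding lower_length_def ce ul by (rule Least_equality) (use se min in blast)+
  show "upper_trunc a b c = upper_orbit a b c ` {n. ulive a b c n}"
    "lower_trunc a b c = lower_orbit a b c ` {n. live a b c n}"
    using sc ul ll sh by (auto simp: upper_trunc_def lower_trunc_def strong_shape_def)
qed

lemma weak_shape_trunc:
  assumes ne: "(a, b) \<noteq> (- 1, 1)" and sh: "weak_shape c m k"
  shows "upper_trunc a b c = upper_orbit a b c ` {n. ulive a b c n}"
    "lower_trunc a b c = lower_orbit a b c ` {n. live a b c n}"
proof -
  have o: "upper_orbit a b c m = Fin 0" "lower_orbit a b c k = Fin 0"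
    and live: "\<And>n. ulive a b c n \<longleftrightarrow> n \<le> m" "\<And>n. live a b c n \<longleftrightarrow> n \<le> k"
    using sh by (auto simp: weak_shape_def)
  have ru: "rho a b (Fin 0) = S" and rl: "rho_low a b (Fin 0) = S" using a_neg b_pos by auto
  have "upper_orbit a b c (m + 1) = Infty" "lower_orbit a b c (k + 1) = Infty"
    using o ru rl upper_orbit_Suc[of a b c m] lower_orbit_Suc[of a b c k]
    by (simp_all del: rho.simps rho_low.simps)
  then have inf: "upper_orbit a b c (m + 1 + n) = Infty" "lower_orbit a b c (k + 1 + n) = Infty" for n
    using upper_after_Infty lower_after_Infty by blast+
  have fin: "m' \<le> m \<and> k' \<le> k" if "common_value a b c m' k'" for m' k'
  proof -
    have "upper_orbit a b c m' \<noteq> Infty" "lower_orbit a b c k' \<noteq> Infty"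
      using that by (auto simp: common_value_def)
    then have "\<not> m < m'" "\<not> k < k'"
      using inf(1)[of "m' - m - 1"] inf(2)[of "k' - k - 1"] by auto
    then show ?thesis by simp
  qed
  have ns: "\<not> strong_cycle a b c"
  proof
    assume "strong_cycle a b c"
    then obtain m' k' where se: "strong_end a b c m' k'" by (auto simp: strong_cycle_def)
    then have "m' \<le> m" using fin by (auto simp: strong_end_def)
    then show False using strong_end_not_live(1)[OF ne se] live by blast
  qed
  have we: "weak_end a b c m k" using o a_neg b_pos by (auto simp: weak_end_def common_value_def)
  then have wc: "weak_cycle a b c" using ns by (auto simp: weak_cycle_def)
  have min: "m = m' \<and> k = k'" if w: "weak_end a b c m' k'" for m' k'
  proof -
    have le: "m' \<le> m" "k' \<le> k" using fin w by (auto simp: weak_end_def)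
    then have "ulive a b c m'" "live a b c k'" using live by auto
    from weak_end_cases[OF w this] have "m' = m \<or> k' = k"
    proof
      assume "\<not> usteppable a b (upper_orbit a b c m')"
      then have "\<not> ulive a b c (Suc m')" unfolding ulive_Suc by blast
      then show ?thesis using live le by (metis le_antisym not_less_eq_eq)
    next
      assume "\<not> steppable a b (lower_orbit a b c k')"
      then have "\<not> live a b c (Suc k')" unfolding live_Suc by blast
      then show ?thesis using live le by (metis le_antisym not_less_eq_eq)
    qed
    then have zero: "upper_orbit a b c m' = Fin 0" "lower_orbit a b c k' = Fin 0"
      using w o by (auto simp: weak_end_def common_value_def)
    have "\<not> m' < m"
    proof
      assume "m' < m"
      then have "ulive a b c (Suc m')" using live by simp
      then have "usteppable a b (Fin 0)" using zero unfolding ulive_Suc by simp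
      then show False using b_pos by (simp add: usteppable_iff steppable_def)
    qed
    moreover have "\<not> k' < k"
    proof
      assume "k' < k"
      then have "live a b c (Suc k')" using live by simp
      then have "steppable a b (Fin 0)" using zero unfolding live_Suc by simp
      then show False using a_neg by (simp add: steppable_def)
    qed
    ultimately show ?thesis using le by simp
  qed
  have ce: "cycle_end a b c = weak_end a b c" using ns by (simp add: cycle_end_def)
  have ul: "upper_length a b c = m"
    unfolding upper_length_def ce by (rule Least_equality) (use we min in blast)+
  have ll: "lower_length a b c = k"
    unfolding lower_length_def ce ul by (rule Least_equality) (use we min in blast)+
  have "{n. n \<le> m} = insert m {..<m}" "{n. n \<le> k} = insert k {..<k}" by auto
  then show "upper_trunc a b c = upper_orbit a b c ` {n. ulive a b c n}"
    "lower_trunc a b c = lower_orbit a b c ` {n. live a b c n}"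
    using ns wc ul ll o by (simp_all add: upper_trunc_def lower_trunc_def live)
qed

text \<open>
  If both orbits stay live for ever, no cycle ends: a common value would have to be \<open>a\<close> or \<open>b\<close>, and a trivial product
  is impossible on the live parts.
\<close>

lemma trunc_eq:
  assumes ne: "(a, b) \<noteq> (- 1, 1)"
  shows "upper_trunc a b c = upper_orbit a b c ` {n. ulive a b c n}"
    "lower_trunc a b c = lower_orbit a b c ` {n. live a b c n}"
proof -
  have "upper_trunc a b c = upper_orbit a b c ` {n. ulive a b c n} \<and>
    lower_trunc a b c = lower_orbit a b c ` {n. live a b c n}"
    using cycle_trichotomy[of c]
  proof (elim disjE exE)
    fix m k assume "strong_shape c m k"
    then show ?thesis using strong_shape_trunc[OF ne] by metis
  next
    fix m k assume "weak_shape c m k"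
    then show ?thesis using weak_shape_trunc[OF ne] by metis
  next
    assume all: "\<forall>n. ulive a b c n \<and> live a b c n"
    then have "\<not> strong_cycle a b c"
      using strong_end_not_live(1)[OF ne] by (auto simp: strong_cycle_def)
    moreover have "\<not> weak_cycle a b c"
    proof
      assume "weak_cycle a b c"
      then obtain m k where "weak_end a b c m k" by (auto simp: weak_cycle_def)
      then have "\<not> usteppable a b (upper_orbit a b c m) \<or> \<not> steppable a b (lower_orbit a b c k)"
        using weak_end_cases all by blast
      then show False using all ulive_Suc live_Suc by blast
    qed
    ultimately show ?thesis using all by (simp add: upper_trunc_def lower_trunc_def)
  qed
  then show "upper_trunc a b c = upper_orbit a b c ` {n. ulive a b c n}"
    "lower_trunc a b c = lower_orbit a b c ` {n. live a b c n}" by blast+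
qed

end

section \<open>The endpoints respect the mirror symmetry\<close>

context ab
begin

text \<open>
  The first visits of the orbits of \<open>b\<close> to \<open>a\<close> and to \<open>S a\<close>; they happen together, between two links.
\<close>

definition meets_at :: "nat \<Rightarrow> nat \<Rightarrow> bool" where
  "meets_at i j \<longleftrightarrow> ulive a b At_b i \<and> live a b At_b j \<and>
     upper_orbit a b At_b i = Fin (- 1 / a) \<and> lower_orbit a b At_b j = Fin a \<and>
     (\<forall>i'<i. upper_orbit a b At_b i' \<noteq> Fin (- 1 / a)) \<and> (\<forall>j'<j. lower_orbit a b At_b j' \<noteq> Fin a) \<and>
     upper_walk a b At_b i = S \<circ> lower_walk a b At_b j"

definition unmet :: "nat \<Rightarrow> nat \<Rightarrow> bool" where
  "unmet m k \<longleftrightarrow> (\<forall>i<m. upper_orbit a b At_b i \<noteq> Fin (- 1 / a)) \<and> (\<forall>j<k. lower_orbit a b At_b j \<noteq> Fin a)"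

text \<open>
  Between two links the lower orbit passes \<open>a\<close> exactly if the upper orbit passes \<open>S a\<close>, and at that time the two products differ by \<open>S\<close>. For
  \<open>a + 1 < b\<close> the upper orbit has no other way to reach \<open>S a\<close>, since its values exceed \<open>a\<close>.
\<close>

lemma meets_or_unmet:
  assumes ab1: "a + 1 < b" and ne: "- (a * b) < 1"
  shows "(\<exists>i j. meets_at i j) \<or>
    (\<forall>n. (ulive a b At_b n \<longrightarrow> upper_orbit a b At_b n \<noteq> Fin (- 1 / a)) \<and>
         (live a b At_b n \<longrightarrow> lower_orbit a b At_b n \<noteq> Fin a))"
proof (rule ccontr)
  assume no: "\<not> ?thesis"
  have all: False if "\<And>n. ulive a b At_b n \<Longrightarrow> n < m" "\<And>n. live a b At_b n \<Longrightarrow> n < k" "unmet m k" for m k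
    using that no unfolding unmet_def by blast
  have SbA: "- 1 / b < a" using ne b_pos by (simp add: field_simps)
  have start: "unmet 0 1" using SbA lower_start(2) by (auto simp: unmet_def less_Suc_eq)
  have next_pair: "\<exists>m' k' q'. linked At_b m' k' q' \<and> unmet m' k' \<and> m < m' \<and> k < k'"
    if L: "linked At_b m k q" and U: "unmet m k" for m k q
  proof -
    have ul: "ulive a b At_b m" "live a b At_b k" using L by (auto simp: linked_def)
    have Sa0: "0 < - 1 / a" by (rule Sa_pos)
    consider "q = 0" | "0 < q" "q / (1 - q) < b" | "0 < q" "b \<le> q / (1 - q)"
      | "q < 0" "a < q" | "q < 0" "q \<le> a" by linarith
    then show ?thesis
    proof cases
      case 1
      then have Z: "\<not> steppable a b (lower_orbit a b At_b k)" "\<not> usteppable a b (upper_orbit a b At_b m)"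
        "lower_orbit a b At_b k = Fin 0" "upper_orbit a b At_b m = Fin 0"
        using linked_zero[of At_b m k] L by auto
      have "unmet (m + 1) (k + 1)"
        using U Z Sa0 a_neg by (auto simp: unmet_def less_Suc_eq simp del: divide_minus_left)
      then show ?thesis
        using all[of "m + 1" "k + 1"] ulive_iff_le[OF ul(1) Z(2)] live_iff_le[OF ul(2) Z(1)] by auto
    next
      case 2
      note P = linked_pos[OF L 2(1)] and C = linked_pos_close[OF L 2]
      have "unmet (m + 1) (k + 2)"
        using U P C b_le_Sa 2 a_neg by (auto simp: unmet_def less_Suc_eq simp del: divide_minus_left)
      then show ?thesis
        using all[of "m + 1" "k + 2"] ulive_iff_le[OF ul(1) C(2)] live_iff_le[OF P(2) C(1)] by auto
    next
      case 3
      note P = linked_pos[OF L 3(1)] and C = linked_pos_step[OF L 3]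
      have "unmet (m + 1) (k + 3)"
        using U P C 3 a_neg
        by (auto simp: unmet_def less_Suc_eq eval_nat_numeral simp del: divide_minus_left)
      then show ?thesis using C(1) by (intro exI[of _ "m + 1"] exI[of _ "k + 3"]) auto
    next
      case 4
      note P = linked_neg[OF L 4(1)] and C = linked_neg_close[OF L 4]
      have "unmet (m + 2) (k + 1)"
        using U P C 4 Sa0 by (auto simp: unmet_def less_Suc_eq simp del: divide_minus_left)
      then show ?thesis
        using all[of "m + 2" "k + 1"] ulive_iff_le[OF P(2) C(2)] live_iff_le[OF ul(2) C(1)] by auto
    next
      case 5
      note P = linked_neg[OF L 5(1)] and C = linked_neg_step[OF L 5]
      have p: "a < q / (1 - q)" using L ab1 by (simp add: linked_def)
      have ne1: "- 1 / q + 1 \<noteq> - 1 / a"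
      proof
        assume "- 1 / q + 1 = - 1 / a"
        then have e: "- 1 / (q / (1 - q)) = - 1 / a" using P(7) by metis
        define p where "p = q / (1 - q)"
        have "a = p" using e a_neg P(1) unfolding p_def[symmetric] by simp
        then show False using p by (simp add: p_def)
      qed
      have U2: "unmet (m + 2) k"
        using U P(1,3,5) ne1 Sa0 by (auto simp: unmet_def less_Suc_eq simp del: divide_minus_left)
      show ?thesis
      proof (cases "q = a")
        case True
        then have "meets_at (m + 2) k"
          using U2 C P(6) ul unfolding meets_at_def unmet_def by blast
        then show ?thesis using no by blast
      next
        case False
        then have "- 1 / q \<noteq> - 1 / a" using 5 a_neg by (simp add: field_simps)
        then have "unmet (m + 3) (k + 1)"
          using U2 C(2) P(6) False
          by (auto simp: unmet_def less_Suc_eq eval_nat_numeral simp del: divide_minus_left)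
        then show ?thesis using C(1) by (intro exI[of _ "m + 3"] exI[of _ "k + 1"]) auto
      qed
    qed
  qed
  have "\<exists>m k q. linked At_b m k q \<and> unmet m k \<and> n \<le> m \<and> n \<le> k" for n
  proof (induction n)
    case 0
    then show ?case using linked_start(2) start by auto
  next
    case (Suc n)
    then obtain m k q where mk: "linked At_b m k q" "unmet m k" "n \<le> m" "n \<le> k" by blast
    from next_pair[OF mk(1,2)] obtain m' k' q'
      where "linked At_b m' k' q'" "unmet m' k'" "m < m'" "k < k'" by blast
    then show ?case using mk by (intro exI[of _ m'] exI[of _ k'] exI[of _ q']) auto
  qed
  then have "\<exists>m k. unmet m k \<and> Suc n \<le> m \<and> Suc n \<le> k" for n by blast
  then show False using no unfolding unmet_def by (meson Suc_le_eq)
qed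

lemma b_meets_a_mirror:
  assumes ab1: "a + 1 < b" and ne: "- (a * b) < 1"
  shows "b_meets_a a b \<longleftrightarrow> a_meets_Sb (- b) (- a)"
    "b_meets_a a b \<Longrightarrow> lower_map (- b) (- a) (At_a, Fin (- 1 / - a)) z =
      neg (S (lower_map a b (At_b, Fin a) (neg z)))"
proof -
  interpret m: ab "- b" "- a" by (rule mirror)
  have orb: "lower_orbit (- b) (- a) At_a n = neg (upper_orbit a b At_b n)" if "ulive a b At_b n" for n
    using upper_walk_mirror(2)[OF that] by simp
  have Sa: "neg (Fin (- 1 / a)) = Fin (- 1 / - a)" by simp
  have main: "(b_meets_a a b \<longleftrightarrow> a_meets_Sb (- b) (- a)) \<and> (b_meets_a a b \<longrightarrow>
    (\<forall>z. lower_map (- b) (- a) (At_a, Fin (- 1 / - a)) z = neg (S (lower_map a b (At_b, Fin a) (neg z)))))"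
    using meets_or_unmet[OF assms]
  proof
    assume "\<exists>i j. meets_at i j"
    then obtain i j where ij: "meets_at i j" by blast
    have vb: "visits a b At_b (Fin a)" using ij by (auto simp: meets_at_def visits_def)
    have fj: "first_visit a b At_b (Fin a) = j"
      using ij unfolding first_visit_def meets_at_def by (intro Least_equality) (auto simp: not_less[symmetric])
    have ui: "ulive a b At_b i" using ij by (simp add: meets_at_def)
    have oi: "lower_orbit (- b) (- a) At_a i = Fin (- 1 / - a)"
      using orb[OF ui] ij unfolding meets_at_def by (simp only: Sa)
    have va: "visits (- b) (- a) At_a (Fin (- 1 / - a))"
      using oi ui unfolding visits_def by auto
    have fi: "first_visit (- b) (- a) At_a (Fin (- 1 / - a)) = i"
      unfolding first_visit_def
    proof (rule Least_equality)
      show "lower_orbit (- b) (- a) At_a i = Fin (- 1 / - a)" by (rule oi)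
      fix n assume n: "lower_orbit (- b) (- a) At_a n = Fin (- 1 / - a)"
      show "i \<le> n"
      proof (rule ccontr)
        assume "\<not> i \<le> n"
        then have "ulive a b At_b n" "n < i" using ui live_mono by auto
        then have "neg (upper_orbit a b At_b n) = neg (Fin (- 1 / a))" using orb n Sa by simp
        then show False using ij \<open>n < i\<close> unfolding meets_at_def neg_eq_iff by blast
      qed
    qed
    have "lower_map (- b) (- a) (At_a, Fin (- 1 / - a)) z = neg (S (lower_map a b (At_b, Fin a) (neg z)))" for z
    proof -
      have "upper_walk a b At_b i (neg z) = neg (lower_walk (- b) (- a) At_a i z)"
        using upper_walk_mirror(1)[OF ui, of "neg z"] by simp
      then show ?thesis unfolding lower_map_eq fi fj using ij by (simp add: meets_at_def)
    qed
    then show ?thesis using va vb ab1 by (simp add: b_meets_a_def a_meets_Sb_def)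
  next
    assume N: "\<forall>n. (ulive a b At_b n \<longrightarrow> upper_orbit a b At_b n \<noteq> Fin (- 1 / a)) \<and>
      (live a b At_b n \<longrightarrow> lower_orbit a b At_b n \<noteq> Fin a)"
    have "\<not> visits (- b) (- a) At_a (Fin (- 1 / - a))"
    proof
      assume "visits (- b) (- a) At_a (Fin (- 1 / - a))"
      then obtain n where n: "ulive a b At_b n" "lower_orbit (- b) (- a) At_a n = Fin (- 1 / - a)"
        by (auto simp: visits_def)
      then have "neg (upper_orbit a b At_b n) = neg (Fin (- 1 / a))" using orb Sa by simp
      then show False using N n(1) unfolding neg_eq_iff by blast
    qed
    moreover have "\<not> visits a b At_b (Fin a)" using N by (auto simp: visits_def)
    ultimately show ?thesis by (simp add: b_meets_a_def a_meets_Sb_def)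
  qed
  from main show "b_meets_a a b \<longleftrightarrow> a_meets_Sb (- b) (- a)" by blast
  from main show "b_meets_a a b \<Longrightarrow> lower_map (- b) (- a) (At_a, Fin (- 1 / - a)) z =
      neg (S (lower_map a b (At_b, Fin a) (neg z)))" by blast
qed

lemma a_meets_Sb_mirror:
  assumes "a + 1 < b" "- (a * b) < 1"
  shows "a_meets_Sb a b \<longleftrightarrow> b_meets_a (- b) (- a)"
    "a_meets_Sb a b \<Longrightarrow> lower_map a b (At_a, Fin (- 1 / b)) z =
      neg (S (lower_map (- b) (- a) (At_b, Fin (- b)) (neg z)))"
proof -
  interpret m: ab "- b" "- a" by (rule mirror)
  have "- b + 1 < - a" "- (- b * - a) < 1" using assms by (auto simp: mult.commute)
  note M = m.b_meets_a_mirror[OF this]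
  show iff: "a_meets_Sb a b \<longleftrightarrow> b_meets_a (- b) (- a)" using M(1) by simp
  show "a_meets_Sb a b \<Longrightarrow> lower_map a b (At_a, Fin (- 1 / b)) z =
      neg (S (lower_map (- b) (- a) (At_b, Fin (- b)) (neg z)))"
    using M(2) iff by simp
qed

text \<open>
  The exceptional case for \<open>a\<close> is the mirror image of the exceptional case for \<open>b\<close>, and the right wall at
  \<open>b\<close> and \<open>S a\<close> is known from the left wall at \<open>S b\<close> and \<open>a\<close>.
\<close>

lemma ray_ends_mirror:
  assumes ne: "- (a * b) < 1" and g: "ray_ends a b xa xb"
  shows "ray_ends (- b) (- a) (- xb) (- xa)"
proof -
  have x: "1 \<le> xa" "xb \<le> - 1" using g by (auto simp: ray_ends_def)
  have "rwall a b True b \<noteq> Infty" unfolding rwall_eq_Infty_iff by (simp add: below_def)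
  then obtain r where r: "rwall a b True b = Fin r" by (cases "rwall a b True b") auto
  have r1: "r \<le> - 1" using rwall_b_le_m1[OF ne] r by (simp add: one_ereal_def)
  obtain p where p: "lwall a b False a = Fin p"
    using lwall_finite[of False a] by (auto simp: below_def)
  have p1: "1 \<le> p" using lwall_a_ge_1[OF ne] p by (simp add: one_ereal_def)
  have lS: "lwall a b True (- 1 / b) = S (Fin r)" using lwall_Sb_plus_eq[OF ne] r by simp
  have lb: "lwall (- b) (- a) False (- b) = Fin (- r)"
    using r by (simp add: rwall_def neg_eq_Fin_iff)
  have lSa: "lwall (- b) (- a) True (- 1 / - a) = neg (S (Fin p))"
  proof -
    have "rwall a b False (- 1 / a) = S (Fin p)" using rwall_Sa_minus_eq[OF ne] p by simp
    then have "neg (rwall a b False (- 1 / a)) = neg (S (Fin p))" by simp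
    then show ?thesis by (simp add: rwall_def)
  qed
  have xr: "xb \<le> r" using g r1 lo_le_iff_S[of r "Fin xb"] x unfolding ray_ends_def lS
    by (simp add: divide_nonneg_neg)
  have px: "p \<le> xa" using g p by (simp add: ray_ends_def)
  have P: "b_meets_a a b \<longleftrightarrow> a_meets_Sb (- b) (- a)" and Q: "a_meets_Sb a b \<longleftrightarrow> b_meets_a (- b) (- a)"
    using b_meets_a_mirror(1) a_meets_Sb_mirror(1) ne
    by (cases "a + 1 < b"; auto simp: b_meets_a_def a_meets_Sb_def)+
  show ?thesis
    unfolding ray_ends_def
  proof (intro conjI)
    show "1 \<le> - xb" "- xa \<le> - 1" using x by auto
    show "hi (lwall (- b) (- a) False (- b)) \<le> ereal (- xb)" using lb xr by simp
    have "1 / xa \<le> 1 / p" using px p1 by (simp add: field_simps)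
    then show "hi (S (Fin (- xa))) \<le> hi (lwall (- b) (- a) True (- 1 / - a))"
      unfolding lSa using x p1 by simp
    show "if b_meets_a (- b) (- a) then lower_map (- b) (- a) (At_b, Fin (- b)) (Fin (- xa)) = Fin (- xb)
      else lwall (- b) (- a) False (- b) = Fin (- xb)"
    proof (cases "a_meets_Sb a b")
      case True
      then have "a + 1 < b" by (simp add: a_meets_Sb_def)
      have "S (Fin xb) = neg (S (lower_map (- b) (- a) (At_b, Fin (- b)) (Fin (- xa))))"
        using a_meets_Sb_mirror(2)[OF \<open>a + 1 < b\<close> ne True, of "Fin xa"] g True by (simp add: ray_ends_def)
      then have "Fin xb = neg (lower_map (- b) (- a) (At_b, Fin (- b)) (Fin (- xa)))"
        unfolding neg_S S_inj .
      then show ?thesis using True Q by (metis neg_neg neg_simps(1))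
    next
      case False
      then have "S (Fin r) = S (Fin xb)" using g lS by (simp add: ray_ends_def)
      then have "r = xb" unfolding S_inj by simp
      then show ?thesis using False Q lb by simp
    qed
    show "if a_meets_Sb (- b) (- a)
      then lower_map (- b) (- a) (At_a, Fin (- 1 / - a)) (Fin (- xb)) = S (Fin (- xa))
      else lwall (- b) (- a) True (- 1 / - a) = S (Fin (- xa))"
    proof (cases "b_meets_a a b")
      case True
      then have "a + 1 < b" by (simp add: b_meets_a_def)
      have "lower_map (- b) (- a) (At_a, Fin (- 1 / - a)) (Fin (- xb)) =
          neg (S (lower_map a b (At_b, Fin a) (Fin xb)))"
        using b_meets_a_mirror(2)[OF \<open>a + 1 < b\<close> ne True, of "Fin (- xb)"] by simp
      also have "\<dots> = S (Fin (- xa))" using g True unfolding neg_S by (simp add: ray_ends_def neg_S)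
      finally show ?thesis using True P by simp
    next
      case False
      then have "p = xa" using g p by (simp add: ray_ends_def)
      then show ?thesis using False P lSa by (simp add: neg_S)
    qed
  qed
qed

lemma ray_ends_both_exists:
  assumes ne: "(a, b) \<noteq> (- 1, 1)"
  shows "\<exists>xa xb. ray_ends a b xa xb \<and> ray_ends (- b) (- a) (- xb) (- xa)"
proof (cases "- (a * b) < 1")
  case True
  then show ?thesis using ray_ends_mirror ray_ends_exists_nonextremal by blast
next
  case False
  interpret m: ab "- b" "- a" by (rule mirror)
  have e: "- (a * b) = 1" using False prod by simp
  have "ray_ends a b 1 (- 1)" using e ne by (rule ray_ends_extremal)
  moreover have "ray_ends (- b) (- a) 1 (- 1)"
    using e ne by (intro m.ray_ends_extremal) (auto simp: mult.commute)
  ultimately show ?thesis by force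
qed

end

section \<open>Levels\<close>

definition mirror_level :: "level \<Rightarrow> level" where
  "mirror_level = (\<lambda>(c, y). (swap c, neg y))"

lemma mirror_level_mirror [simp]: "mirror_level (mirror_level l) = l"
  by (cases l) (simp add: mirror_level_def)

lemma mirror_level_Sa: "mirror_level (level_Sa a) = level_Sb (- a)"
  by (simp add: mirror_level_def level_Sa_def level_Sb_def neg_S)

text \<open>
  The first endpoint equation; the second one is its mirror image (\<open>endpoint_equations_iff\<close>).
\<close>

definition next_lower_match :: "real \<Rightarrow> real \<Rightarrow> real \<Rightarrow> real \<Rightarrow> bool" where
  "next_lower_match a b xa xb \<longleftrightarrow>
     (\<exists>l. next_lower a b xa xb l \<and> lower_right a b xa xb (level_Sb b) = lower_left a b xa xb l)"

lemma ray_left_mirror: "neg (ray_left xa xb c) = ray_right (- xb) (- xa) (swap c)"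
  by (cases c) auto

lemma ray_right_mirror: "neg (ray_right xa xb c) = ray_left (- xb) (- xa) (swap c)"
  by (cases c) auto

lemma neg_in_ray: "neg z \<in> ray (- xb) (- xa) (swap c) \<longleftrightarrow> z \<in> ray xa xb c"
  by (cases c; cases z) (auto simp: ray_a_iff ray_b_iff)

context ab
begin

lemma lower_levels_iff:
  assumes "(a, b) \<noteq> (- 1, 1)"
  shows "l \<in> lower_levels a b \<longleftrightarrow> visits a b (fst l) (snd l)"
  using trunc_eq(2)[OF assms] by (cases l) (auto simp: lower_levels_def visits_def)

lemma upper_levels_iff:
  assumes "(a, b) \<noteq> (- 1, 1)"
  shows "l \<in> upper_levels a b \<longleftrightarrow> mirror_level l \<in> lower_levels (- b) (- a)"
proof -
  interpret m: ab "- b" "- a" by (rule mirror)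
  have "(- b, - a) \<noteq> (- 1, 1)" using assms by auto
  then have "mirror_level l \<in> lower_levels (- b) (- a) \<longleftrightarrow>
      visits (- b) (- a) (swap (fst l)) (neg (snd l))"
    using m.lower_levels_iff by (simp add: mirror_level_def split: prod.split)
  moreover have "l \<in> upper_levels a b \<longleftrightarrow> (\<exists>n. ulive a b (fst l) n \<and> upper_orbit a b (fst l) n = snd l)"
    using trunc_eq(1)[OF assms] by (cases l) (auto simp: upper_levels_def)
  ultimately show ?thesis
    unfolding visits_def using upper_walk_mirror(2) by (metis neg_neg)
qed

lemma upper_map_mirror:
  assumes "(a, b) \<noteq> (- 1, 1)" "l \<in> upper_levels a b"
  shows "upper_map a b l z = neg (lower_map (- b) (- a) (mirror_level l) (neg z))"
proof -
  interpret m: ab "- b" "- a" by (rule mirror)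
  obtain c y where l: "l = (c, y)" by (cases l)
  have ne': "(- b, - a) \<noteq> (- 1, 1)" using assms(1) by auto
  have v: "visits (- b) (- a) (swap c) (neg y)"
    using assms(2) upper_levels_iff[OF assms(1)] m.lower_levels_iff[OF ne']
    unfolding l mirror_level_def by simp
  define n where "n = first_visit (- b) (- a) (swap c) (neg y)"
  note n = visits_first[OF v, folded n_def]
  have "(LEAST n. upper_orbit a b c n = y) = n"
  proof (rule Least_equality)
    show "upper_orbit a b c n = y" using upper_walk_mirror(2)[of c n] n by simp
    fix i assume i: "upper_orbit a b c i = y"
    show "n \<le> i"
    proof (rule ccontr)
      assume "\<not> n \<le> i"
      then have "ulive a b c i" using n(1) live_mono by simp
      then have "lower_orbit (- b) (- a) (swap c) i = neg y" using upper_walk_mirror(2)[of c i] i by auto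
      then have "n \<le> i" unfolding n_def by (rule first_visit_le)
      then show False using \<open>\<not> n \<le> i\<close> by simp
    qed
  qed
  then show ?thesis
    using upper_walk_mirror(1)[of c n z] n
    by (simp add: l upper_map_def mirror_level_def lower_map_eq n_def)
qed

lemma upper_ends_mirror:
  assumes "(a, b) \<noteq> (- 1, 1)" "l \<in> upper_levels a b"
  shows "upper_left a b xa xb l = neg (lower_right (- b) (- a) (- xb) (- xa) (mirror_level l))"
    "upper_right a b xa xb l = neg (lower_left (- b) (- a) (- xb) (- xa) (mirror_level l))"
    "x \<in> upper_seg a b xa xb l \<longleftrightarrow> neg x \<in> lower_seg (- b) (- a) (- xb) (- xa) (mirror_level l)"
proof -
  have f: "fst (mirror_level l) = swap (fst l)" by (cases l) (simp add: mirror_level_def)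
  note U = upper_map_mirror[OF assms]
  show "upper_left a b xa xb l = neg (lower_right (- b) (- a) (- xb) (- xa) (mirror_level l))"
    "upper_right a b xa xb l = neg (lower_left (- b) (- a) (- xb) (- xa) (mirror_level l))"
    by (simp_all add: upper_left_def upper_right_def lower_left_def lower_right_def U f
        ray_left_mirror ray_right_mirror)
  show "x \<in> upper_seg a b xa xb l \<longleftrightarrow> neg x \<in> lower_seg (- b) (- a) (- xb) (- xa) (mirror_level l)"
  proof
    assume "x \<in> upper_seg a b xa xb l"
    then obtain z where "z \<in> ray xa xb (fst l)" "x = upper_map a b l z" by (auto simp: upper_seg_def)
    then have "neg z \<in> ray (- xb) (- xa) (swap (fst l))"
      "neg x = lower_map (- b) (- a) (mirror_level l) (neg z)" by (simp_all add: neg_in_ray U)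
    then show "neg x \<in> lower_seg (- b) (- a) (- xb) (- xa) (mirror_level l)"
      unfolding lower_seg_def f by (metis imageI)
  next
    assume "neg x \<in> lower_seg (- b) (- a) (- xb) (- xa) (mirror_level l)"
    then obtain z where z: "z \<in> ray (- xb) (- xa) (swap (fst l))"
      "neg x = lower_map (- b) (- a) (mirror_level l) z" unfolding lower_seg_def f by blast
    then have "neg z \<in> ray xa xb (fst l)" using neg_in_ray[of "neg z" xb xa "fst l"] by simp
    moreover have "x = upper_map a b l (neg z)" using z(2) by (simp add: U) (metis neg_neg)
    ultimately show "x \<in> upper_seg a b xa xb l" unfolding upper_seg_def by blast
  qed
qed

lemma level_Sb_in: "(a, b) \<noteq> (- 1, 1) \<Longrightarrow> level_Sb b \<in> lower_levels a b"
  using lower_levels_iff visits_start(2) b_pos by (simp add: level_Sb_def)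

lemma level_Sa_in: "(a, b) \<noteq> (- 1, 1) \<Longrightarrow> level_Sa a \<in> upper_levels a b"
proof -
  interpret m: ab "- b" "- a" by (rule mirror)
  assume ne: "(a, b) \<noteq> (- 1, 1)"
  then have "(- b, - a) \<noteq> (- 1, 1)" by auto
  from m.level_Sb_in[OF this] show ?thesis using upper_levels_iff[OF ne] mirror_level_Sa by simp
qed

lemma upper_before_mirror:
  assumes "(a, b) \<noteq> (- 1, 1)" "u \<in> upper_levels a b" "u' \<in> upper_levels a b"
  shows "upper_before a b xa xb u u' \<longleftrightarrow>
    lower_before (- b) (- a) (- xb) (- xa) (mirror_level u') (mirror_level u)"
proof -
  have s: "snd (mirror_level l) = neg (snd l)" for l by (cases l) (simp add: mirror_level_def)
  show ?thesis
    unfolding upper_before_def lower_before_def s lo_neg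
      upper_ends_mirror(2)[OF assms(1,2)] upper_ends_mirror(2)[OF assms(1,3)] hi_neg
    by (auto simp: ereal_minus_less_minus)
qed

lemma prev_upper_mirror:
  assumes ne: "(a, b) \<noteq> (- 1, 1)"
  shows "prev_upper a b xa xb u \<longleftrightarrow> next_lower (- b) (- a) (- xb) (- xa) (mirror_level u)"
proof -
  note U = upper_levels_iff[OF ne] and B = upper_before_mirror[OF ne] and Sa = level_Sa_in[OF ne]
  have "(\<forall>u'\<in>upper_levels a b. upper_before a b xa xb u' (level_Sa a) \<longrightarrow> \<not> upper_before a b xa xb u u') \<longleftrightarrow>
    (\<forall>l'\<in>lower_levels (- b) (- a). lower_before (- b) (- a) (- xb) (- xa) (level_Sb (- a)) l' \<longrightarrow>
      \<not> lower_before (- b) (- a) (- xb) (- xa) l' (mirror_level u))" (is "?l \<longleftrightarrow> ?r")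
    if u: "u \<in> upper_levels a b"
  proof
    assume l: ?l
    show ?r
    proof (intro ballI impI)
      fix l' assume l': "l' \<in> lower_levels (- b) (- a)"
        "lower_before (- b) (- a) (- xb) (- xa) (level_Sb (- a)) l'"
      have m: "mirror_level l' \<in> upper_levels a b" using U l' by simp
      have "upper_before a b xa xb (mirror_level l') (level_Sa a)"
        using l'(2) B[OF m Sa] mirror_level_Sa by simp
      then have "\<not> upper_before a b xa xb u (mirror_level l')" using l m by blast
      then show "\<not> lower_before (- b) (- a) (- xb) (- xa) l' (mirror_level u)"
        using B[OF u m] by simp
    qed
  next
    assume r: ?r
    show ?l
      using r U B[OF _ Sa] B[OF u] mirror_level_Sa by simp
  qed
  then show ?thesis
    unfolding prev_upper_def next_lower_def
    using U[of u] B[of u "level_Sa a"] Sa mirror_level_Sa by auto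
qed

lemma endpoint_equations_iff:
  assumes ne: "(a, b) \<noteq> (- 1, 1)"
  shows "endpoint_equations a b xa xb \<longleftrightarrow> 1 \<le> xa \<and> xb \<le> - 1 \<and>
    next_lower_match a b xa xb \<and> next_lower_match (- b) (- a) (- xb) (- xa)"
proof -
  let ?R = "lower_right (- b) (- a) (- xb) (- xa)" and ?L = "lower_left (- b) (- a) (- xb) (- xa)"
  have "(\<exists>u. prev_upper a b xa xb u \<and> upper_left a b xa xb (level_Sa a) = upper_right a b xa xb u) \<longleftrightarrow>
    next_lower_match (- b) (- a) (- xb) (- xa)"
  proof
    assume "\<exists>u. prev_upper a b xa xb u \<and> upper_left a b xa xb (level_Sa a) = upper_right a b xa xb u"
    then obtain u where u: "prev_upper a b xa xb u"
      "upper_left a b xa xb (level_Sa a) = upper_right a b xa xb u" by blast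
    have um: "u \<in> upper_levels a b" using u(1) by (simp add: prev_upper_def)
    have "?R (level_Sb (- a)) = ?L (mirror_level u)"
      using u(2) upper_ends_mirror(1)[OF ne level_Sa_in[OF ne], of xa xb]
        upper_ends_mirror(2)[OF ne um, of xa xb] mirror_level_Sa by simp
    then show "next_lower_match (- b) (- a) (- xb) (- xa)"
      using u(1) prev_upper_mirror[OF ne] unfolding next_lower_match_def by blast
  next
    assume "next_lower_match (- b) (- a) (- xb) (- xa)"
    then obtain l where l: "next_lower (- b) (- a) (- xb) (- xa) l" "?R (level_Sb (- a)) = ?L l"
      unfolding next_lower_match_def by blast
    then have u: "prev_upper a b xa xb (mirror_level l)" using prev_upper_mirror[OF ne] by simp
    then have um: "mirror_level l \<in> upper_levels a b" by (simp add: prev_upper_def)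
    have "upper_left a b xa xb (level_Sa a) = upper_right a b xa xb (mirror_level l)"
      using l(2) upper_ends_mirror(1)[OF ne level_Sa_in[OF ne], of xa xb]
        upper_ends_mirror(2)[OF ne um, of xa xb] mirror_level_Sa by simp
    with u show "\<exists>u. prev_upper a b xa xb u \<and> upper_left a b xa xb (level_Sa a) = upper_right a b xa xb u"
      by blast
  qed
  then show ?thesis unfolding endpoint_equations_def next_lower_match_def by blast
qed

end

subsection \<open>How the segments of the orbit of a depend on the endpoint\<close>

text \<open>
  The distance of the ends \<open>x + 1\<close> and \<open>x' + 1\<close> of the segment at \<open>T a\<close> in the chart \<open>chi3\<close>.
\<close>

definition gap_dist :: "real \<Rightarrow> real \<Rightarrow> real" where
  "gap_dist x x' = \<bar>1 / (x + 1) - 1 / (x' + 1)\<bar>"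

text \<open>
  The three intervals in which the left end of a transported segment can lie. Its distance in the corresponding chart is
  at most the one at the start.
\<close>

definition lands_negative :: "(rbar \<Rightarrow> rbar) \<Rightarrow> bool" where
  "lands_negative W \<longleftrightarrow> (\<forall>x x'. 1 \<le> x \<longrightarrow> 1 \<le> x' \<longrightarrow> (\<exists>w w'. W (Fin x) = Fin w \<and> W (Fin x') = Fin w' \<and>
     - 1 < w \<and> w < 0 \<and> - 1 < w' \<and> w' < 0 \<and> \<bar>w - w'\<bar> \<le> gap_dist x x'))"

definition lands_positive :: "(rbar \<Rightarrow> rbar) \<Rightarrow> bool" where
  "lands_positive W \<longleftrightarrow> (\<forall>x x'. 1 \<le> x \<longrightarrow> 1 \<le> x' \<longrightarrow> (\<exists>w w'. W (Fin x) = Fin w \<and> W (Fin x') = Fin w' \<and>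
     0 < w \<and> 0 < w' \<and> \<bar>w - w'\<bar> \<le> gap_dist x x'))"

definition lands_above_one :: "(rbar \<Rightarrow> rbar) \<Rightarrow> bool" where
  "lands_above_one W \<longleftrightarrow> (\<forall>x x'. 1 \<le> x \<longrightarrow> 1 \<le> x' \<longrightarrow> (\<exists>w w'. W (Fin x) = Fin w \<and> W (Fin x') = Fin w' \<and>
     1 < w \<and> 1 < w' \<and> \<bar>1 / w - 1 / w'\<bar> \<le> gap_dist x x'))"

lemma lands_negative_S:
  assumes "lands_above_one W"
  shows "lands_negative (S \<circ> W)"
  unfolding lands_negative_def
proof (intro allI impI)
  fix x x' :: real assume "1 \<le> x" "1 \<le> x'"
  then obtain w w' where w: "W (Fin x) = Fin w" "W (Fin x') = Fin w'" "1 < w" "1 < w'"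
    "\<bar>1 / w - 1 / w'\<bar> \<le> gap_dist x x'" using assms unfolding lands_above_one_def by blast
  have "\<bar>- 1 / w - (- 1 / w')\<bar> \<le> gap_dist x x'" using w(5) by (simp add: abs_minus_commute)
  then show "\<exists>v v'. (S \<circ> W) (Fin x) = Fin v \<and> (S \<circ> W) (Fin x') = Fin v' \<and>
     - 1 < v \<and> v < 0 \<and> - 1 < v' \<and> v' < 0 \<and> \<bar>v - v'\<bar> \<le> gap_dist x x'"
    using w(1-4) by (intro exI[of _ "- 1 / w"] exI[of _ "- 1 / w'"]) auto
qed

lemma lands_positive_T:
  assumes "lands_negative W"
  shows "lands_positive (T \<circ> W)"
  unfolding lands_positive_def
proof (intro allI impI)
  fix x x' :: real assume "1 \<le> x" "1 \<le> x'"
  then obtain w w' where w: "W (Fin x) = Fin w" "W (Fin x') = Fin w'" "- 1 < w" "- 1 < w'"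
    "\<bar>w - w'\<bar> \<le> gap_dist x x'" using assms unfolding lands_negative_def by blast
  then show "\<exists>v v'. (T \<circ> W) (Fin x) = Fin v \<and> (T \<circ> W) (Fin x') = Fin v' \<and>
     0 < v \<and> 0 < v' \<and> \<bar>v - v'\<bar> \<le> gap_dist x x'"
    by (intro exI[of _ "w + 1"] exI[of _ "w' + 1"]) auto
qed

lemma inverse_shift_le:
  fixes w w' :: real
  assumes "0 < w" "0 < w'"
  shows "\<bar>1 / (w + 1) - 1 / (w' + 1)\<bar> \<le> \<bar>w - w'\<bar>" "\<bar>1 / (w + 1) - 1 / (w' + 1)\<bar> \<le> \<bar>1 / w - 1 / w'\<bar>"
proof -
  have e: "1 / (w + 1) - 1 / (w' + 1) = (w' - w) / ((w + 1) * (w' + 1))"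
    using assms by (simp add: field_simps)
  have pos: "0 < (w + 1) * (w' + 1)" "0 < w * w'" using assms by simp_all
  have "1 * 1 \<le> (w + 1) * (w' + 1)" using assms by (intro mult_mono) auto
  then have "\<bar>w' - w\<bar> / ((w + 1) * (w' + 1)) \<le> \<bar>w' - w\<bar> / 1"
    using pos by (intro divide_left_mono) auto
  then show "\<bar>1 / (w + 1) - 1 / (w' + 1)\<bar> \<le> \<bar>w - w'\<bar>"
    unfolding e using pos by (simp add: abs_divide abs_minus_commute)
  have e': "1 / w - 1 / w' = (w' - w) / (w * w')" using assms by (simp add: field_simps)
  have "w * w' \<le> (w + 1) * (w' + 1)" using assms by (intro mult_mono) auto
  then have "\<bar>w' - w\<bar> / ((w + 1) * (w' + 1)) \<le> \<bar>w' - w\<bar> / (w * w')"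
    using pos by (intro divide_left_mono) auto
  then show "\<bar>1 / (w + 1) - 1 / (w' + 1)\<bar> \<le> \<bar>1 / w - 1 / w'\<bar>"
    unfolding e e' using pos by (simp add: abs_divide)
qed

lemma lands_above_one_T:
  assumes "lands_positive W \<or> lands_above_one W"
  shows "lands_above_one (T \<circ> W)"
  unfolding lands_above_one_def
proof (intro allI impI)
  fix x x' :: real assume x: "1 \<le> x" "1 \<le> x'"
  have "\<exists>w w'. W (Fin x) = Fin w \<and> W (Fin x') = Fin w' \<and> 0 < w \<and> 0 < w' \<and>
      \<bar>1 / (w + 1) - 1 / (w' + 1)\<bar> \<le> gap_dist x x'"
    using assms
  proof
    assume "lands_positive W"
    then obtain w w' where w: "W (Fin x) = Fin w" "W (Fin x') = Fin w'" "0 < w" "0 < w'"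
      "\<bar>w - w'\<bar> \<le> gap_dist x x'" using x unfolding lands_positive_def by blast
    then show ?thesis using order.trans[OF inverse_shift_le(1)[OF w(3,4)] w(5)] by blast
  next
    assume "lands_above_one W"
    then obtain w w' where w: "W (Fin x) = Fin w" "W (Fin x') = Fin w'" "1 < w" "1 < w'"
      "\<bar>1 / w - 1 / w'\<bar> \<le> gap_dist x x'" using x unfolding lands_above_one_def by blast
    have p: "0 < w" "0 < w'" using w by auto
    then show ?thesis using w order.trans[OF inverse_shift_le(2)[OF p] w(5)] by blast
  qed
  then obtain w w' where w: "W (Fin x) = Fin w" "W (Fin x') = Fin w'" "0 < w" "0 < w'"
      "\<bar>1 / (w + 1) - 1 / (w' + 1)\<bar> \<le> gap_dist x x'" by blast
  then show "\<exists>v v'. (T \<circ> W) (Fin x) = Fin v \<and> (T \<circ> W) (Fin x') = Fin v' \<and>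
     1 < v \<and> 1 < v' \<and> \<bar>1 / v - 1 / v'\<bar> \<le> gap_dist x x'"
    by (intro exI[of _ "w + 1"] exI[of _ "w' + 1"]) auto
qed

context ab
begin

text \<open>
  Levels reached by \<open>S\<close> lie at or below \<open>S b\<close> and have negative ends; levels reached by \<open>T\<close> lie at or above \<open>S b\<close> and have
  positive ends. The bound \<open>t < -1\<close> in the first case keeps \<open>S\<close> from being applied to an end below \<open>1\<close>.
\<close>

lemma a_walk_form:
  assumes "live a b At_a k" "lower_orbit a b At_a k = Fin t"
  shows "lands_negative (lower_walk a b At_a k) \<and> t \<le> - 1 / b \<and> t < - 1 \<or>
    (lands_positive (lower_walk a b At_a k) \<or> lands_above_one (lower_walk a b At_a k)) \<and> - 1 / b \<le> t \<and>
    (0 < t \<longrightarrow> lands_above_one (lower_walk a b At_a k))"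
  using assms
proof (induction k arbitrary: t)
  case 0
  have "lands_above_one T" unfolding lands_above_one_def gap_dist_def
  proof (intro allI impI)
    fix x x' :: real assume "1 \<le> x" "1 \<le> x'"
    then show "\<exists>w w'. T (Fin x) = Fin w \<and> T (Fin x') = Fin w' \<and> 1 < w \<and> 1 < w' \<and>
      \<bar>1 / w - 1 / w'\<bar> \<le> \<bar>1 / (x + 1) - 1 / (x' + 1)\<bar>"
      by (intro exI[of _ "x + 1"] exI[of _ "x' + 1"]) auto
  qed
  then show ?case using 0 lower_start(1) Sb_less_a1 by (auto simp: lower_walk_0)
next
  case (Suc k)
  have lk: "live a b At_a k" and st: "steppable a b (lower_orbit a b At_a k)"
    using Suc.prems by (auto simp: live_Suc)
  obtain u where u: "lower_orbit a b At_a k = Fin u" "u \<le> a + 1" using live_Fin[OF lk] by blast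
  note IH = Suc.IH[OF lk u(1)]
  show ?case using st
  proof (cases rule: steppable_cases)
    case (S v)
    then have v: "v = u" "0 < u" "u \<le> b" using u by auto
    then have "\<not> u \<le> - 1 / b" using Sb_neg by linarith
    then have "lands_above_one (lower_walk a b At_a k)" using IH v by blast
    moreover have "lower_walk a b At_a (Suc k) = S \<circ> lower_walk a b At_a k"
      unfolding lower_walk_Suc S(4) ..
    ultimately have "lands_negative (lower_walk a b At_a (Suc k))" using lands_negative_S by metis
    moreover have t: "t = - 1 / u"
      using Suc.prems(2) S v by (simp add: lower_orbit_Suc del: rho_low.simps)
    moreover have "t \<le> - 1 / b" unfolding t using v by (simp add: field_simps)
    moreover have "t < - 1" unfolding t using v u(2) a_neg by (simp add: field_simps)
    ultimately show ?thesis by blast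
  next
    case (T v)
    then have v: "- 1 / b - 1 \<le> u" using u by auto
    have t: "t = u + 1" using Suc.prems(2) T u by (simp add: lower_orbit_Suc del: rho_low.simps)
    have w: "lower_walk a b At_a (Suc k) = T \<circ> lower_walk a b At_a k"
      unfolding lower_walk_Suc T(4) ..
    have ge: "- 1 / b \<le> t" using v t by linarith
    from IH show ?thesis
    proof
      assume A: "lands_negative (lower_walk a b At_a k) \<and> u \<le> - 1 / b \<and> u < - 1"
      then have "lands_positive (lower_walk a b At_a (Suc k))" unfolding w by (intro lands_positive_T) simp
      moreover have "\<not> 0 < t" using A t by linarith
      ultimately show ?thesis using ge by blast
    next
      assume A: "(lands_positive (lower_walk a b At_a k) \<or> lands_above_one (lower_walk a b At_a k)) \<and> - 1 / b \<le> u \<and>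
        (0 < u \<longrightarrow> lands_above_one (lower_walk a b At_a k))"
      then have "lands_above_one (lower_walk a b At_a (Suc k))" unfolding w by (intro lands_above_one_T) simp
      then show ?thesis using ge by blast
    qed
  qed
qed

text \<open>
  The orbit of \<open>a\<close> arrives at \<open>S b\<close> by \<open>S\<close> with a negative left end and by \<open>T\<close> with a positive one, whatever the
  endpoints are; the segment of \<open>b\<close> starts at \<open>0\<close>.
\<close>

lemma level_right_of_Sb:
  assumes v: "visits a b c y" and before: "lower_before a b xa xb (level_Sb b) (c, y)" and xa: "1 \<le> xa"
  shows "\<And>xa' xb'. 1 \<le> xa' \<Longrightarrow> lower_before a b xa' xb' (level_Sb b) (c, y)"
    "c = At_a \<Longrightarrow> lands_positive (lower_map a b (c, y)) \<or> lands_above_one (lower_map a b (c, y))"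
    "c = At_b \<Longrightarrow> lo (Fin (- 1 / b)) < lo y"
proof -
  have Sb: "level_Sb b = (At_b, Fin (- 1 / b))" using b_pos by (simp add: level_Sb_def)
  have left: "lower_left a b xa xb (level_Sb b) = Fin 0" for xa xb
    using lower_map_start(2) by (simp add: Sb lower_left_def del: divide_minus_left)
  have bf: "lower_before a b xa xb (level_Sb b) (c, y) \<longleftrightarrow> lo (Fin (- 1 / b)) < lo y \<or>
    y = Fin (- 1 / b) \<and> 0 < lo (lower_left a b xa xb (c, y))" for xa xb
    unfolding lower_before_def left by (auto simp: Sb zero_ereal_def)
  obtain t where t: "y = Fin t" using visits_Fin[OF v] by blast
  show bb: "c = At_b \<Longrightarrow> lo (Fin (- 1 / b)) < lo y"
  proof (rule ccontr)
    assume A: "c = At_b" "\<not> lo (Fin (- 1 / b)) < lo y"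
    then have "(c, y) = level_Sb b" "0 < lo (lower_left a b xa xb (c, y))" using before Sb unfolding bf by auto
    then show False using left by (simp add: zero_ereal_def)
  qed
  have form: "lands_positive (lower_map a b (c, y)) \<or> lands_above_one (lower_map a b (c, y))" if c: "c = At_a"
  proof (rule ccontr)
    assume "\<not> ?thesis"
    then have f: "lands_negative (lower_map a b (c, y))" "t \<le> - 1 / b"
      using a_walk_form[OF visits_first[OF v[unfolded c t]]] unfolding c t lower_map_eq by blast+
    then have "0 < lo (lower_left a b xa xb (c, y))" using before t unfolding bf by auto
    moreover obtain w where "lower_map a b (c, y) (Fin xa) = Fin w" "w < 0"
      using f(1) xa unfolding lands_negative_def by blast
    ultimately show False using c by (simp add: lower_left_def)
  qed
  then show "c = At_a \<Longrightarrow> lands_positive (lower_map a b (c, y)) \<or> lands_above_one (lower_map a b (c, y))" .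
  show "lower_before a b xa' xb' (level_Sb b) (c, y)" if "1 \<le> xa'" for xa' xb'
  proof (cases c)
    case At_b
    then show ?thesis using bb bf by blast
  next
    case At_a
    then obtain w where "lower_map a b (c, y) (Fin xa') = Fin w" "0 < w"
      using form \<open>1 \<le> xa'\<close> unfolding lands_positive_def lands_above_one_def by (meson less_trans zero_less_one)
    then have "0 < lo (lower_left a b xa' xb' (c, y))" using At_a by (simp add: lower_left_def)
    then show ?thesis using before unfolding bf by blast
  qed
qed

text \<open>
  The level next to \<open>S b\<close> has the same value for both pairs, but the choice between an orbit of \<open>a\<close> and an orbit of \<open>b\<close> may differ. In
  each case the left end is a minimum of a contracting function of \<open>xa\<close> and a constant.
\<close>

lemma next_lower_match_contracts:
  assumes ne: "(a, b) \<noteq> (- 1, 1)"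
    and M: "next_lower_match a b xa xb" "next_lower_match a b xa' xb'"
    and x: "1 \<le> xa" "xb \<le> - 1" "1 \<le> xa'" "xb' \<le> - 1"
  shows "\<bar>1 / xb - 1 / xb'\<bar> \<le> gap_dist xa xa'"
proof -
  have one: "- 1 / xb' - (- 1 / xb) \<le> gap_dist xa xa'"
    if M: "next_lower_match a b xa xb" "next_lower_match a b xa' xb'"
      and x: "1 \<le> xa" "xb \<le> - 1" "1 \<le> xa'" "xb' \<le> - 1" for xa xb xa' xb'
  proof -
    obtain c y where l: "next_lower a b xa xb (c, y)"
      "lower_right a b xa xb (level_Sb b) = lower_left a b xa xb (c, y)"
      using M(1) unfolding next_lower_match_def by (metis surj_pair)
    obtain c' y' where l': "next_lower a b xa' xb' (c', y')"
      "lower_right a b xa' xb' (level_Sb b) = lower_left a b xa' xb' (c', y')"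
      using M(2) unfolding next_lower_match_def by (metis surj_pair)
    have Sb: "level_Sb b = (At_b, Fin (- 1 / b))" using b_pos by (simp add: level_Sb_def)
    have right: "lower_right a b xa xb (level_Sb b) = Fin (- 1 / xb)" if "xb \<le> - 1" for xa xb
      using lower_map_start(2) that by (simp add: Sb lower_right_def del: divide_minus_left)
    have lev: "(c, y) \<in> lower_levels a b" "(c', y') \<in> lower_levels a b"
      using l(1) l'(1) by (auto simp: next_lower_def)
    then have v: "visits a b c y" "visits a b c' y'" using lower_levels_iff[OF ne] by auto
    have bf: "lower_before a b xa xb (level_Sb b) (c, y)" "lower_before a b xa' xb' (level_Sb b) (c', y')"
      using l(1) l'(1) by (auto simp: next_lower_def)
    note R = level_right_of_Sb[OF v(1) bf(1) x(1)] and R' = level_right_of_Sb[OF v(2) bf(2) x(3)]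
    have min: "\<not> lower_before a b xa xb (c', y') (c, y)" "\<not> lower_before a b xa' xb' (c, y) (c', y')"
      using l(1) l'(1) lev R(1)[OF x(3)] R'(1)[OF x(1)] unfolding next_lower_def by blast+
    have "lo y = lo y'" using min by (auto simp: lower_before_def)
    then have yy: "y' = y" by (simp add: lo_inj)
    have le: "lo (lower_left a b xa' xb' (c', y)) \<le> lo (lower_left a b xa' xb' (c, y))"
      using min(2) yy by (auto simp: lower_before_def)
    have e: "lower_left a b xa xb (c, y) = Fin (- 1 / xb)" "lower_left a b xa' xb' (c', y) = Fin (- 1 / xb')"
      using l(2) l'(2) right x yy by auto
    have dist: "0 \<le> gap_dist xa xa'" by (simp add: gap_dist_def)
    show ?thesis
    proof (cases c)
      case At_b
      then have "lower_left a b xa' xb' (c, y) = Fin (- 1 / xb)" using e(1) by (simp add: lower_left_def)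
      then have "- 1 / xb' \<le> - 1 / xb" using le e(2) by simp
      then show ?thesis using dist by linarith
    next
      case At_a
      have small: "- 1 / xb \<le> 1" using x by (simp add: field_simps)
      have "\<not> lands_above_one (lower_map a b (c, y))"
      proof
        assume "lands_above_one (lower_map a b (c, y))"
        then obtain w where "lower_map a b (c, y) (Fin xa) = Fin w" "1 < w"
          using x unfolding lands_above_one_def by blast
        then show False using e(1) At_a small by (simp add: lower_left_def)
      qed
      then have "lands_positive (lower_map a b (c, y))" using R(2) At_a by blast
      then obtain w w' where w: "lower_map a b (c, y) (Fin xa) = Fin w"
        "lower_map a b (c, y) (Fin xa') = Fin w'" "\<bar>w - w'\<bar> \<le> gap_dist xa xa'"
        using x unfolding lands_positive_def by blast
      then have "w = - 1 / xb" "- 1 / xb' \<le> w'" using e le At_a by (auto simp: lower_left_def)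
      then show ?thesis using w(3) by linarith
    qed
  qed
  have "gap_dist xa' xa = gap_dist xa xa'" by (simp add: gap_dist_def abs_minus_commute)
  then show ?thesis using one[OF M x] one[OF M(2,1) x(3,4,1,2)] by (simp add: abs_le_iff)
qed

text \<open>
  Composed, the two equations would strictly decrease the distance of two solutions.
\<close>

lemma endpoints_unique:
  assumes ne: "(a, b) \<noteq> (- 1, 1)"
    and E: "endpoint_equations a b xa xb" "endpoint_equations a b xa' xb'"
  shows "xa = xa' \<and> xb = xb'"
proof -
  interpret m: ab "- b" "- a" by (rule mirror)
  have ne': "(- b, - a) \<noteq> (- 1, 1)" using ne by auto
  note E1 = E(1)[unfolded endpoint_equations_iff[OF ne]] and E2 = E(2)[unfolded endpoint_equations_iff[OF ne]]
  have x: "1 \<le> xa" "xb \<le> - 1" "1 \<le> xa'" "xb' \<le> - 1" using E1 E2 by auto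
  have 1: "\<bar>1 / xb - 1 / xb'\<bar> \<le> gap_dist xa xa'"
    using next_lower_match_contracts[OF ne] E1 E2 by blast
  have "\<bar>1 / (- xa) - 1 / (- xa')\<bar> \<le> gap_dist (- xb) (- xb')"
    by (rule m.next_lower_match_contracts[OF ne']) (use E1 E2 x in auto)
  then have 2: "\<bar>1 / xa - 1 / xa'\<bar> \<le> gap_dist (- xb) (- xb')" by (simp add: abs_minus_commute)
  have strict: "gap_dist x x' < \<bar>1 / x - 1 / x'\<bar>" if "1 \<le> x" "1 \<le> x'" "x \<noteq> x'" for x x'
  proof -
    have p: "0 < x" "0 < x'" using that by auto
    have "1 / (x + 1) - 1 / (x' + 1) = (x' - x) / ((x + 1) * (x' + 1))"
      "1 / x - 1 / x' = (x' - x) / (x * x')" using p by (simp_all add: field_simps)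
    moreover have "\<bar>x' - x\<bar> / ((x + 1) * (x' + 1)) < \<bar>x' - x\<bar> / (x * x')"
      using p that by (intro divide_strict_left_mono mult_strict_mono) auto
    ultimately show ?thesis using p by (simp add: gap_dist_def abs_divide abs_mult)
  qed
  have "\<bar>1 / (- xb) - 1 / (- xb')\<bar> = \<bar>1 / xb - 1 / xb'\<bar>" by (simp add: abs_minus_commute)
  note S = strict[OF x(1,3)] strict[of "- xb" "- xb'", unfolded this]
  show ?thesis
  proof (rule ccontr)
    assume "\<not> ?thesis"
    then consider "xa \<noteq> xa'" "xb \<noteq> xb'" | "xa \<noteq> xa'" "xb = xb'" | "xa = xa'" "xb \<noteq> xb'" by blast
    then show False
    proof cases
      case 1
      then show ?thesis using \<open>\<bar>1 / xb - 1 / xb'\<bar> \<le> gap_dist xa xa'\<close> 2 S x by force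
    next
      case 2
      then show ?thesis using \<open>\<bar>1 / xa - 1 / xa'\<bar> \<le> gap_dist (- xb) (- xb')\<close> x by (auto simp: gap_dist_def)
    next
      case 3
      then show ?thesis using 1 x by (auto simp: gap_dist_def)
    qed
  qed
qed

subsection \<open>The endpoint equations have a solution\<close>

lemma ray_left_least:
  assumes "xb < 0" "u \<in> ray xa xb c"
  shows "hi (lower_walk a b c 0 (ray_left xa xb c)) \<le> hi (lower_walk a b c 0 u)"
proof (cases c)
  case At_a
  then show ?thesis using assms by (simp add: ray_a_iff lower_walk_0 hi_T_le_iff[of "Fin xa", simplified])
next
  case At_b
  then show ?thesis using assms lo_le_iff_S[OF assms(1), of u] by (simp add: ray_b_iff lower_walk_0 zero_ereal_def)
qed

lemma lower_left_least:
  assumes g: "ray_ends a b xa xb" and v: "visits a b c (Fin t)" and u: "u \<in> ray xa xb c"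
  shows "hi (lower_left a b xa xb (c, Fin t)) \<le> hi (lower_map a b (c, Fin t) u)"
proof -
  obtain t0 where t0: "lower_orbit a b c 0 = Fin t0" using live_Fin[of c 0] by auto
  have xb: "xb < 0" using g by (simp add: ray_ends_def)
  have "lower_walk a b c 0 ` ray xa xb c \<subseteq> jump a b t0"
    using ray_ends_seg_subset_jump[OF g live_0 t0] .
  from seg_order[OF this t0 visits_first(1)[OF v] ray_left_in u] ray_left_least[OF xb u]
  show ?thesis by (simp add: lower_left_def lower_map_eq)
qed

lemma lower_left_in_jump:
  assumes "ray_ends a b xa xb" "visits a b c (Fin t)"
  shows "lower_left a b xa xb (c, Fin t) \<in> jump a b t"
  using ray_ends_seg_subset_jump[OF assms(1) visits_first[OF assms(2)]] ray_left_in
  by (auto simp: lower_left_def lower_map_eq)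

lemma lower_left_finite:
  assumes g: "ray_ends a b xa xb" and v: "visits a b c (Fin t)"
  shows "lower_left a b xa xb (c, Fin t) \<noteq> Infty"
proof
  assume inf: "lower_left a b xa xb (c, Fin t) = Infty"
  define u where "u = ray_right xa xb c"
  have u: "u \<in> ray xa xb c" "u \<noteq> ray_left xa xb c"
    by (cases c; auto simp: u_def ray_a_iff ray_b_iff)+
  have "hi (lower_map a b (c, Fin t) u) = \<infinity>"
    using lower_left_least[OF g v u(1)] inf by simp
  then have "lower_map a b (c, Fin t) u = lower_left a b xa xb (c, Fin t)"
    using inf hi_inj[of "lower_map a b (c, Fin t) u" Infty] by simp
  then show False using u(2) by (simp add: lower_left_def lower_map_eq lower_walk_inj)
qed

text \<open>
  In the exceptional case the segment of \<open>a\<close> at \<open>S b\<close> itself comes next. Otherwise the wall is constant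
  from \<open>S b\<close> to the next live value \<open>y\<close>, and some segment at \<open>y\<close> starts where the wall arrives.
\<close>

lemma next_lower_match_exists:
  assumes ne: "(a, b) \<noteq> (- 1, 1)" and fin: "finite (live_values a b)" and g: "ray_ends a b xa xb"
  shows "next_lower_match a b xa xb"
proof -
  have x: "1 \<le> xa" "xb \<le> - 1" using g by (auto simp: ray_ends_def)
  have Sb: "level_Sb b = (At_b, Fin (- 1 / b))" using b_pos by (simp add: level_Sb_def)
  have left: "lower_left a b xa xb (level_Sb b) = Fin 0"
    using lower_map_start(2) by (simp add: Sb lower_left_def del: divide_minus_left)
  have right: "lower_right a b xa xb (level_Sb b) = S (Fin xb)"
    using lower_map_start(2) by (simp add: Sb lower_right_def del: divide_minus_left)
  have bf: "lower_before a b xa xb (level_Sb b) (c, Fin t) \<longleftrightarrow> - 1 / b < t \<or>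
    t = - 1 / b \<and> 0 < lo (lower_left a b xa xb (c, Fin t))" for c t
    unfolding lower_before_def left by (auto simp: Sb zero_ereal_def)
  note lev = lower_levels_iff[OF ne]
  show ?thesis
  proof (cases "a_meets_Sb a b")
    case True
    let ?l = "(At_a, Fin (- 1 / b))"
    have v: "visits a b At_a (Fin (- 1 / b))" using True by (simp add: a_meets_Sb_def)
    have ll: "lower_left a b xa xb ?l = S (Fin xb)" using True g by (simp add: ray_ends_def lower_left_def)
    have pos: "0 < lo (S (Fin xb))" using x by (simp add: zero_less_divide_iff)
    have "next_lower a b xa xb ?l"
      unfolding next_lower_def
    proof (intro conjI ballI impI)
      show "?l \<in> lower_levels a b" using v lev by simp
      show "lower_before a b xa xb (level_Sb b) ?l" unfolding bf ll using pos by simp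
      fix l' assume l': "l' \<in> lower_levels a b" "lower_before a b xa xb (level_Sb b) l'"
      obtain c t where ct: "l' = (c, Fin t)" using l'(1) lev visits_Fin by (metis prod.collapse)
      show "\<not> lower_before a b xa xb l' ?l"
      proof
        assume B: "lower_before a b xa xb l' ?l"
        then have t: "t = - 1 / b" using l'(2) unfolding ct bf by (auto simp: lower_before_def)
        then have "c = At_a" using l'(2) left Sb unfolding ct bf by (cases c) (auto simp: zero_ereal_def)
        then show False using B ct t by (simp add: lower_before_def)
      qed
    qed
    then show ?thesis unfolding next_lower_match_def using right ll by metis
  next
    case False
    then have lS: "lwall a b True (- 1 / b) = S (Fin xb)" using g by (simp add: ray_ends_def)
    have noSb: "- 1 / b < t" if "visits a b c (Fin t)" "lower_before a b xa xb (level_Sb b) (c, Fin t)" for c t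
    proof (rule ccontr)
      assume "\<not> - 1 / b < t"
      then have t: "t = - 1 / b" and p: "0 < lo (lower_left a b xa xb (c, Fin t))"
        using that(2) unfolding bf by auto
      have c: "c = At_a" using level_right_of_Sb(3)[OF that x(1)] t by (cases c) auto
      then have nb: "\<not> a + 1 < b" using False that(1) t by (simp add: a_meets_Sb_def)
      then have b1: "b = a + 1" using gap by simp
      \<comment> \<open>then the orbit of \<open>a\<close> starts \<open>b, S b\<close>, and its segment at \<open>S b\<close> is negative\<close>
      have rb: "rho_low a b (Fin b) = S" using rho_low_S b_pos by blast
      have w1: "lower_walk a b At_a 1 = S \<circ> T"
        using lower_walk_Suc[of a b At_a 0] lower_start(1) b1 rb by (simp add: lower_walk_0 del: rho_low.simps)
      have o1: "lower_orbit a b At_a 1 = Fin (- 1 / b)"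
        using lower_orbit_Suc[of a b At_a 0] lower_start(1) b1 rb b_pos by (simp del: rho_low.simps)
      have "first_visit a b At_a (Fin (- 1 / b)) \<noteq> 0"
        using first_visit_orbit[OF o1] lower_start(1) Sb_less_a1 by (metis less_irrefl rbar.inject)
      then have "first_visit a b At_a (Fin (- 1 / b)) = 1" using first_visit_le[OF o1] by linarith
      then have "lower_left a b xa xb (c, Fin t) = S (T (Fin xa))"
        using c t w1 by (simp add: lower_left_def lower_map_eq)
      then show False using p x by (simp add: zero_less_divide_iff)
    qed
    define Y where "Y = {t \<in> live_values a b. - 1 / b < t}"
    have Y: "finite Y" "Y \<noteq> {}" using fin live_values_start(1) Sb_less_a1 by (auto simp: Y_def)
    define y where "y = Min Y"
    have yY: "y \<in> Y" and ymin: "\<And>t. t \<in> Y \<Longrightarrow> y \<le> t" using Y by (auto simp: y_def)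
    have wall: "lwall a b True (- 1 / b) = lwall a b False y"
    proof (rule lwall_const)
      show "\<not> (- 1 / b < c \<and> c < y)" if "c \<in> live_values a b" for c
        using ymin[of c] that by (auto simp: Y_def)
    qed (use yY in \<open>auto simp: Y_def\<close>)
    obtain c0 where c0: "visits a b c0 (Fin y)" using yY by (auto simp: Y_def live_values_def)
    have "covered xa xb y" using covered_all[OF ray_ends_covered[OF g] c0] .
    moreover have "lwall a b False y \<in> jump a b y" using lwall_sides by (simp add: jump_def arc_def)
    ultimately obtain c u where cu: "visits a b c (Fin y)" "u \<in> ray xa xb c"
      "lwall a b False y = lower_map a b (c, Fin y) u"
      unfolding covered_def by blast
    have "hi (lower_left a b xa xb (c, Fin y)) \<le> hi (lwall a b False y)"
      using lower_left_least[OF g cu(1,2)] cu(3) by simp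
    moreover have low: "hi (lwall a b False y) \<le> hi (lower_left a b xa xb (c', Fin y))"
      if "visits a b c' (Fin y)" for c'
      using lower_left_in_jump[OF g that] by (simp add: jump_def arc_def)
    ultimately have "hi (lower_left a b xa xb (c, Fin y)) = hi (lwall a b False y)"
      using cu(1) by (simp add: order.antisym)
    then have ll: "lower_left a b xa xb (c, Fin y) = lwall a b False y" by (simp add: hi_inj)
    have "next_lower a b xa xb (c, Fin y)"
      unfolding next_lower_def
    proof (intro conjI ballI impI)
      show "(c, Fin y) \<in> lower_levels a b" using cu(1) lev by simp
      show "lower_before a b xa xb (level_Sb b) (c, Fin y)" unfolding bf using yY by (simp add: Y_def)
      fix l' assume l': "l' \<in> lower_levels a b" "lower_before a b xa xb (level_Sb b) l'"
      obtain c' t where ct: "l' = (c', Fin t)" using l'(1) lev visits_Fin by (metis prod.collapse)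
      then have v': "visits a b c' (Fin t)" using l'(1) lev by simp
      then have "t \<in> Y" using noSb l'(2) ct by (auto simp: Y_def live_values_def)
      then have yt: "y \<le> t" by (rule ymin)
      show "\<not> lower_before a b xa xb l' (c, Fin y)"
      proof
        assume B: "lower_before a b xa xb l' (c, Fin y)"
        then have "t = y" "lo (lower_left a b xa xb (c', Fin t)) < lo (lower_left a b xa xb (c, Fin y))"
          using yt unfolding ct lower_before_def by auto
        then have "hi (lower_left a b xa xb (c', Fin y)) < hi (lower_left a b xa xb (c, Fin y))"
          using lo_eq_hi[OF lower_left_finite[OF g cu(1)]] lo_eq_hi[OF lower_left_finite[OF g v']] by simp
        then show False using low[of c'] v' \<open>t = y\<close> ll by simp
      qed
    qed
    then show ?thesis unfolding next_lower_match_def using right ll wall lS by metis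
  qed
qed

lemma live_values_subset:
  assumes "(a, b) \<noteq> (- 1, 1)"
  shows "Fin ` live_values a b \<subseteq> (\<Union>c. lower_trunc a b c)"
proof
  fix z assume "z \<in> Fin ` live_values a b"
  then obtain c n where n: "live a b c n" "lower_orbit a b c n = z"
    by (auto simp: live_values_def visits_def)
  then have "z \<in> lower_trunc a b c" unfolding trunc_eq(2)[OF assms] by blast
  then show "z \<in> (\<Union>c. lower_trunc a b c)" by blast
qed

lemma finite_live_values:
  assumes "(a, b) \<noteq> (- 1, 1)" "finiteness_condition a b"
  shows "finite (live_values a b)" "finite (live_values (- b) (- a))"
proof -
  interpret m: ab "- b" "- a" by (rule mirror)
  have ne': "(- b, - a) \<noteq> (- 1, 1)" using assms(1) by auto
  have U: "UNIV = {At_a, At_b}" using disc.exhaust by auto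
  have "finite (\<Union>c. lower_trunc a b c)"
    unfolding U using assms(2) by (auto simp: finiteness_condition_def)
  then have "finite (Fin ` live_values a b)" using live_values_subset[OF assms(1)] finite_subset by blast
  then show "finite (live_values a b)" by (rule finite_imageD) (auto simp: inj_on_def)
  have sub: "Fin ` live_values (- b) (- a) \<subseteq> neg ` (\<Union>c. upper_trunc a b c)"
  proof
    fix z assume "z \<in> Fin ` live_values (- b) (- a)"
    then obtain c n where n: "live (- b) (- a) c n" "lower_orbit (- b) (- a) c n = z"
      by (auto simp: live_values_def visits_def)
    then have "upper_orbit a b (swap c) n = neg z" using upper_walk_mirror(2)[of "swap c" n] by simp
    moreover have "ulive a b (swap c) n" using n(1) by simp
    ultimately have "neg z \<in> upper_trunc a b (swap c)" unfolding trunc_eq(1)[OF assms(1)] by (metis imageI mem_Collect_eq)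
    then show "z \<in> neg ` (\<Union>c. upper_trunc a b c)" by (metis UN_I UNIV_I imageI neg_neg)
  qed
  have "finite (neg ` (\<Union>c. upper_trunc a b c))"
    unfolding U using assms(2) by (auto simp: finiteness_condition_def)
  then have "finite (Fin ` live_values (- b) (- a))" using sub finite_subset by blast
  then show "finite (live_values (- b) (- a))" by (rule finite_imageD) (auto simp: inj_on_def)
qed

lemma x_ab_good:
  assumes ne: "(a, b) \<noteq> (- 1, 1)" and fin: "finiteness_condition a b"
  shows "\<exists>xa xb. x_ab a b = (xa, xb) \<and> ray_ends a b xa xb \<and> ray_ends (- b) (- a) (- xb) (- xa)"
proof -
  interpret m: ab "- b" "- a" by (rule mirror)
  have ne': "(- b, - a) \<noteq> (- 1, 1)" using ne by auto
  obtain xa xb where g: "ray_ends a b xa xb" "ray_ends (- b) (- a) (- xb) (- xa)"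
    using ray_ends_both_exists[OF ne] by blast
  have "endpoint_equations a b xa xb"
    unfolding endpoint_equations_iff[OF ne]
    using next_lower_match_exists[OF ne finite_live_values(1)[OF assms] g(1)]
      m.next_lower_match_exists[OF ne' finite_live_values(2)[OF assms] g(2)] g(1)
    by (auto simp: ray_ends_def)
  then have "x_ab a b = (xa, xb)"
    unfolding x_ab_def using endpoints_unique[OF ne] by (intro the_equality) auto
  with g show ?thesis by blast
qed

section \<open>The rectangular set is the closed region between the walls\<close>

text \<open>
  Between two live values the wall is constant, so the segments above \<open>t\<close> fill everything from the wall at
  \<open>t\<close> to infinity.
\<close>

lemma covered_row:
  assumes fin: "finite (live_values a b)" and g: "ray_ends a b xa xb"
  shows "(\<exists>c s. visits a b c (Fin s) \<and> t \<le> s \<and> x \<in> lower_seg a b xa xb (c, Fin s)) \<longleftrightarrow>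
    low_row a b False t x"
proof
  assume "\<exists>c s. visits a b c (Fin s) \<and> t \<le> s \<and> x \<in> lower_seg a b xa xb (c, Fin s)"
  then obtain c s where cs: "visits a b c (Fin s)" "t \<le> s" "x \<in> lower_seg a b xa xb (c, Fin s)" by blast
  have "x \<in> jump a b s"
    using ray_ends_seg_subset_jump[OF g visits_first[OF cs(1)]] cs(3) by (auto simp: lower_seg_def lower_map_eq)
  then have "hi (lwall a b False s) \<le> hi x" by (simp add: jump_def arc_def)
  moreover have "hi (lwall a b False t) \<le> hi (lwall a b False s)"
    using cs(2) by (intro lwall_mono) (auto simp: precedes_def)
  moreover have "t \<le> a + 1" using cs visits_Fin by force
  ultimately show "low_row a b False t x" by (auto simp: low_row_def below_def)
next
  assume "low_row a b False t x"
  then have t: "t \<le> a + 1" and x: "hi (lwall a b False t) \<le> hi x" by (auto simp: low_row_def below_def)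
  define A where "A = {c \<in> live_values a b. t \<le> c \<and> hi x \<le> hi (lwall a b True c)}"
  have "lwall a b True (a + 1) = Infty" by (rule lwall_top) (simp add: below_def)
  then have A: "finite A" "A \<noteq> {}" using fin live_values_start(1) t by (auto simp: A_def)
  define s where "s = Min A"
  have sA: "s \<in> A" and smin: "\<And>c. c \<in> A \<Longrightarrow> s \<le> c" using A by (auto simp: s_def)
  have "hi (lwall a b False s) \<le> hi x"
  proof (cases "\<exists>c\<in>live_values a b. t \<le> c \<and> c < s")
    case False
    then have "lwall a b False t = lwall a b False s"
      using sA by (cases "t = s") (auto simp: A_def intro!: lwall_const)
    then show ?thesis using x by simp
  next
    case True
    define B where "B = {c \<in> live_values a b. t \<le> c \<and> c < s}"
    have B: "finite B" "B \<noteq> {}" using True fin by (auto simp: B_def)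
    define c where "c = Max B"
    have cB: "c \<in> B" and cmax: "\<And>d. d \<in> B \<Longrightarrow> d \<le> c" using B by (auto simp: c_def)
    have "lwall a b True c = lwall a b False s"
    proof (rule lwall_const)
      show "\<not> (c < d \<and> d < s)" if "d \<in> live_values a b" for d
        using cmax[of d] that cB by (auto simp: B_def)
    qed (use cB in \<open>auto simp: B_def\<close>)
    moreover have "\<not> hi x \<le> hi (lwall a b True c)" using smin[of c] cB by (auto simp: A_def B_def)
    ultimately show ?thesis by simp
  qed
  then have "x \<in> jump a b s" using sA by (simp add: jump_def arc_def A_def)
  moreover obtain c0 where "visits a b c0 (Fin s)" using sA by (auto simp: A_def live_values_def)
  ultimately have "x \<in> (\<Union>c\<in>{c. visits a b c (Fin s)}. lower_map a b (c, Fin s) ` ray xa xb c)"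
    using covered_all[OF ray_ends_covered[OF g]] unfolding covered_def by blast
  then show "\<exists>c s. visits a b c (Fin s) \<and> t \<le> s \<and> x \<in> lower_seg a b xa xb (c, Fin s)"
    using sA by (auto simp: lower_seg_def A_def)
qed

lemma A_lower_iff:
  assumes ne: "(a, b) \<noteq> (- 1, 1)" and fin: "finiteness_condition a b"
  shows "(x, Fin t) \<in> A_lower a b \<longleftrightarrow> low_row a b False t x"
    "low_row a b False t x \<Longrightarrow> (x, Infty) \<in> A_lower a b"
proof -
  obtain xa xb where X: "x_ab a b = (xa, xb)" "ray_ends a b xa xb" using x_ab_good[OF assms] by blast
  have A: "(x, y) \<in> A_lower a b \<longleftrightarrow> (\<exists>c s. visits a b c (Fin s) \<and> y \<in> ivl (- \<infinity>) (ereal s) \<and>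
      x \<in> lower_seg a b xa xb (c, Fin s))" for y
  proof -
    have "(x, y) \<in> A_lower a b \<longleftrightarrow> (\<exists>l\<in>lower_levels a b. x \<in> lower_seg a b xa xb l \<and> y \<in> ivl (- \<infinity>) (lo (snd l)))"
      unfolding A_lower_def X by simp
    also have "\<dots> \<longleftrightarrow> (\<exists>c s. visits a b c (Fin s) \<and> y \<in> ivl (- \<infinity>) (ereal s) \<and>
      x \<in> lower_seg a b xa xb (c, Fin s))"
    proof
      assume "\<exists>l\<in>lower_levels a b. x \<in> lower_seg a b xa xb l \<and> y \<in> ivl (- \<infinity>) (lo (snd l))"
      then obtain c z where cz: "(c, z) \<in> lower_levels a b" "x \<in> lower_seg a b xa xb (c, z)"
        "y \<in> ivl (- \<infinity>) (lo z)" by auto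
      then have v: "visits a b c z" using lower_levels_iff[OF ne] by simp
      obtain s where "z = Fin s" using visits_Fin[OF v] by blast
      then show "\<exists>c s. visits a b c (Fin s) \<and> y \<in> ivl (- \<infinity>) (ereal s) \<and> x \<in> lower_seg a b xa xb (c, Fin s)"
        using cz v by auto
    next
      assume "\<exists>c s. visits a b c (Fin s) \<and> y \<in> ivl (- \<infinity>) (ereal s) \<and> x \<in> lower_seg a b xa xb (c, Fin s)"
      then obtain c s where "visits a b c (Fin s)" "y \<in> ivl (- \<infinity>) (ereal s)"
        "x \<in> lower_seg a b xa xb (c, Fin s)" by blast
      then show "\<exists>l\<in>lower_levels a b. x \<in> lower_seg a b xa xb l \<and> y \<in> ivl (- \<infinity>) (lo (snd l))"
        using lower_levels_iff[OF ne] by (intro bexI[of _ "(c, Fin s)"]) auto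
    qed
    finally show ?thesis .
  qed
  note R = covered_row[OF finite_live_values(1)[OF assms] X(2)]
  show "(x, Fin t) \<in> A_lower a b \<longleftrightarrow> low_row a b False t x"
    unfolding A R[symmetric] by (auto simp: in_ivl_Fin)
  show "low_row a b False t x \<Longrightarrow> (x, Infty) \<in> A_lower a b"
    unfolding A R[symmetric] by (auto simp: in_ivl_Infty)
qed

lemma A_upper_mirror:
  assumes ne: "(a, b) \<noteq> (- 1, 1)" and fin: "finiteness_condition a b"
  shows "(x, Fin t) \<in> A_upper a b \<longleftrightarrow> up_row a b True t x"
    "up_row a b True t x \<Longrightarrow> (x, Infty) \<in> A_upper a b"
proof -
  interpret m: ab "- b" "- a" by (rule mirror)
  have ne': "(- b, - a) \<noteq> (- 1, 1)" using ne by auto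
  obtain xa xb where X: "x_ab a b = (xa, xb)" "ray_ends (- b) (- a) (- xb) (- xa)"
    using x_ab_good[OF assms] by blast
  have A: "(x, y) \<in> A_upper a b \<longleftrightarrow> (\<exists>c s. visits (- b) (- a) c (Fin s) \<and> neg y \<in> ivl (- \<infinity>) (ereal s) \<and>
      neg x \<in> lower_seg (- b) (- a) (- xb) (- xa) (c, Fin s))" for y
  proof -
    have "(x, y) \<in> A_upper a b \<longleftrightarrow> (\<exists>u\<in>upper_levels a b. x \<in> upper_seg a b xa xb u \<and> y \<in> ivl (hi (snd u)) \<infinity>)"
      unfolding A_upper_def X by simp
    also have "\<dots> \<longleftrightarrow> (\<exists>c s. visits (- b) (- a) c (Fin s) \<and> neg y \<in> ivl (- \<infinity>) (ereal s) \<and>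
      neg x \<in> lower_seg (- b) (- a) (- xb) (- xa) (c, Fin s))"
    proof
      assume "\<exists>u\<in>upper_levels a b. x \<in> upper_seg a b xa xb u \<and> y \<in> ivl (hi (snd u)) \<infinity>"
      then obtain u where u: "u \<in> upper_levels a b" "x \<in> upper_seg a b xa xb u" "y \<in> ivl (hi (snd u)) \<infinity>"
        by blast
      obtain c z where cz: "mirror_level u = (c, z)" by (cases "mirror_level u")
      then have z: "z = neg (snd u)" by (cases u) (auto simp: mirror_level_def)
      have v: "visits (- b) (- a) c z"
        using u(1) upper_levels_iff[OF ne] m.lower_levels_iff[OF ne'] cz by simp
      obtain s where s: "z = Fin s" using m.visits_Fin[OF v] by blast
      then have "snd u = Fin (- s)" using z neg_eq_Fin_iff by metis
      then have "neg y \<in> ivl (- \<infinity>) (ereal s)" using u(3) by (simp add: neg_in_ivl)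
      then show "\<exists>c s. visits (- b) (- a) c (Fin s) \<and> neg y \<in> ivl (- \<infinity>) (ereal s) \<and>
        neg x \<in> lower_seg (- b) (- a) (- xb) (- xa) (c, Fin s)"
        using v s u(2) upper_ends_mirror(3)[OF ne u(1)] cz by auto
    next
      assume "\<exists>c s. visits (- b) (- a) c (Fin s) \<and> neg y \<in> ivl (- \<infinity>) (ereal s) \<and>
        neg x \<in> lower_seg (- b) (- a) (- xb) (- xa) (c, Fin s)"
      then obtain c s where cs: "visits (- b) (- a) c (Fin s)" "neg y \<in> ivl (- \<infinity>) (ereal s)"
        "neg x \<in> lower_seg (- b) (- a) (- xb) (- xa) (c, Fin s)" by blast
      define u where "u = mirror_level (c, Fin s)"
      have u: "u \<in> upper_levels a b"
        using cs(1) upper_levels_iff[OF ne] m.lower_levels_iff[OF ne'] by (simp add: u_def)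
      have "x \<in> upper_seg a b xa xb u"
        using cs(3) upper_ends_mirror(3)[OF ne u] by (simp add: u_def)
      moreover have "y \<in> ivl (hi (snd u)) \<infinity>" using cs(2) by (simp add: u_def mirror_level_def neg_in_ivl)
      ultimately show "\<exists>u\<in>upper_levels a b. x \<in> upper_seg a b xa xb u \<and> y \<in> ivl (hi (snd u)) \<infinity>"
        using u by blast
    qed
    finally show ?thesis .
  qed
  have R: "up_row a b True t x \<longleftrightarrow> (\<exists>c s. visits (- b) (- a) c (Fin s) \<and> - t \<le> s \<and>
      neg x \<in> lower_seg (- b) (- a) (- xb) (- xa) (c, Fin s))"
    using m.covered_row[OF finite_live_values(2)[OF assms] X(2), of "- t" "neg x"]
    by (simp add: up_row_mirror)
  show "(x, Fin t) \<in> A_upper a b \<longleftrightarrow> up_row a b True t x"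
    unfolding A R by (auto simp: in_ivl_Fin)
  show "up_row a b True t x \<Longrightarrow> (x, Infty) \<in> A_upper a b"
    unfolding A R by (auto simp: in_ivl_Infty)
qed

lemma low_row_True_imp_False: "low_row a b True t x \<Longrightarrow> low_row a b False t x"
  using lwall_sides[of t] by (auto simp: low_row_def below_def intro: order.trans)

lemma region_subset_A_set:
  assumes ne: "(a, b) \<noteq> (- 1, 1)" and fin: "finiteness_condition a b"
  shows "region a b \<subseteq> A_set a b"
proof
  fix p assume p: "p \<in> region a b"
  obtain x y where xy: "p = (x, y)" by (cases p)
  have nd: "p \<notin> diagonal" using p xy by (simp add: region_def diagonal_def)
  have "p \<in> A_upper a b \<union> A_lower a b"
  proof (cases y)
    case (Fin t)
    then have "low_row a b True t x \<or> up_row a b True t x" using p xy by (auto simp: region_def)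
    then show ?thesis
      using A_lower_iff(1)[OF assms] A_upper_mirror(1)[OF assms] low_row_True_imp_False xy Fin by blast
  next
    case Infty
    then obtain r where r: "x = Fin r" using p xy by (cases x) (auto simp: region_def)
    show ?thesis
    proof (cases "0 \<le> r")
      case True
      have "hi (lwall a b False (- 1 / b)) \<le> 0"
        by (rule conjunct2[OF lwall_zone1]) (simp add: below_def)
      also have "0 \<le> hi x" using True r by simp
      finally have "low_row a b False (- 1 / b) x" using Sb_less_a1 by (simp add: low_row_def below_def)
      then show ?thesis using A_lower_iff(2)[OF assms] xy Infty by blast
    next
      case False
      have "lo x \<le> 0" using False r by simp
      also have "0 \<le> lo (rwall a b True (- 1 / a))"
        by (rule conjunct1[OF rwall_zone1]) (simp add: below_def)
      finally have "up_row a b True (- 1 / a) x" using b_le_Sa by (simp add: up_row_def below_def)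
      then show ?thesis using A_upper_mirror(2)[OF assms] xy Infty by blast
    qed
  qed
  with nd show "p \<in> A_set a b" by (simp add: A_set_def)
qed

text \<open>
  A row of the rectangular set exceeds the attractor only where the wall jumps, and the jump is covered by segments
  at that level.
\<close>

lemma A_set_minus_region:
  assumes ne: "(a, b) \<noteq> (- 1, 1)" and fin: "finiteness_condition a b"
  shows "A_set a b - region a b \<subseteq> lower_edges a b"
proof
  fix p assume p: "p \<in> A_set a b - region a b"
  obtain x y where xy: "p = (x, y)" by (cases p)
  have nd: "x \<noteq> y" "p \<notin> diagonal" using p xy by (auto simp: A_set_def diagonal_def)
  obtain t where t: "y = Fin t" using p xy nd by (cases y) (auto simp: region_def)
  have nr: "\<not> low_row a b True t x" "\<not> up_row a b True t x" using p xy nd t by (auto simp: region_def)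
  then have "low_row a b False t x"
    using p xy t A_lower_iff(1)[OF assms] A_upper_mirror(1)[OF assms] by (auto simp: A_set_def)
  then have l: "t \<le> a + 1" "hi (lwall a b False t) \<le> hi x" by (auto simp: low_row_def below_def)
  have u: "hi x \<le> hi (lwall a b True t)"
  proof (cases "t < a + 1")
    case True
    then show ?thesis using nr(1) by (auto simp: low_row_def below_def)
  next
    case False
    then have "lwall a b True t = Infty" by (intro lwall_top) (simp add: below_def)
    then show ?thesis by simp
  qed
  have "t \<in> live_values a b"
  proof (rule ccontr)
    assume n: "t \<notin> live_values a b"
    then have "agree False t True t" by (auto simp: agree_def below_def order.order_iff_strict)
    then have "lwall a b False t = lwall a b True t" by (rule lwall_agree)
    moreover have "t < a + 1" using n live_values_start(1) l(1) by (cases "t = a + 1") auto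
    ultimately show False using nr(1) l(2) by (simp add: low_row_def below_def)
  qed
  then obtain c0 where c0: "visits a b c0 (Fin t)" by (auto simp: live_values_def)
  obtain xa xb where X: "x_ab a b = (xa, xb)" "ray_ends a b xa xb" using x_ab_good[OF assms] by blast
  have "x \<in> jump a b t" using l u by (simp add: jump_def arc_def)
  then obtain c where "visits a b c (Fin t)" "x \<in> lower_map a b (c, Fin t) ` ray xa xb c"
    using covered_all[OF ray_ends_covered[OF X(2)] c0] unfolding covered_def by blast
  then have c: "(c, Fin t) \<in> lower_levels a b" "x \<in> lower_seg a b xa xb (c, Fin t)"
    using lower_levels_iff[OF ne] by (auto simp: lower_seg_def)
  then have "(x, Fin t) \<in> (\<Union>l\<in>lower_levels a b. lower_seg a b xa xb l \<times> {snd l})"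
    by (intro UN_I[of "(c, Fin t)"]) auto
  then show "p \<in> lower_edges a b" using nd xy t by (simp add: lower_edges_def X)
qed

end

theorem theorem6p4:
  fixes a b :: real
  assumes "(a, b) \<in> param_set"
    and "a \<noteq> 0" and "b \<noteq> 0" and "(a, b) \<noteq> (- 1, 1)"
    and "finiteness_condition a b"
  shows "attractor a b \<subseteq> A_set a b \<and> A_set a b - attractor a b \<subseteq> lower_edges a b"
proof -
  interpret ab a b
    using assms(1-3) by unfold_locales (auto simp: param_set_def)
  show ?thesis
    unfolding attractor_eq_region
    using region_subset_A_set[OF assms(4,5)] A_set_minus_region[OF assms(4,5)] by blast
qed

end
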